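(* Let $N\in\{2,3\}$. For every $c>0$ there exists $T^*>0$ such that for every $T\in(0,T^* )$, any $T$-periodic solution $\psi:\mathbb{R}^N\to\mathbb{C}$ of $$ ic\,\partial_{x_1}\psi+\Delta\psi+(1-|\psi|^2)\psi=0 $$ is necessarily constant.
   Context: $T$-periodic means $T$-periodic in each of the variables $x_1,\dots,x_N$. Solutions are understood in the weak sense, in the space $H^1_T(\mathbb{R}^N)$ of complex-valued functions on $\mathbb{R}^N$ that are $T$-periodic in each variable and of class $H^1_{loc}$. *)

theory Defs
  imports "HOL-Analysis.Analysis"
begin

definition partial_deriv :: "'n::finite \<Rightarrow> (real ^ 'n \<Rightarrow> complex) \<Rightarrow> real ^ 'n \<Rightarrow> complex"
  where "partial_deriv i f x = frechet_derivative f (at x) (axis i 1)"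

primrec Ck :: "nat \<Rightarrow> (real ^ 'n::finite \<Rightarrow> complex) \<Rightarrow> bool"
  where
    "Ck 0 f \<longleftrightarrow> continuous_on UNIV f"
  | "Ck (Suc k) f \<longleftrightarrow> f differentiable_on UNIV \<and> (\<forall>i. Ck k (partial_deriv i f))"

definition test_functions :: "(real ^ 'n::finite \<Rightarrow> complex) set"
  where "test_functions = {\<phi>. (\<forall>k. Ck k \<phi>) \<and> compact (closure {x. \<phi> x \<noteq> 0})}"

definition L2_loc :: "(real ^ 'n::finite \<Rightarrow> complex) set"
  where "L2_loc = {f. f \<in> borel_measurable lebesgue \<and>
     (\<forall>K. compact K \<longrightarrow> set_integrable lebesgue K (\<lambda>x. (cmod (f x))\<^sup>2))}"

(* The integrals are guaranteed to exist only for locally integrable \<psi> and g; below both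
   are always in L2_loc. *)
definition has_weak_partial ::
  "'n::finite \<Rightarrow> (real ^ 'n \<Rightarrow> complex) \<Rightarrow> (real ^ 'n \<Rightarrow> complex) \<Rightarrow> bool"
  where "has_weak_partial i \<psi> g \<longleftrightarrow>
    (\<forall>\<phi>\<in>test_functions.
       (LINT x|lebesgue. \<psi> x * partial_deriv i \<phi> x) = - (LINT x|lebesgue. g x * \<phi> x))"

definition H1_loc :: "(real ^ 'n::finite \<Rightarrow> complex) set"
  where "H1_loc = {\<psi> \<in> L2_loc. \<forall>i. \<exists>g\<in>L2_loc. has_weak_partial i \<psi> g}"

(* Elements of the Sobolev space are represented by functions, considered up to null sets,
   so periodicity is required almost everywhere. *)
definition H1_per :: "real \<Rightarrow> (real ^ 'n::finite \<Rightarrow> complex) set"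
  where "H1_per T =
    {\<psi> \<in> H1_loc. \<forall>i. AE x in lebesgue. \<psi> (x + T *\<^sub>R axis i 1) = \<psi> x}"

(* Weak form of  i c d/dx_1 \<psi> + Laplace \<psi> + (1 - |\<psi>|^2) \<psi> = 0.  The functions g i are the weak
   partial derivatives of \<psi>, unique up to null sets.  The index 1 of the first coordinate makes
   sense for the numeral index types 2 and 3.  Using has_bochner_integral, rather than an
   equation between integrals, includes that the integral exists. *)
definition weak_periodic_solution ::
  "real \<Rightarrow> real \<Rightarrow> (real ^ 'n::{finite,one} \<Rightarrow> complex) \<Rightarrow> bool"
  where "weak_periodic_solution c T \<psi> \<longleftrightarrow>
    \<psi> \<in> H1_per T \<and>
    (\<exists>g. (\<forall>i. g i \<in> L2_loc \<and> has_weak_partial i \<psi> (g i)) \<and>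
      (\<forall>\<phi>\<in>test_functions.
         has_bochner_integral lebesgue
           (\<lambda>x. \<i> * of_real c * g 1 x * \<phi> x
                - (\<Sum>i\<in>UNIV. g i x * partial_deriv i \<phi> x)
                + of_real (1 - (cmod (\<psi> x))\<^sup>2) * \<psi> x * \<phi> x) 0))"

definition ae_constant :: "(real ^ 'n::finite \<Rightarrow> complex) \<Rightarrow> bool"
  where "ae_constant \<psi> \<longleftrightarrow> (\<exists>a. AE x in lebesgue. \<psi> x = a)"

end

theory Submission
  imports Defs "HOL-Computational_Algebra.Polynomial"
begin

text \<open>Write F(z) = |z|^2 z.  The map F is monotone, being the gradient of the convex function |z|^4 / 4.
Let \<psi> be a T-periodic solution, let w be the difference \<psi>(x + s e) - \<psi>(x) of \<psi> and a
translate of it in a coordinate direction e, and let H be the corresponding difference of F(\<psi>).  Then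
  i c d/dx_1 w + Laplace w + w = H,   and   H \<bullet> w \<ge> 0 pointwise
for the real inner product \<bullet> of complex numbers.  Testing with w over a cube Q of periods and using
Young's inequality gives  \<integral> |grad w|^2 \<le> (c^2 + 2) \<integral> |w|^2,  hence
  \<integral> |w(x + t e') - w(x)|^2 \<le> t^2 (c^2 + 2) \<integral> |w|^2
for every t > 0 and every coordinate direction e'.  Now let s = T/m.  The m translates w(x + k s e) with
k < m add up to \<psi>(x + T e) - \<psi>(x) = 0, so w is the average of the m differences
w(x) - w(x + k s e), all of which are translations by less than T.  Therefore
\<integral> |w|^2 \<le> T^2 (c^2 + 2) \<integral> |w|^2, and w = 0 as soon as T^2 (c^2 + 2) < 1.  So \<psi> has the
period T/m in every coordinate direction for every m, and this forces it to be constant.  The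
threshold is 1 / sqrt (c^2 + 2).

What has to be justified is testing with w: the admissible test functions are smooth with compact
support, and H is only locally integrable, so that integrability of the product of H and w is not clear a priori.
Three devices deal with this.

The equation is mollified (\<open>weak_solution_mollified\<close>), which turns it into a pointwise
identity between continuous periodic functions.

The mollified w is tested not with itself but with its projection P w onto a ball of radius R.
This is bounded, it is a nonnegative multiple of w, so that H \<bullet> P w \<ge> 0 persists, and the projection is
firmly nonexpansive: (a - b) \<bullet> (P a - P b) \<ge> |P a - P b|^2.

Derivatives are replaced by difference quotients of step h.  Integration by parts is then merely
translation invariance of the integral over Q, and no derivative of P w is ever taken; firm
nonexpansiveness takes the place of the chain rule (\<open>discrete_energy_inequality\<close>).

Letting h tend to 0 gives \<open>energy_inequality\<close>, removing the mollification gives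
\<open>truncated_translation_estimate\<close>, and letting R tend to infinity gives
\<open>translation_estimate\<close>, the displayed estimate above.  The averaging argument is
\<open>fractional_period_on_cube\<close>, and \<open>mollified_solution_constant\<close> concludes.\<close>


section \<open>Test functions\<close>

text \<open>An affine substitution only multiplies partial derivatives by a constant.  The constant factor b is
carried along so that the statement can be iterated over the order of differentiability.\<close>

lemma partial_deriv_affine:
  fixes \<phi> :: "real ^ 'n::finite \<Rightarrow> complex"
  assumes "\<phi> differentiable_on UNIV"
  shows "(\<lambda>y. b * \<phi> (x + r *\<^sub>R y)) differentiable_on UNIV"
    and "partial_deriv i (\<lambda>y. b * \<phi> (x + r *\<^sub>R y))
           = (\<lambda>y. (b * of_real r) * partial_deriv i \<phi> (x + r *\<^sub>R y))"
proof -
  have D: "((\<lambda>y. b * \<phi> (x + r *\<^sub>R y)) has_derivative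
            (\<lambda>h. b * frechet_derivative \<phi> (at (x + r *\<^sub>R y)) (r *\<^sub>R h))) (at y)" for y
  proof -
    have 1: "(\<phi> has_derivative frechet_derivative \<phi> (at (x + r *\<^sub>R y))) (at (x + r *\<^sub>R y))"
      using assms by (simp add: differentiable_on_def frechet_derivative_works)
    have 2: "((\<lambda>y. x + r *\<^sub>R y) has_derivative (\<lambda>h. r *\<^sub>R h)) (at y)"
      by (auto intro!: derivative_eq_intros)
    show ?thesis
      using has_derivative_mult_right[OF has_derivative_compose[OF 2 1], of b] by simp
  qed
  show "(\<lambda>y. b * \<phi> (x + r *\<^sub>R y)) differentiable_on UNIV"
    unfolding differentiable_on_def using D differentiableI by blast
  show "partial_deriv i (\<lambda>y. b * \<phi> (x + r *\<^sub>R y))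
           = (\<lambda>y. (b * of_real r) * partial_deriv i \<phi> (x + r *\<^sub>R y))"
  proof
    fix y
    have "linear (frechet_derivative \<phi> (at (x + r *\<^sub>R y)))"
      using assms by (simp add: differentiable_on_def linear_frechet_derivative)
    then have "frechet_derivative \<phi> (at (x + r *\<^sub>R y)) (r *\<^sub>R axis i 1)
        = of_real r * frechet_derivative \<phi> (at (x + r *\<^sub>R y)) (axis i 1)"
      using linear_cmul scaleR_conv_of_real by metis
    then show "partial_deriv i (\<lambda>y. b * \<phi> (x + r *\<^sub>R y)) y
           = (b * of_real r) * partial_deriv i \<phi> (x + r *\<^sub>R y)"
      unfolding partial_deriv_def frechet_derivative_at[OF D, symmetric] by (simp only: mult.assoc)
  qed
qed

lemma Ck_affine: "Ck k \<phi> \<Longrightarrow> Ck k (\<lambda>y. b * \<phi> (x + r *\<^sub>R y))"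
proof (induction k arbitrary: \<phi> b)
  case 0
  have "continuous_on UNIV (\<lambda>y. x + r *\<^sub>R y)" by (intro continuous_intros)
  then have "continuous_on UNIV (\<lambda>y. \<phi> (x + r *\<^sub>R y))"
    using 0 continuous_on_compose2[of UNIV \<phi>] by fastforce
  then show ?case unfolding Ck.simps by (rule continuous_on_mult_left)
next
  case (Suc k)
  then have d: "\<phi> differentiable_on UNIV" and k: "Ck k (partial_deriv i \<phi>)" for i by simp_all
  have "Ck k (partial_deriv i (\<lambda>y. b * \<phi> (x + r *\<^sub>R y)))" for i
    unfolding partial_deriv_affine(2)[OF d] by (rule Suc.IH[OF k])
  with partial_deriv_affine(1)[OF d] show ?case unfolding Ck.simps by blast
qed

lemma test_functions_affine:
  assumes "\<phi> \<in> test_functions" "r \<noteq> 0"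
  shows "(\<lambda>y. b * \<phi> (x + r *\<^sub>R y)) \<in> test_functions"
proof -
  have "bounded {x. \<phi> x \<noteq> 0}"
    using assms(1) bounded_subset[OF compact_imp_bounded closure_subset]
    unfolding test_functions_def by blast
  then have "bounded ((\<lambda>z. (1/r) *\<^sub>R (z - x)) ` {x. \<phi> x \<noteq> 0})"
    using bounded_scaling[of "(\<lambda>z. z - x) ` {x. \<phi> x \<noteq> 0}" "1/r"] bounded_translation_minus[of "{x. \<phi> x \<noteq> 0}" "x"]
    by (simp only: image_image)
  moreover have "{y. b * \<phi> (x + r *\<^sub>R y) \<noteq> 0} \<subseteq> (\<lambda>z. (1/r) *\<^sub>R (z - x)) ` {x. \<phi> x \<noteq> 0}"
    using assms(2) by (auto intro!: rev_image_eqI)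
  ultimately have "bounded {y. b * \<phi> (x + r *\<^sub>R y) \<noteq> 0}"
    by (rule bounded_subset)
  then show ?thesis
    using assms(1) by (simp add: test_functions_def Ck_affine compact_closure del: Ck.simps)
qed

text \<open>The support does not grow: outside the closed support the function vanishes on an open set, and so
does its derivative.\<close>

lemma test_functions_partial_deriv:
  assumes "\<phi> \<in> test_functions"
  shows "partial_deriv i \<phi> \<in> test_functions"
proof -
  have k: "Ck k (partial_deriv i \<phi>)" for k
  proof -
    have "Ck (Suc k) \<phi>" using assms unfolding test_functions_def by blast
    then show ?thesis by simp
  qed
  have sub: "{x. partial_deriv i \<phi> x \<noteq> 0} \<subseteq> closure {x. \<phi> x \<noteq> 0}"
  proof (intro subsetI, rule ccontr)
    fix x assume nz: "x \<in> {x. partial_deriv i \<phi> x \<noteq> 0}" and x: "x \<notin> closure {x. \<phi> x \<noteq> 0}"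
    have "(\<phi> has_derivative (\<lambda>_. 0)) (at x)"
    proof (rule has_derivative_transform_within_open[of "\<lambda>_. 0"])
      show "open (- closure {x. \<phi> x \<noteq> 0})" by auto
      show "x \<in> - closure {x. \<phi> x \<noteq> 0}" using x by auto
      show "0 = \<phi> y" if "y \<in> - closure {x. \<phi> x \<noteq> 0}" for y
        using that closure_subset[of "{x. \<phi> x \<noteq> 0}"] by auto
    qed auto
    then show False
      using nz frechet_derivative_at[of \<phi> "\<lambda>_. 0" x] by (auto simp: partial_deriv_def)
  qed
  have "bounded (closure {x. \<phi> x \<noteq> 0})"
    using assms by (simp add: test_functions_def compact_imp_bounded)
  with k sub show ?thesis
    using bounded_subset[of _ "{x. partial_deriv i \<phi> x \<noteq> 0}"]
    unfolding test_functions_def compact_closure by blast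
qed

lemma test_functions_continuous: "\<phi> \<in> test_functions \<Longrightarrow> continuous_on UNIV \<phi>"
  unfolding test_functions_def using Ck.simps(1) by blast

lemma test_functions_differentiable: "\<phi> \<in> test_functions \<Longrightarrow> \<phi> differentiable_on UNIV"
  unfolding test_functions_def using Ck.simps(2)[of 0 \<phi>] by blast

lemma test_functions_compact_support:
  assumes "\<phi> \<in> test_functions" shows "\<exists>L>0. \<forall>x. \<phi> x \<noteq> 0 \<longrightarrow> norm x \<le> L"
proof -
  have "bounded (closure {x. \<phi> x \<noteq> 0})"
    using assms by (simp add: test_functions_def compact_imp_bounded)
  then show ?thesis
    using bounded_subset[OF _ closure_subset, of "{x. \<phi> x \<noteq> 0}"] unfolding bounded_pos by blast
qed

text \<open>Convolution kernels are real, so that Taylor's theorem with a real remainder applies to them, while the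
weak formulation is tested with complex functions.\<close>

definition real_tests :: "(real ^ 'n::finite \<Rightarrow> real) set"
  where "real_tests = {\<rho>. (\<lambda>x. complex_of_real (\<rho> x)) \<in> test_functions}"

definition real_partial :: "'n::finite \<Rightarrow> (real ^ 'n \<Rightarrow> real) \<Rightarrow> real ^ 'n \<Rightarrow> real"
  where "real_partial i \<rho> x = Re (partial_deriv i (\<lambda>x. complex_of_real (\<rho> x)) x)"

text \<open>The imaginary part of the derivative is the derivative of the imaginary part, which is zero.\<close>

lemma partial_deriv_of_real:
  assumes "\<rho> \<in> real_tests"
  shows "partial_deriv i (\<lambda>x. complex_of_real (\<rho> x)) x = of_real (real_partial i \<rho> x)"
proof -
  let ?f = "\<lambda>x. complex_of_real (\<rho> x)"
  have D: "(?f has_derivative frechet_derivative ?f (at x)) (at x)"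
    using test_functions_differentiable[of ?f] assms
    by (simp add: real_tests_def differentiable_on_def frechet_derivative_works)
  have "((\<lambda>x. Im (?f x)) has_derivative (\<lambda>h. Im (frechet_derivative ?f (at x) h))) (at x)"
    using bounded_linear.has_derivative[OF bounded_linear_Im D] .
  then have "((\<lambda>x. 0::real) has_derivative (\<lambda>h. Im (frechet_derivative ?f (at x) h))) (at x)"
    by simp
  then have "(\<lambda>h. Im (frechet_derivative ?f (at x) h)) = (\<lambda>h. 0)"
    using has_derivative_unique[OF _ has_derivative_const] by blast
  then show ?thesis
    by (auto simp: real_partial_def partial_deriv_def complex_eq_iff fun_eq_iff)
qed

lemma real_tests_real_partial:
  assumes "\<rho> \<in> real_tests" shows "real_partial i \<rho> \<in> real_tests"
  using test_functions_partial_deriv[of "\<lambda>x. complex_of_real (\<rho> x)" i] assms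
    partial_deriv_of_real[OF assms, of i, THEN ext[where f="partial_deriv i (\<lambda>x. complex_of_real (\<rho> x))"]]
  unfolding real_tests_def by (metis mem_Collect_eq)

lemma real_tests_continuous:
  assumes "\<rho> \<in> real_tests" shows "continuous_on UNIV \<rho>"
proof -
  have "continuous_on UNIV (\<lambda>x. complex_of_real (\<rho> x))"
    using assms test_functions_continuous unfolding real_tests_def by blast
  from continuous_on_Re[OF this] show ?thesis by simp
qed

lemma real_tests_support: "\<rho> \<in> real_tests \<Longrightarrow> \<exists>L>0. \<forall>x. \<rho> x \<noteq> 0 \<longrightarrow> norm x \<le> L"
  using test_functions_compact_support[of "\<lambda>x. complex_of_real (\<rho> x)"]
  unfolding real_tests_def by simp

lemma continuous_compact_support_bounded:
  fixes \<rho> :: "real ^ 'n \<Rightarrow> real"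
  assumes "continuous_on UNIV \<rho>" "\<forall>x. \<rho> x \<noteq> 0 \<longrightarrow> norm x \<le> L"
  shows "\<exists>M>0. \<forall>x. \<bar>\<rho> x\<bar> \<le> M"
proof -
  have "compact (\<rho> ` cball 0 L)"
    using assms(1) by (intro compact_continuous_image) (auto intro: continuous_on_subset)
  then obtain M where M: "M > 0" "\<forall>x\<in>cball 0 L. \<bar>\<rho> x\<bar> \<le> M"
    using compact_imp_bounded[of "\<rho> ` cball 0 L"] unfolding bounded_pos by auto
  have "\<bar>\<rho> x\<bar> \<le> M" for x
  proof (cases "\<rho> x = 0")
    case False
    then show ?thesis using assms(2) M by auto
  qed (use M in auto)
  then show ?thesis using M(1) by auto
qed

lemma real_tests_bounded: "\<rho> \<in> real_tests \<Longrightarrow> \<exists>M>0. \<forall>x. \<bar>\<rho> x\<bar> \<le> M"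
  using continuous_compact_support_bounded real_tests_continuous real_tests_support by metis

lemma real_tests_affine:
  assumes "\<rho> \<in> real_tests" "r \<noteq> 0"
  shows "(\<lambda>y. b * \<rho> (x + r *\<^sub>R y)) \<in> real_tests"
    and "real_partial i (\<lambda>y. b * \<rho> (x + r *\<^sub>R y)) = (\<lambda>y. b * r * real_partial i \<rho> (x + r *\<^sub>R y))"
proof -
  have t: "(\<lambda>x. complex_of_real (\<rho> x)) \<in> test_functions"
    using assms by (simp add: real_tests_def)
  show "(\<lambda>y. b * \<rho> (x + r *\<^sub>R y)) \<in> real_tests"
    using test_functions_affine[OF t assms(2), of "of_real b" x] by (simp add: real_tests_def)
  show "real_partial i (\<lambda>y. b * \<rho> (x + r *\<^sub>R y)) = (\<lambda>y. b * r * real_partial i \<rho> (x + r *\<^sub>R y))"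
    using fun_cong[OF partial_deriv_affine(2)[OF test_functions_differentiable[OF t], of i "of_real b" x r]]
    by (auto simp: real_partial_def fun_eq_iff)
qed

lemma real_tests_line_derivative:
  assumes "\<rho> \<in> real_tests"
  shows "((\<lambda>t. \<rho> (x + t *\<^sub>R axis i 1)) has_real_derivative real_partial i \<rho> (x + t *\<^sub>R axis i 1)) (at t)"
proof -
  let ?f = "\<lambda>x. complex_of_real (\<rho> x)" and ?y = "x + t *\<^sub>R axis i 1"
  have D: "(?f has_derivative frechet_derivative ?f (at ?y)) (at ?y)"
    using test_functions_differentiable[of ?f] assms
    by (simp add: real_tests_def differentiable_on_def frechet_derivative_works)
  have L: "((\<lambda>t. x + t *\<^sub>R axis i 1) has_derivative (\<lambda>h. h *\<^sub>R axis i 1)) (at t)"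
    by (auto intro!: derivative_eq_intros)
  have "((\<lambda>t. Re (?f (x + t *\<^sub>R axis i 1))) has_derivative
         (\<lambda>h. Re (frechet_derivative ?f (at ?y) (h *\<^sub>R axis i 1)))) (at t)"
    using bounded_linear.has_derivative[OF bounded_linear_Re has_derivative_compose[OF L D]] .
  moreover have "Re (frechet_derivative ?f (at ?y) (h *\<^sub>R axis i 1)) = real_partial i \<rho> ?y * h" for h
    unfolding real_partial_def partial_deriv_def
    by (subst linear_cmul[OF has_derivative_linear[OF D]]) simp
  ultimately show ?thesis
    by (simp add: has_field_derivative_def)
qed

section \<open>A smooth bump function\<close>

text \<open>Functions of the form p(t) q(t)^m exp(-q(t)) with q(t) = 1 / (1 - t^2), extended by zero.  This family is
closed under differentiation, so smoothness of the standard bump exp(-q), the case p = 1 and m = 0, follows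
without a formula for its higher derivatives.\<close>

definition bump_term :: "real poly \<Rightarrow> nat \<Rightarrow> real \<Rightarrow> real"
  where "bump_term p m t = (if \<bar>t\<bar> < 1 then poly p t * (1 / (1 - t\<^sup>2)) ^ m * exp (- (1 / (1 - t\<^sup>2))) else 0)"

text \<open>Since q' = 2 t q^2, the derivative of p q^m exp(-q) is (p' (1 - t^2)^2 + 2 t (m p (1 - t^2) - p)) q^(m+2) exp(-q).\<close>

definition bump_deriv_poly :: "real poly \<Rightarrow> nat \<Rightarrow> real poly"
  where "bump_deriv_poly p m = pderiv p * [:1, 0, -1:]\<^sup>2
           + smult 2 ([:0, 1:] * (smult (real m) p * [:1, 0, -1:] - p))"

lemma power_div_fact_le_exp:
  fixes x :: real assumes "x \<ge> 0" shows "x ^ n / fact n \<le> exp x"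
proof -
  have "(\<Sum>k\<in>{n}. x ^ k /\<^sub>R fact k) \<le> (\<Sum>k. x ^ k /\<^sub>R fact k)"
    using assms by (intro sum_le_suminf summable_exp_generic) auto
  then show ?thesis by (simp add: exp_def field_simps)
qed

text \<open>Quadratic decay at the points 1 and -1, which makes the derivative there equal to zero: exp(-q) is at most
(m+2)! / q^(m+2), and two of these powers are left over after cancelling q^m.\<close>

lemma bump_term_bound:
  "\<exists>C\<ge>0. \<forall>t. \<bar>t\<bar> \<le> 1 \<longrightarrow> \<bar>bump_term p m t\<bar> \<le> C * (1 - t\<^sup>2)\<^sup>2"
proof -
  have "compact (poly p ` {-1..1})"
    by (intro compact_continuous_image continuous_intros) auto
  then obtain P where P: "P > 0" "\<forall>x\<in>{-1..1}. \<bar>poly p x\<bar> \<le> P"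
    using compact_imp_bounded[of "poly p ` {-1..1}"] unfolding bounded_pos by auto
  have "\<bar>bump_term p m t\<bar> \<le> P * fact (m+2) * (1 - t\<^sup>2)\<^sup>2" if "\<bar>t\<bar> \<le> 1" for t
  proof (cases "\<bar>t\<bar> < 1")
    case True
    define q where "q = 1 / (1 - t\<^sup>2)"
    have t2: "1 - t\<^sup>2 > 0" using True by (simp add: abs_square_less_1)
    then have q: "q > 0" by (simp add: q_def)
    have "q ^ m * exp (- q) \<le> fact (m+2) * (1 - t\<^sup>2)\<^sup>2"
    proof -
      have "q ^ (m+2) \<le> fact (m+2) * exp q"
        using power_div_fact_le_exp[of q "m+2"] by (simp only: pos_divide_le_eq fact_gt_zero mult.commute less_imp_le[OF q] simp_thms)
      then have "q ^ m * exp (- q) * q\<^sup>2 \<le> fact (m+2)"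
        using q by (simp add: power_add exp_minus field_simps power2_eq_square)
      then have "q ^ m * exp (- q) \<le> fact (m+2) / q\<^sup>2"
        using q by (simp add: field_simps)
      also have "\<dots> = fact (m+2) * (1 - t\<^sup>2)\<^sup>2"
        using t2 by (simp add: q_def power_divide)
      finally show ?thesis .
    qed
    moreover have pt: "\<bar>poly p t\<bar> \<le> P" using P(2) that by (simp add: abs_le_iff)
    ultimately have "\<bar>poly p t\<bar> * (q ^ m * exp (- q)) \<le> P * (fact (m+2) * (1 - t\<^sup>2)\<^sup>2)"
      using P(1) q by (intro mult_mono[OF pt]) auto
    then show ?thesis
      using True q by (simp add: bump_term_def abs_mult q_def[symmetric] mult.assoc)
  qed (use P in \<open>simp add: bump_term_def\<close>)
  then show ?thesis using P by (intro exI[of _ "P * fact (m+2)"]) auto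
qed

text \<open>Inside the interval this is the product rule, outside everything vanishes, and at the two end points
\<open>bump_term_bound\<close> shows that the difference quotient tends to zero.\<close>

lemma bump_term_has_derivative:
  "(bump_term p m has_real_derivative bump_term (bump_deriv_poly p m) (m + 2) t) (at t)"
proof -
  consider "\<bar>t\<bar> < 1" | "\<bar>t\<bar> > 1" | "\<bar>t\<bar> = 1" by linarith
  then show ?thesis
  proof cases
    case 1
    have t2: "1 - t\<^sup>2 > 0" using 1 by (simp add: abs_square_less_1)
    let ?f = "\<lambda>t. poly p t * (1 / (1 - t\<^sup>2)) ^ m * exp (- (1 / (1 - t\<^sup>2)))"
    define q where "q = 1 / (1 - t\<^sup>2)"
    have qt: "(1 - t\<^sup>2) * q = 1" using t2 by (simp add: q_def)
    have dq: "((\<lambda>t. 1 / (1 - t\<^sup>2)) has_real_derivative 2 * t * q\<^sup>2) (at t)"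
      using t2 by (auto intro!: derivative_eq_intros simp: q_def power2_eq_square field_simps)
    have "(?f has_real_derivative
        (poly (pderiv p) t * q ^ m + real m * q ^ (m - 1) * (2 * t * q\<^sup>2) * poly p t) * exp (- q)
          + exp (- q) * (- (2 * t * q\<^sup>2)) * (poly p t * q ^ m)) (at t)"
      unfolding q_def[symmetric]
      by (rule derivative_eq_intros dq poly_DERIV refl | simp add: q_def[symmetric])+
    moreover have "(poly (pderiv p) t * q ^ m + real m * q ^ (m - 1) * (2 * t * q\<^sup>2) * poly p t) * exp (- q)
          + exp (- q) * (- (2 * t * q\<^sup>2)) * (poly p t * q ^ m)
        = bump_term (bump_deriv_poly p m) (m + 2) t"
    proof -
      have a: "poly (pderiv p) t * q ^ m = poly (pderiv p) t * (1 - t\<^sup>2)\<^sup>2 * q ^ (m + 2)"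
      proof -
        have "(1 - t\<^sup>2)\<^sup>2 * q ^ (m + 2) = q ^ m * ((1 - t\<^sup>2) * q)\<^sup>2"
          by (simp add: power_add power2_eq_square mult_ac)
        then show ?thesis by (simp add: qt)
      qed
      have b: "real m * q ^ (m - 1) * (2 * t * q\<^sup>2) = real m * (1 - t\<^sup>2) * 2 * t * q ^ (m + 2)"
      proof (cases m)
        case (Suc k)
        have "(1 - t\<^sup>2) * q ^ (m + 2) = q ^ k * q\<^sup>2 * ((1 - t\<^sup>2) * q)"
          by (simp add: Suc power_add power2_eq_square)
        then have "(1 - t\<^sup>2) * q ^ (m + 2) = q ^ k * q\<^sup>2" unfolding qt by simp
        then show ?thesis by (simp add: Suc mult_ac del: power_Suc)
      qed simp
      show ?thesis
        unfolding a b using 1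
        by (simp add: bump_term_def bump_deriv_poly_def q_def[symmetric] power_add)
           (simp add: algebra_simps power2_eq_square)
    qed
    ultimately have "(?f has_real_derivative bump_term (bump_deriv_poly p m) (m + 2) t) (at t)"
      by simp
    then show ?thesis
      by (rule has_field_derivative_transform_within_open[of _ _ _ "{-1<..<1}"])
         (use 1 in \<open>auto simp: bump_term_def\<close>)
  next
    case 2
    have "((\<lambda>t. 0) has_real_derivative 0) (at t)" by simp
    then have "(bump_term p m has_real_derivative 0) (at t)"
      by (rule has_field_derivative_transform_within_open[of _ _ _ "- {-1..1}"])
         (use 2 in \<open>auto simp: bump_term_def\<close>)
    then show ?thesis using 2 by (simp add: bump_term_def)
  next
    case 3
    obtain C where C: "C \<ge> 0" "\<And>t. \<bar>t\<bar> \<le> 1 \<Longrightarrow> \<bar>bump_term p m t\<bar> \<le> C * (1 - t\<^sup>2)\<^sup>2"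
      using bump_term_bound by metis
    have b: "\<bar>bump_term p m y\<bar> \<le> 4 * C * (y - t)\<^sup>2" for y
    proof (cases "\<bar>y\<bar> \<le> 1")
      case True
      have "t\<^sup>2 = 1" using 3 by (metis abs_1 abs_eq_iff power2_eq_iff one_power2 power2_abs)
      then have "(1 - y\<^sup>2)\<^sup>2 = (y - t)\<^sup>2 * (t + y)\<^sup>2"
        by (simp add: power2_eq_square algebra_simps)
      moreover have "(t + y)\<^sup>2 \<le> 2\<^sup>2"
        using True 3 by (intro abs_le_square_iff[THEN iffD1]) auto
      ultimately have "(1 - y\<^sup>2)\<^sup>2 \<le> (y - t)\<^sup>2 * 4"
        by (simp add: mult_left_mono)
      then show ?thesis
        using C(2)[OF True] mult_left_mono[OF _ C(1), of "(1 - y\<^sup>2)\<^sup>2" "(y - t)\<^sup>2 * 4"] by simp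
    qed (use C in \<open>simp add: bump_term_def\<close>)
    have "((\<lambda>y. (bump_term p m y - bump_term p m t) / (y - t)) \<longlongrightarrow> 0) (at t)"
    proof (rule Lim_null_comparison)
      show "\<forall>\<^sub>F y in at t. norm ((bump_term p m y - bump_term p m t) / (y - t)) \<le> 4 * C * \<bar>y - t\<bar>"
      proof (rule always_eventually, rule allI)
        fix y
        show "norm ((bump_term p m y - bump_term p m t) / (y - t)) \<le> 4 * C * \<bar>y - t\<bar>"
        proof (cases "y = t")
          case False
          have "\<bar>bump_term p m y\<bar> \<le> 4 * C * \<bar>y - t\<bar> * \<bar>y - t\<bar>"
            using b[of y] by (simp add: power2_eq_square mult.assoc flip: abs_mult)
          then show ?thesis
            using False 3 by (simp add: bump_term_def[of p m t] abs_divide pos_divide_le_eq)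
        qed simp
      qed
      show "((\<lambda>y. 4 * C * \<bar>y - t\<bar>) \<longlongrightarrow> 0) (at t)"
        by (auto intro!: tendsto_eq_intros)
    qed
    then show ?thesis
      using 3 by (simp add: has_field_derivative_iff bump_term_def[of "bump_deriv_poly p m"])
  qed
qed

text \<open>A partial derivative changes only one factor, and this factor stays in the family \<open>bump_term\<close>.
So a statement about all products of the family can be proved by induction on k.\<close>

lemma Ck_bump_product:
  "Ck k (\<lambda>x :: real ^ 'n::finite. complex_of_real (\<Prod>j\<in>UNIV. bump_term (p j) (m j) (x $ j)))"
proof (induction k arbitrary: p m)
  have D: "((\<lambda>x :: real ^ 'n. complex_of_real (\<Prod>j\<in>UNIV. bump_term (p j) (m j) (x $ j))) has_derivative
       (\<lambda>h. complex_of_real (\<Sum>i\<in>UNIV. bump_term (bump_deriv_poly (p i) (m i)) (m i + 2) (x $ i) * (h $ i)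
          * (\<Prod>j\<in>UNIV - {i}. bump_term (p j) (m j) (x $ j))))) (at x)" for p m x
  proof -
    have "((\<lambda>x :: real ^ 'n. bump_term (p j) (m j) (x $ j)) has_derivative
       (\<lambda>h. bump_term (bump_deriv_poly (p j) (m j)) (m j + 2) (x $ j) * (h $ j))) (at x)" for j
      using has_derivative_compose[OF bounded_linear_imp_has_derivative[OF bounded_linear_vec_nth]
          bump_term_has_derivative[unfolded has_field_derivative_def]] .
    from has_derivative_of_real[OF has_derivative_prod[OF this]]
    show ?thesis .
  qed
  {
    case 0
    have "continuous_on UNIV (\<lambda>x :: real ^ 'n. complex_of_real (\<Prod>j\<in>UNIV. bump_term (p j) (m j) (x $ j)))"
      by (metis (no_types, lifting) D has_derivative_continuous continuous_at_imp_continuous_on)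
    then show ?case by simp
  next
    case (Suc k)
    have "partial_deriv i (\<lambda>x :: real ^ 'n. complex_of_real (\<Prod>j\<in>UNIV. bump_term (p j) (m j) (x $ j)))
       = (\<lambda>x. complex_of_real (\<Prod>j\<in>UNIV. bump_term ((p(i := bump_deriv_poly (p i) (m i))) j)
                ((m(i := m i + 2)) j) (x $ j)))" for i
    proof
      fix x :: "real ^ 'n"
      have "(\<Sum>l\<in>UNIV. bump_term (bump_deriv_poly (p l) (m l)) (m l + 2) (x $ l) * ((axis i 1 :: real ^ 'n) $ l)
          * (\<Prod>j\<in>UNIV - {l}. bump_term (p j) (m j) (x $ j)))
        = (\<Sum>l\<in>{i}. bump_term (bump_deriv_poly (p l) (m l)) (m l + 2) (x $ l)
          * (\<Prod>j\<in>UNIV - {l}. bump_term (p j) (m j) (x $ j)))"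
        by (rule sum.mono_neutral_cong_right) (auto simp: axis_def)
      also have "\<dots> = (\<Prod>j\<in>UNIV. bump_term ((p(i := bump_deriv_poly (p i) (m i))) j)
                ((m(i := m i + 2)) j) (x $ j))"
        by (subst prod.remove[of UNIV i]) (auto intro!: prod.cong)
      finally show "partial_deriv i (\<lambda>x :: real ^ 'n. complex_of_real (\<Prod>j\<in>UNIV. bump_term (p j) (m j) (x $ j))) x
       = complex_of_real (\<Prod>j\<in>UNIV. bump_term ((p(i := bump_deriv_poly (p i) (m i))) j)
                ((m(i := m i + 2)) j) (x $ j))"
        unfolding partial_deriv_def frechet_derivative_at[OF D, symmetric] by simp
    qed
    moreover have "(\<lambda>x :: real ^ 'n. complex_of_real (\<Prod>j\<in>UNIV. bump_term (p j) (m j) (x $ j))) differentiable_on UNIV"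
      unfolding differentiable_on_def using D differentiableI by blast
    ultimately show ?case using Suc.IH unfolding Ck.simps by (simp only: simp_thms)
  }
qed

lemma real_tests_bump_exists:
  "\<exists>\<rho> \<in> real_tests. (\<forall>x :: real ^ 'n::finite. \<rho> x \<ge> 0) \<and> (\<forall>x. (\<forall>j. \<bar>x $ j\<bar> < 1) \<longrightarrow> \<rho> x > 0)"
proof -
  let ?\<rho> = "\<lambda>x :: real ^ 'n. \<Prod>j\<in>UNIV. bump_term 1 0 (x $ j)"
  have "- 1 \<le> x $ j \<and> x $ j \<le> 1" if "?\<rho> x \<noteq> 0" for x j
  proof -
    have "bump_term 1 0 (x $ j) \<noteq> 0" using that by (simp add: prod_zero_iff)
    then have "\<bar>x $ j\<bar> < 1" by (simp add: bump_term_def split: if_splits)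
    then show ?thesis by linarith
  qed
  then have "{x. complex_of_real (?\<rho> x) \<noteq> 0} \<subseteq> cbox (- 1) 1"
    unfolding mem_box_cart subset_iff mem_Collect_eq of_real_eq_0_iff by simp
  then have "bounded {x. complex_of_real (?\<rho> x) \<noteq> 0}"
    using bounded_cbox bounded_subset by blast
  moreover have "Ck k (\<lambda>x. complex_of_real (?\<rho> x))" for k
    using Ck_bump_product[of k "\<lambda>_. 1" "\<lambda>_. 0"] by simp
  ultimately have "?\<rho> \<in> real_tests"
    unfolding real_tests_def test_functions_def mem_Collect_eq compact_closure by blast
  moreover have "?\<rho> x \<ge> 0" for x
    by (intro prod_nonneg) (auto simp: bump_term_def)
  moreover have "?\<rho> x > 0" if "\<forall>j. \<bar>x $ j\<bar> < 1" for x
    using that by (intro prod_pos) (auto simp: bump_term_def)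
  ultimately show ?thesis by (intro bexI[of _ ?\<rho>]) auto
qed

section \<open>Convolution with test functions\<close>

lemma lborel_reflect: "distr lborel borel ((-) (x::'a::euclidean_space)) = lborel"
  using lborel_affine[of "-1" x] by (simp add: density_1 cong: distr_cong)

lemma lborel_shift: "distr lborel borel (\<lambda>y. y + (a::'a::euclidean_space)) = lborel"
proof -
  have "(\<lambda>y. y + a) = (+) a" by (auto simp: add.commute)
  then show ?thesis by (simp only: lborel_distr_plus)
qed

lemma lborel_shift':
  "distr lborel borel (\<lambda>y. y - (a::'a::euclidean_space)) = lborel"
  using lborel_shift[of "-a"] by simp

lemma lborel_integral_shift:
  fixes f :: "'a::euclidean_space \<Rightarrow> 'b::{banach, second_countable_topology}"
  assumes [measurable]: "f \<in> borel_measurable borel"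
  shows "(LINT y|lborel. f (y + a)) = (LINT y|lborel. f y)"
  using integral_distr[of "\<lambda>y. y + a" lborel borel f] by (simp add: lborel_shift)

lemma lborel_integral_reflect:
  fixes f :: "'a::euclidean_space \<Rightarrow> 'b::{banach, second_countable_topology}"
  assumes [measurable]: "f \<in> borel_measurable borel"
  shows "(LINT y|lborel. f (x - y)) = (LINT y|lborel. f y)"
  using integral_distr[of "(-) x" lborel borel f] by (simp add: lborel_reflect)

lemma lborel_integrable_reflect:
  fixes f :: "'a::euclidean_space \<Rightarrow> 'b::{banach, second_countable_topology}"
  assumes "integrable lborel f"
  shows "integrable lborel (\<lambda>y. f (x - y))"
  using integrable_distr[of "(-) x" lborel borel f] assms by (simp add: lborel_reflect)

lemma lborel_integrable_shift:
  fixes f :: "'a::euclidean_space \<Rightarrow> 'b::{banach, second_countable_topology}"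
  assumes "integrable lborel f"
  shows "integrable lborel (\<lambda>y. f (y + a))"
  using integrable_distr[of "\<lambda>y. y + a" lborel borel f] assms by (simp add: lborel_shift)

text \<open>Translation preserves null sets; the exceptional set itself need not be measurable.\<close>

lemma AE_lborel_shift:
  fixes a :: "'a::euclidean_space"
  assumes "AE x in lborel. P x"
  shows "AE x in lborel. P (x + a)"
proof -
  obtain N where N: "{x. \<not> P x} \<subseteq> N" "N \<in> null_sets lborel"
    using assms by (auto elim!: AE_E3 simp: eventually_ae_filter)
  have "AE x in distr lborel borel (\<lambda>y. y + a). x \<notin> N"
    unfolding lborel_shift by (rule AE_not_in[OF N(2)])
  moreover have "N \<in> sets borel" using N(2) by auto
  ultimately have "AE x in lborel. x + a \<notin> N"
    by (subst (asm) AE_distr_iff) (auto simp: Compl_eq[symmetric] intro: borel_comp)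
  then show ?thesis
    by eventually_elim (use N in auto)
qed

text \<open>Balls around the origin suffice, since every compact set lies in one.\<close>

definition loc_int :: "(real ^ 'n::finite \<Rightarrow> 'b::{banach, second_countable_topology}) \<Rightarrow> bool"
  where "loc_int f \<longleftrightarrow> f \<in> borel_measurable borel \<and> (\<forall>R. set_integrable lborel (cball 0 R) f)"

definition conv :: "(real ^ 'n::finite \<Rightarrow> real) \<Rightarrow> (real ^ 'n \<Rightarrow> 'b) \<Rightarrow> real ^ 'n
    \<Rightarrow> 'b::{banach, second_countable_topology}"
  where "conv \<rho> f x = (LINT y|lborel. \<rho> (x - y) *\<^sub>R f y)"

lemma loc_int_measurable: "loc_int f \<Longrightarrow> f \<in> borel_measurable borel"
  by (simp add: loc_int_def)

lemma loc_int_set_integrable: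
  assumes "loc_int f" "bounded S" "S \<in> sets borel"
  shows "set_integrable lborel S f"
proof -
  obtain R where "S \<subseteq> cball 0 R"
    using assms(2) unfolding bounded_iff by (auto simp: subset_iff)
  then show ?thesis
    using assms set_integrable_subset[of lborel "cball 0 R" f S] by (auto simp: loc_int_def)
qed

lemma integrable_loc_int:
  assumes "integrable lborel f" shows "loc_int f"
  using assms unfolding loc_int_def set_integrable_def
  by (auto intro: integrable_mult_indicator)

lemma loc_int_norm: "loc_int f \<Longrightarrow> loc_int (\<lambda>x. norm (f x))"
  unfolding loc_int_def by (auto dest: set_integrable_norm)

lemma loc_int_diff: "loc_int f \<Longrightarrow> loc_int g \<Longrightarrow> loc_int (\<lambda>x. f x - g x)"
  unfolding loc_int_def by auto

lemma loc_int_shift: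
  assumes "loc_int f" shows "loc_int (\<lambda>x. f (x + a))"
proof -
  note [measurable] = loc_int_measurable[OF assms]
  have "set_integrable lborel (cball 0 R) (\<lambda>x. f (x + a))" for R
  proof -
    have "set_integrable lborel (cball a R) f"
      by (intro loc_int_set_integrable[OF assms]) auto
    from lborel_integrable_shift[OF this[unfolded set_integrable_def], of a]
    show ?thesis
      unfolding set_integrable_def
      by (rule Bochner_Integration.integrable_cong[THEN iffD1, rotated 2])
         (auto simp: indicator_def dist_norm algebra_simps split: if_splits)
  qed
  then show ?thesis by (simp add: loc_int_def)
qed

text \<open>The one domination used for all limits below: an integrable majorant that is common to all x in a bounded
set.\<close>

lemma conv_integrand_bound:
  assumes "\<And>x. \<bar>\<rho> x\<bar> \<le> M" "\<And>x. \<rho> x \<noteq> 0 \<Longrightarrow> norm x \<le> L" "norm x + L \<le> R"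
  shows "norm (\<rho> (x - y) *\<^sub>R f y) \<le> M * (indicator (cball 0 R) y * norm (f y))"
proof (cases "\<rho> (x - y) = 0")
  case True
  then show ?thesis using assms(1)[of 0] by (simp add: indicator_def)
next
  case False
  then have "norm (x - y) \<le> L" by (rule assms(2))
  then have "norm y \<le> R"
    using assms(3) norm_triangle_ineq4[of x "x - y"] by simp
  then show ?thesis
    using assms(1)[of "x - y"] by (simp add: mult_right_mono)
qed

lemma continuous_borel_measurable:
  fixes \<rho> :: "real ^ 'n::finite \<Rightarrow> 'b::topological_space"
  shows "continuous_on UNIV \<rho> \<Longrightarrow> \<rho> \<in> borel_measurable borel"
  by (rule borel_measurable_continuous_onI)

lemma conv_integrable:
  assumes f: "loc_int f" and "continuous_on UNIV \<rho>" "\<And>x. \<rho> x \<noteq> 0 \<Longrightarrow> norm x \<le> L"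
  shows "integrable lborel (\<lambda>y. \<rho> (x - y) *\<^sub>R f y)"
proof -
  obtain M where M: "\<And>x. \<bar>\<rho> x\<bar> \<le> M"
    using continuous_compact_support_bounded assms by metis
  note [measurable] = loc_int_measurable[OF f] continuous_borel_measurable[OF assms(2)]
  show ?thesis
  proof (rule Bochner_Integration.integrable_bound)
    show "integrable lborel (\<lambda>y. M * (indicator (cball 0 (norm x + L)) y * norm (f y)))"
      using loc_int_norm[OF f] by (auto simp: loc_int_def set_integrable_def)
    have "norm (\<rho> (x - y) *\<^sub>R f y) \<le> M * (indicator (cball 0 (norm x + L)) y * norm (f y))" for y
      by (rule conv_integrand_bound[OF M assms(3) order_refl])
    then show "AE y in lborel. norm (\<rho> (x - y) *\<^sub>R f y)
        \<le> norm (M * (indicator (cball 0 (norm x + L)) y * norm (f y)))"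
      by (intro always_eventually allI order_trans[OF _ abs_ge_self[of "M * _", folded real_norm_def]])
  qed measurable
qed

lemma real_tests_conv_integrable:
  assumes "loc_int f" "\<rho> \<in> real_tests"
  shows "integrable lborel (\<lambda>y. \<rho> (x - y) *\<^sub>R f y)"
  using conv_integrable[OF assms(1) real_tests_continuous[OF assms(2)]] real_tests_support[OF assms(2)]
  by blast

lemma conv_diff:
  assumes "loc_int f" "loc_int g" "\<rho> \<in> real_tests"
  shows "conv \<rho> (\<lambda>y. f y - g y) x = conv \<rho> f x - conv \<rho> g x"
  unfolding conv_def using assms
  by (simp add: scaleR_diff_right Bochner_Integration.integral_diff real_tests_conv_integrable)

lemma conv_shift:
  assumes "f \<in> borel_measurable borel" "\<rho> \<in> real_tests"
  shows "conv \<rho> (\<lambda>y. f (y + a)) x = conv \<rho> f (x + a)"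
proof -
  note [measurable] = assms(1) continuous_borel_measurable[OF real_tests_continuous[OF assms(2)]]
  show ?thesis
    unfolding conv_def
    using lborel_integral_shift[of "\<lambda>y. \<rho> (x + a - y) *\<^sub>R f y" a] by (simp add: algebra_simps)
qed

lemma conv_cong_AE:
  assumes "AE y in lborel. f y = g y" "f \<in> borel_measurable borel" "g \<in> borel_measurable borel" "\<rho> \<in> real_tests"
  shows "conv \<rho> f x = conv \<rho> g x"
proof -
  note [measurable] = assms(2,3) continuous_borel_measurable[OF real_tests_continuous[OF assms(4)]]
  show ?thesis
    unfolding conv_def by (rule integral_cong_AE) (use assms(1) in \<open>auto elim: eventually_mono\<close>)
qed

lemma conv_continuous:
  fixes f :: "real ^ 'n::finite \<Rightarrow> 'b::{banach, second_countable_topology}"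
  assumes f: "loc_int f" and r: "\<rho> \<in> real_tests"
  shows "continuous_on UNIV (conv \<rho> f)"
proof -
  obtain M where M: "\<And>x. \<bar>\<rho> x\<bar> \<le> M" using real_tests_bounded[OF r] by blast
  obtain L where L: "\<And>x. \<rho> x \<noteq> 0 \<Longrightarrow> norm x \<le> L" using real_tests_support[OF r] by blast
  note cont = real_tests_continuous[OF r]
  note [measurable] = loc_int_measurable[OF f] continuous_borel_measurable[OF cont]
  have "(\<lambda>n. conv \<rho> f (u n)) \<longlonglongrightarrow> conv \<rho> f x" if u: "u \<longlonglongrightarrow> x" for u x
  proof -
    have "bounded (range u)" using u convergent_def convergent_imp_bounded by blast
    then obtain B where B: "\<And>n. norm (u n) \<le> B" unfolding bounded_iff by blast
    show ?thesis
      unfolding conv_def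
    proof (rule integral_dominated_convergence)
      show "integrable lborel (\<lambda>y. M * (indicator (cball 0 (B + L)) y * norm (f y)))"
        using loc_int_norm[OF f] by (auto simp: loc_int_def set_integrable_def)
      show "AE y in lborel. norm (\<rho> (u n - y) *\<^sub>R f y) \<le> M * (indicator (cball 0 (B + L)) y * norm (f y))" for n
        using B[of n] by (intro always_eventually allI conv_integrand_bound[OF M L]) auto
      show "AE y in lborel. (\<lambda>n. \<rho> (u n - y) *\<^sub>R f y) \<longlonglongrightarrow> \<rho> (x - y) *\<^sub>R f y"
      proof (intro always_eventually allI tendsto_scaleR tendsto_const)
        fix y
        have "isCont \<rho> (x - y)" using cont by (simp add: continuous_on_eq_continuous_at)
        then show "(\<lambda>n. \<rho> (u n - y)) \<longlonglongrightarrow> \<rho> (x - y)"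
          by (rule isCont_tendsto_compose) (intro tendsto_diff u tendsto_const)
      qed
    qed measurable
  qed
  then show ?thesis
    by (simp add: continuous_on_sequentially o_def)
qed

section \<open>Mollifiers\<close>

definition mollifier :: "(nat \<Rightarrow> real ^ 'n::finite \<Rightarrow> real) \<Rightarrow> bool"
  where "mollifier \<rho> \<longleftrightarrow>
    (\<forall>k. \<rho> k \<in> real_tests \<and> (\<forall>x. 0 \<le> \<rho> k x) \<and> (LINT x|lborel. \<rho> k x) = 1) \<and>
    (\<exists>L>0. \<forall>k x. \<rho> k x \<noteq> 0 \<longrightarrow> norm x \<le> L / real (Suc k))"

lemma real_tests_integrable:
  assumes "\<rho> \<in> real_tests" shows "integrable lborel \<rho>"
proof -
  have "loc_int (\<lambda>_ :: real ^ 'n. 1 :: real)"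
    unfolding loc_int_def set_integrable_def using emeasure_lborel_cball_finite[of "0 :: real ^ 'n"] by (auto simp: less_top[symmetric])
  from lborel_integrable_reflect[OF real_tests_conv_integrable[OF this assms, of 0], of 0]
  show ?thesis by simp
qed

lemma AE_ball_nonempty:
  assumes "0 < r" "AE x in lborel. x \<in> ball (0::'a::euclidean_space) r \<longrightarrow> P x"
  shows "\<exists>x\<in>ball 0 r. P x"
proof (rule ccontr)
  assume "\<not> ?thesis"
  then have "AE x in lborel. x \<notin> ball (0::'a) r" using assms(2) by (auto elim: eventually_mono)
  then have "ball (0::'a) r \<in> null_sets lborel" by (subst AE_iff_null_sets) auto
  then show False
    using open_not_negligible[of "ball (0::'a) r"] assms(1)
    by (auto simp: negligible_iff_null_sets intro: null_sets_completionI)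
qed

text \<open>Rescale a bump by the factor k + 1 and normalise.  The integral of the rescaled bump is positive since
the bump is positive on a ball.\<close>

lemma mollifier_exists: "\<exists>\<rho> :: nat \<Rightarrow> real ^ 'n::finite \<Rightarrow> real. mollifier \<rho>"
proof -
  obtain \<beta> :: "real ^ 'n \<Rightarrow> real" where b: "\<beta> \<in> real_tests" "\<And>x. \<beta> x \<ge> 0"
      "\<And>x. (\<forall>j. \<bar>x $ j\<bar> < 1) \<Longrightarrow> \<beta> x > 0"
    using real_tests_bump_exists by blast
  obtain L where L: "L > 0" "\<And>x. \<beta> x \<noteq> 0 \<Longrightarrow> norm x \<le> L"
    using real_tests_support[OF b(1)] by blast
  define r where "r k x = \<beta> (0 + real (Suc k) *\<^sub>R x)" for k x
  have r: "(\<lambda>x. c * r k x) \<in> real_tests" for k c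
    unfolding r_def by (rule real_tests_affine[OF b(1)]) simp
  have rt: "r k \<in> real_tests" for k using r[of 1 k] by simp
  have rn: "AE x in lborel. 0 \<le> r k x" for k by (simp add: r_def b)
  have I: "(LINT x|lborel. r k x) > 0" for k
  proof (rule ccontr)
    assume "\<not> ?thesis"
    moreover have "(LINT x|lborel. r k x) \<ge> 0" by (rule Bochner_Integration.integral_nonneg) (simp add: r_def b)
    ultimately have "(LINT x|lborel. r k x) = 0" by simp
    then have ae: "AE x in lborel. r k x = 0"
      using integral_nonneg_eq_0_iff_AE[OF real_tests_integrable[OF rt, of k]] rn by blast
    from ae have "AE x in lborel. x \<in> ball 0 (1 / real (Suc k)) \<longrightarrow> r k x = 0"
      by (rule eventually_mono) simp
    from AE_ball_nonempty[OF _ this] obtain x where x: "x \<in> ball 0 (1 / real (Suc k))" "r k x = 0"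
      by auto
    then have n: "norm (real (Suc k) *\<^sub>R x) < 1" by (simp add: field_simps del: of_nat_Suc)
    have "\<bar>(real (Suc k) *\<^sub>R x) $ j\<bar> < 1" for j
      using component_le_norm_cart[of "real (Suc k) *\<^sub>R x" j] n by linarith
    then have "r k x > 0" unfolding r_def by (intro b(3)) simp
    with x(2) show False by simp
  qed
  define \<rho> where "\<rho> k x = (1 / (LINT x|lborel. r k x)) * r k x" for k x
  have "\<rho> k x \<noteq> 0 \<Longrightarrow> norm x \<le> L / real (Suc k)" for k x
    using L(2)[of "0 + real (Suc k) *\<^sub>R x"] by (auto simp: \<rho>_def r_def field_simps simp del: of_nat_Suc)
  moreover have "\<rho> k \<in> real_tests" for k
    using r[of "1 / (LINT x|lborel. r k x)" k] unfolding \<rho>_def .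
  moreover have "0 \<le> \<rho> k x" for k x using I[of k] by (simp add: \<rho>_def r_def b)
  moreover have "(LINT x|lborel. \<rho> k x) = 1" for k
    unfolding \<rho>_def using I[of k] by simp
  ultimately have "mollifier \<rho>" unfolding mollifier_def using L(1) by blast
  then show ?thesis by blast
qed

text \<open>Young's inequality for a probability density, by Fubini.\<close>

lemma conv_L1_bound:
  fixes f :: "real ^ 'n::finite \<Rightarrow> 'b::{banach, second_countable_topology}"
  assumes f: "integrable lborel f" and r: "\<rho> \<in> real_tests" "\<And>x. \<rho> x \<ge> 0" "(LINT x|lborel. \<rho> x) = 1"
  shows "(\<integral>\<^sup>+x. norm (conv \<rho> f x) \<partial>lborel) \<le> (\<integral>\<^sup>+x. norm (f x) \<partial>lborel)"
proof -
  note [measurable] = borel_measurable_integrable[OF f] continuous_borel_measurable[OF real_tests_continuous[OF r(1)]]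
  have "(\<integral>\<^sup>+x. norm (conv \<rho> f x) \<partial>lborel) \<le> (\<integral>\<^sup>+x. (\<integral>\<^sup>+y. norm (\<rho> (x - y) *\<^sub>R f y) \<partial>lborel) \<partial>lborel)"
    unfolding conv_def
    by (intro nn_integral_mono integral_norm_bound_ennreal
        real_tests_conv_integrable[OF integrable_loc_int[OF f] r(1)])
  also have "\<dots> = (\<integral>\<^sup>+y. (\<integral>\<^sup>+x. norm (\<rho> (x - y) *\<^sub>R f y) \<partial>lborel) \<partial>lborel)"
    by (rule lborel_pair.Fubini') measurable
  also have "\<dots> = (\<integral>\<^sup>+y. norm (f y) \<partial>lborel)"
  proof (rule nn_integral_cong)
    fix y
    have "(\<integral>\<^sup>+x. norm (\<rho> (x - y) *\<^sub>R f y) \<partial>lborel) = (\<integral>\<^sup>+x. ennreal (\<rho> (x - y)) * norm (f y) \<partial>lborel)"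
      using r(2) by (intro nn_integral_cong) (simp add: ennreal_mult)
    also have "\<dots> = (\<integral>\<^sup>+x. ennreal (\<rho> (x - y)) \<partial>lborel) * norm (f y)"
      by (rule nn_integral_multc) measurable
    also have "(\<integral>\<^sup>+x. ennreal (\<rho> (x - y)) \<partial>lborel) = (\<integral>\<^sup>+x. ennreal (\<rho> x) \<partial>distr lborel borel (\<lambda>x. x - y))"
      by (subst nn_integral_distr) auto
    also have "\<dots> = 1"
      using r by (subst lborel_shift') (simp add: nn_integral_eq_integral real_tests_integrable)
    finally show "(\<integral>\<^sup>+x. norm (\<rho> (x - y) *\<^sub>R f y) \<partial>lborel) = norm (f y)" by simp
  qed
  finally show ?thesis .
qed

text \<open>The approximation error is stable in the first argument, which lets convergence pass from a dense class of
functions to all integrable ones.\<close>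

lemma conv_L1_error:
  fixes f g :: "real ^ 'n::finite \<Rightarrow> 'b::{banach, second_countable_topology}"
  assumes f: "integrable lborel f" and g: "integrable lborel g"
    and r: "\<rho> \<in> real_tests" "\<And>x. \<rho> x \<ge> 0" "(LINT x|lborel. \<rho> x) = 1"
  shows "(\<integral>\<^sup>+x. norm (conv \<rho> f x - f x) \<partial>lborel)
      \<le> (\<integral>\<^sup>+x. norm (conv \<rho> g x - g x) \<partial>lborel) + 2 * (\<integral>\<^sup>+x. norm (f x - g x) \<partial>lborel)"
proof -
  let ?d = "\<lambda>x. f x - g x"
  have d: "integrable lborel ?d" using f g by simp
  note loc = integrable_loc_int[OF f] integrable_loc_int[OF g] integrable_loc_int[OF d]
  note [measurable] = borel_measurable_integrable[OF f] borel_measurable_integrable[OF g]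
    continuous_borel_measurable[OF conv_continuous[OF loc(1) r(1)]]
    continuous_borel_measurable[OF conv_continuous[OF loc(2) r(1)]]
    continuous_borel_measurable[OF conv_continuous[OF loc(3) r(1)]]
  have "(\<integral>\<^sup>+x. norm (conv \<rho> f x - f x) \<partial>lborel)
     \<le> (\<integral>\<^sup>+x. ennreal (norm (conv \<rho> g x - g x)) + (ennreal (norm (conv \<rho> ?d x)) + norm (?d x)) \<partial>lborel)"
  proof (rule nn_integral_mono)
    fix x
    have "conv \<rho> f x - f x = (conv \<rho> g x - g x) + (conv \<rho> ?d x - ?d x)"
      by (simp add: conv_diff[OF loc(1,2) r(1)])
    then have "norm (conv \<rho> f x - f x) = norm ((conv \<rho> g x - g x) + (conv \<rho> ?d x - ?d x))"
      by (rule arg_cong)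
    then have "norm (conv \<rho> f x - f x) \<le> norm (conv \<rho> g x - g x) + (norm (conv \<rho> ?d x) + norm (?d x))"
      using norm_triangle_ineq[of "conv \<rho> g x - g x" "conv \<rho> ?d x - ?d x"]
        norm_triangle_ineq4[of "conv \<rho> ?d x" "?d x"] by linarith
    then show "ennreal (norm (conv \<rho> f x - f x)) \<le> ennreal (norm (conv \<rho> g x - g x)) + (ennreal (norm (conv \<rho> ?d x)) + norm (?d x))"
      by (simp flip: ennreal_plus)
  qed
  also have "\<dots> = (\<integral>\<^sup>+x. norm (conv \<rho> g x - g x) \<partial>lborel) + ((\<integral>\<^sup>+x. norm (conv \<rho> ?d x) \<partial>lborel) + (\<integral>\<^sup>+x. norm (?d x) \<partial>lborel))"
    by (simp add: nn_integral_add)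
  also have "\<dots> \<le> (\<integral>\<^sup>+x. norm (conv \<rho> g x - g x) \<partial>lborel) + ((\<integral>\<^sup>+x. norm (?d x) \<partial>lborel) + (\<integral>\<^sup>+x. norm (?d x) \<partial>lborel))"
    using conv_L1_bound[OF d r] by (intro add_mono) auto
  finally show ?thesis by (simp add: mult_2)
qed

lemma mollifier_tendsto_on_open:
  fixes U :: "(real ^ 'n::finite) set"
  assumes m: "mollifier \<rho>" and U: "open U" "x \<in> U"
  shows "(\<lambda>k. conv (\<rho> k) (indicat_real U) x) \<longlonglongrightarrow> 1"
proof -
  obtain L where L: "L > 0" "\<And>k x. \<rho> k x \<noteq> 0 \<Longrightarrow> norm x \<le> L / real (Suc k)"
    and r: "\<And>k. \<rho> k \<in> real_tests" "\<And>k. (LINT x|lborel. \<rho> k x) = 1"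
    using m unfolding mollifier_def by blast
  obtain e where e: "e > 0" "ball x e \<subseteq> U" using U openE by blast
  have "eventually (\<lambda>k. L / real (Suc k) < e) sequentially"
    using LIMSEQ_Suc[OF lim_const_over_n[of L]] e(1) by (auto elim: order_tendstoD)
  then have "eventually (\<lambda>k. conv (\<rho> k) (indicat_real U) x = 1) sequentially"
  proof eventually_elim
    case (elim k)
    have "\<rho> k (x - y) *\<^sub>R indicat_real U y = \<rho> k (x - y)" for y
    proof (cases "\<rho> k (x - y) = 0")
      case False
      then have "norm (x - y) < e" using L(2) elim by fastforce
      then have "y \<in> U" using e(2) by (auto simp: dist_norm)
      then show ?thesis by simp
    qed simp
    then have "conv (\<rho> k) (indicat_real U) x = (LINT y|lborel. \<rho> k (x - y))"
      unfolding conv_def by (rule arg_cong[OF ext])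
    also have "\<dots> = 1"
      using lborel_integral_reflect[OF continuous_borel_measurable[OF real_tests_continuous[OF r(1)]]] r(2)
      by simp
    finally show ?case .
  qed
  then show ?thesis by (simp add: tendsto_eventually)
qed

text \<open>Scheffe's argument: writing g for the mollified indicator of U, we have 0 \<le> g \<le> 1 and
\<integral> g \<le> |U|, so the total error is at most twice the mass that g lacks inside U, and this tends to zero
by dominated convergence because g converges to 1 at every point of the open set U.\<close>

lemma mollifier_L1_open:
  fixes U :: "(real ^ 'n::finite) set"
  assumes m: "mollifier \<rho>" and U: "open U" "emeasure lborel U < \<infinity>"
  shows "(\<lambda>k. \<integral>\<^sup>+x. norm (conv (\<rho> k) (indicat_real U) x - indicat_real U x) \<partial>lborel) \<longlonglongrightarrow> 0"
proof -
  have r: "\<rho> k \<in> real_tests" "\<rho> k x \<ge> 0" "(LINT x|lborel. \<rho> k x) = 1" for k x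
    using m unfolding mollifier_def by auto
  define g where "g k = conv (\<rho> k) (indicat_real U)" for k
  have [measurable]: "U \<in> sets borel" using U by simp
  have int1: "integrable lborel (indicat_real U)" using U by simp
  have [measurable]: "g k \<in> borel_measurable borel" for k
    unfolding g_def using conv_continuous[OF integrable_loc_int[OF int1] r(1)] continuous_borel_measurable by blast
  have le1: "\<bar>g k x\<bar> \<le> 1" and ge0: "g k x \<ge> 0" for k x
  proof -
    show "g k x \<ge> 0" unfolding g_def conv_def by (rule Bochner_Integration.integral_nonneg) (simp add: r)
    have "g k x \<le> (LINT y|lborel. \<rho> k (x - y))"
      unfolding g_def conv_def
      by (intro integral_mono real_tests_conv_integrable[OF integrable_loc_int[OF int1] r(1)]
           lborel_integrable_reflect real_tests_integrable[OF r(1)]) (auto simp: r indicator_def)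
    also have "\<dots> = 1"
      using lborel_integral_reflect[OF continuous_borel_measurable[OF real_tests_continuous[OF r(1)]]] r(3)
      by simp
    finally show "\<bar>g k x\<bar> \<le> 1" using \<open>g k x \<ge> 0\<close> by simp
  qed
  have bound: "(\<integral>\<^sup>+x. norm (g k x) \<partial>lborel) \<le> (\<integral>\<^sup>+x. norm (indicat_real U x) \<partial>lborel)" for k
    unfolding g_def by (rule conv_L1_bound[OF int1 r])
  have "(\<integral>\<^sup>+x. norm (indicat_real U x) \<partial>lborel) < \<infinity>"
    using int1 by (simp add: integrable_iff_bounded)
  then have int2: "integrable lborel (g k)" for k
    using bound[of k] by (intro integrableI_bounded) (auto intro: le_less_trans)
  have ile: "(LINT x|lborel. g k x) \<le> (LINT x|lborel. indicat_real U x)" for k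
  proof -
    have "ennreal (LINT x|lborel. g k x) \<le> ennreal (LINT x|lborel. indicat_real U x)"
      using bound[of k] ge0 int1 int2[of k] by (simp add: nn_integral_eq_integral)
    then show ?thesis by (subst (asm) ennreal_le_iff) (auto intro: Bochner_Integration.integral_nonneg)
  qed
  have lim: "(\<lambda>k. LINT x|lborel. indicat_real U x * (1 - g k x)) \<longlonglongrightarrow> (LINT x|(lborel :: (real^'n) measure). 0)"
  proof (rule integral_dominated_convergence[where w="indicat_real U"])
    show "AE x in lborel. (\<lambda>k. indicat_real U x * (1 - g k x)) \<longlonglongrightarrow> 0"
    proof (intro always_eventually allI)
      fix x show "(\<lambda>k. indicat_real U x * (1 - g k x)) \<longlonglongrightarrow> 0"
        using mollifier_tendsto_on_open[OF m U(1), of x]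
        by (cases "x \<in> U") (auto simp: g_def intro!: tendsto_eq_intros)
    qed
    show "AE x in lborel. norm (indicat_real U x * (1 - g k x)) \<le> indicat_real U x" for k
      using le1[of k] ge0[of k] by (auto simp: indicator_def abs_le_iff)
  qed (use int1 in auto)
  have err: "(LINT x|lborel. \<bar>g k x - indicat_real U x\<bar>) \<le> 2 * (LINT x|lborel. indicat_real U x * (1 - g k x))" for k
  proof -
    have e: "\<bar>g k x - indicat_real U x\<bar> = (g k x - indicat_real U x) + 2 * (indicat_real U x * (1 - g k x))" for x
      using le1[of k x] ge0[of k x] by (auto simp: indicator_def)
    have i3: "integrable lborel (\<lambda>x. indicat_real U x * (1 - g k x))"
    proof (rule Bochner_Integration.integrable_bound[OF int1])
      show "AE x in lborel. norm (indicat_real U x * (1 - g k x)) \<le> norm (indicat_real U x)"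
        using le1[of k] ge0[of k] by (auto simp: indicator_def abs_le_iff)
    qed measurable
    have "(LINT x|lborel. \<bar>g k x - indicat_real U x\<bar>)
       = (LINT x|lborel. g k x) - (LINT x|lborel. indicat_real U x) + 2 * (LINT x|lborel. indicat_real U x * (1 - g k x))"
      unfolding e using int1 int2[of k] i3 by simp
    then show ?thesis using ile[of k] by linarith
  qed
  have "(\<lambda>k. LINT x|lborel. \<bar>g k x - indicat_real U x\<bar>) \<longlonglongrightarrow> 0"
  proof (rule tendsto_sandwich[where f="\<lambda>_. 0" and h="\<lambda>k. 2 * (LINT x|lborel. indicat_real U x * (1 - g k x))"])
    show "(\<lambda>k. 2 * (LINT x|lborel. indicat_real U x * (1 - g k x))) \<longlonglongrightarrow> 0"
      using tendsto_mult_right_zero[of _ sequentially 2] lim by simp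
  qed (auto intro!: always_eventually err Bochner_Integration.integral_nonneg)
  then have "(\<lambda>k. ennreal (LINT x|lborel. \<bar>g k x - indicat_real U x\<bar>)) \<longlonglongrightarrow> 0"
    using tendsto_ennrealI by fastforce
  moreover have "ennreal (LINT x|lborel. \<bar>g k x - indicat_real U x\<bar>) = (\<integral>\<^sup>+x. norm (g k x - indicat_real U x) \<partial>lborel)" for k
    using int1 int2[of k] by (subst nn_integral_eq_integral) auto
  ultimately show ?thesis by (simp add: g_def)
qed

lemma ennreal_tendsto_0_approx:
  fixes a :: "nat \<Rightarrow> ennreal"
  assumes "\<And>e. e > 0 \<Longrightarrow> \<exists>b. b \<longlonglongrightarrow> 0 \<and> (\<forall>k. a k \<le> b k + ennreal e)"
  shows "a \<longlonglongrightarrow> 0"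
proof (rule order_tendstoI)
  fix c :: ennreal assume "0 < c"
  then obtain e where e: "e > 0" "ennreal (2 * e) < c"
  proof (cases c)
    case (real r)
    then show ?thesis using that[of "r / 3"] \<open>0 < c\<close> by (auto simp: ennreal_less_iff)
  qed (use that[of 1] in auto)
  obtain b where b: "b \<longlonglongrightarrow> 0" "\<And>k. a k \<le> b k + ennreal e" using assms[OF e(1)] by blast
  have "eventually (\<lambda>k. b k < ennreal e) sequentially"
    using b(1) e(1) by (auto intro: order_tendstoD)
  then show "eventually (\<lambda>k. a k < c) sequentially"
  proof eventually_elim
    case (elim k)
    have "a k \<le> ennreal e + ennreal e" using b(2)[of k] elim by (meson add_mono less_imp_le order_refl order_trans)
    also have "\<dots> = ennreal (2 * e)" using e(1) by (simp flip: ennreal_plus)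
    finally show ?case using e(2) by simp
  qed
qed auto

text \<open>Open sets are treated in \<open>mollifier_L1_open\<close>, outer regularity of Lebesgue measure gives
Borel sets, and \<open>conv_L1_error\<close> carries the statement to sums and limits of simple functions.\<close>

lemma mollifier_L1:
  fixes f :: "real ^ 'n::finite \<Rightarrow> 'b::{banach, second_countable_topology}"
  assumes m: "mollifier \<rho>" and f: "integrable lborel f"
  shows "(\<lambda>k. \<integral>\<^sup>+x. norm (conv (\<rho> k) f x - f x) \<partial>lborel) \<longlonglongrightarrow> 0"
  using f
proof (induction rule: integrable_induct)
  have r: "\<rho> k \<in> real_tests" "\<rho> k x \<ge> 0" "(LINT x|lborel. \<rho> k x) = 1" for k x
    using m unfolding mollifier_def by auto
  {
    case (base A c)
    have iA: "integrable lborel (indicat_real A)" using base by simp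
    have "(\<lambda>k. \<integral>\<^sup>+x. norm (conv (\<rho> k) (indicat_real A) x - indicat_real A x) \<partial>lborel) \<longlonglongrightarrow> 0"
    proof (rule ennreal_tendsto_0_approx)
      fix e :: real assume "e > 0"
      \<comment> \<open>Half of e, since the distance of A and U enters \<open>conv_L1_error\<close> twice.\<close>
      obtain U where U: "open U" "A \<subseteq> U" "emeasure lborel (U - A) < ennreal (e / 2)"
        using outer_regular_lborel[of A "e/2"] base \<open>e > 0\<close> by auto
      have [measurable]: "U \<in> sets borel" "A \<in> sets borel" using U base by auto
      have "emeasure lborel U = emeasure lborel A + emeasure lborel (U - A)"
        using U(2) by (subst plus_emeasure) (auto simp: Un_absorb1)
      moreover have "emeasure lborel (U - A) < \<infinity>" using U(3) by (rule less_trans) simp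
      ultimately have fin: "emeasure lborel U < \<infinity>" using base(2) by (simp add: less_top)
      have iU: "integrable lborel (indicat_real U)" using fin by simp
      have "(\<integral>\<^sup>+x. norm (indicat_real A x - indicat_real U x) \<partial>lborel) = (\<integral>\<^sup>+x. indicator (U - A) x \<partial>lborel)"
        using U(2) by (intro nn_integral_cong) (auto simp: indicator_def)
      also have "\<dots> = emeasure lborel (U - A)" by simp
      finally have d: "2 * (\<integral>\<^sup>+x. norm (indicat_real A x - indicat_real U x) \<partial>lborel) \<le> ennreal e"
        using U(3) \<open>e > 0\<close> mult_left_mono[of "emeasure lborel (U - A)" "ennreal (e/2)" 2]
        by (simp add: ennreal_mult[symmetric, of 2 "e/2", simplified])
      show "\<exists>b. b \<longlonglongrightarrow> 0 \<and> (\<forall>k. (\<integral>\<^sup>+x. norm (conv (\<rho> k) (indicat_real A) x - indicat_real A x) \<partial>lborel) \<le> b k + ennreal e)"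
        using mollifier_L1_open[OF m U(1) fin] conv_L1_error[OF iA iU r] d
        by (meson add_left_mono order_trans)
    qed
    then have "(\<lambda>k. (\<integral>\<^sup>+x. norm (conv (\<rho> k) (indicat_real A) x - indicat_real A x) \<partial>lborel) * norm c) \<longlonglongrightarrow> 0 * ennreal (norm c)"
      by (intro tendsto_mult_ennreal tendsto_const) auto
    moreover have "(\<integral>\<^sup>+x. norm (conv (\<rho> k) (indicat_real A) x - indicat_real A x) \<partial>lborel) * norm c
       = (\<integral>\<^sup>+x. norm (conv (\<rho> k) (\<lambda>x. indicat_real A x *\<^sub>R c) x - indicat_real A x *\<^sub>R c) \<partial>lborel)" for k
    proof -
      have "conv (\<rho> k) (\<lambda>x. indicat_real A x *\<^sub>R c) x = conv (\<rho> k) (indicat_real A) x *\<^sub>R c" for x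
        unfolding conv_def
        using integral_scaleR_left[of c lborel "\<lambda>y. \<rho> k (x - y) *\<^sub>R indicat_real A y"]
          real_tests_conv_integrable[OF integrable_loc_int[OF iA] r(1)[of k]] by simp
      then have "norm (conv (\<rho> k) (\<lambda>x. indicat_real A x *\<^sub>R c) x - indicat_real A x *\<^sub>R c)
          = norm (conv (\<rho> k) (indicat_real A) x - indicat_real A x) * norm c" for x
        by (simp flip: scaleR_diff_left)
      moreover have [measurable]: "conv (\<rho> k) (indicat_real A) \<in> borel_measurable borel"
        using conv_continuous[OF integrable_loc_int[OF iA] r(1)] continuous_borel_measurable by blast
      moreover have [measurable]: "A \<in> sets borel" using base by simp
      ultimately show ?thesis by (simp add: ennreal_mult nn_integral_multc)
    qed
    ultimately show ?case by simp
  next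
    case (add f g)
    have "(\<lambda>k. (\<integral>\<^sup>+x. norm (conv (\<rho> k) f x - f x) \<partial>lborel) + (\<integral>\<^sup>+x. norm (conv (\<rho> k) g x - g x) \<partial>lborel)) \<longlonglongrightarrow> 0 + 0"
      by (intro tendsto_add add.IH)
    then have lim: "(\<lambda>k. (\<integral>\<^sup>+x. norm (conv (\<rho> k) f x - f x) \<partial>lborel) + (\<integral>\<^sup>+x. norm (conv (\<rho> k) g x - g x) \<partial>lborel)) \<longlonglongrightarrow> 0"
      by simp
    show ?case
    proof (rule tendsto_sandwich[OF _ _ tendsto_const lim])
      show "\<forall>\<^sub>F k in sequentially. (\<integral>\<^sup>+x. norm (conv (\<rho> k) (\<lambda>x. f x + g x) x - (f x + g x)) \<partial>lborel)
         \<le> (\<integral>\<^sup>+x. norm (conv (\<rho> k) f x - f x) \<partial>lborel) + (\<integral>\<^sup>+x. norm (conv (\<rho> k) g x - g x) \<partial>lborel)"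
      proof (intro always_eventually allI)
        fix k
        note li = integrable_loc_int[OF add.hyps(1)] integrable_loc_int[OF add.hyps(2)]
        note [measurable] = continuous_borel_measurable[OF conv_continuous[OF li(1) r(1)[of k]]]
          continuous_borel_measurable[OF conv_continuous[OF li(2) r(1)[of k]]]
          li[THEN loc_int_measurable]
        have c: "conv (\<rho> k) (\<lambda>x. f x + g x) x = conv (\<rho> k) f x + conv (\<rho> k) g x" for x
          unfolding conv_def
          by (simp add: scaleR_add_right Bochner_Integration.integral_add real_tests_conv_integrable li r)
        have "(\<integral>\<^sup>+x. norm (conv (\<rho> k) (\<lambda>x. f x + g x) x - (f x + g x)) \<partial>lborel)
          \<le> (\<integral>\<^sup>+x. ennreal (norm (conv (\<rho> k) f x - f x)) + norm (conv (\<rho> k) g x - g x) \<partial>lborel)"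
        proof (rule nn_integral_mono)
          fix x
          have "norm (conv (\<rho> k) (\<lambda>x. f x + g x) x - (f x + g x)) \<le> norm (conv (\<rho> k) f x - f x) + norm (conv (\<rho> k) g x - g x)"
            unfolding c using norm_triangle_ineq[of "conv (\<rho> k) f x - f x" "conv (\<rho> k) g x - g x"]
            by (simp add: algebra_simps)
          then show "ennreal (norm (conv (\<rho> k) (\<lambda>x. f x + g x) x - (f x + g x)))
             \<le> ennreal (norm (conv (\<rho> k) f x - f x)) + norm (conv (\<rho> k) g x - g x)"
            by (simp flip: ennreal_plus)
        qed
        also have "\<dots> = (\<integral>\<^sup>+x. norm (conv (\<rho> k) f x - f x) \<partial>lborel) + (\<integral>\<^sup>+x. norm (conv (\<rho> k) g x - g x) \<partial>lborel)"
          by (rule nn_integral_add) measurable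
        finally show "(\<integral>\<^sup>+x. norm (conv (\<rho> k) (\<lambda>x. f x + g x) x - (f x + g x)) \<partial>lborel)
         \<le> (\<integral>\<^sup>+x. norm (conv (\<rho> k) f x - f x) \<partial>lborel) + (\<integral>\<^sup>+x. norm (conv (\<rho> k) g x - g x) \<partial>lborel)" .
      qed
    qed auto
  next
    case (lim f s)
    note [measurable] = borel_measurable_integrable[OF lim.hyps(1)] borel_measurable_integrable[OF lim.hyps(4)]
    have "(\<lambda>i. \<integral>\<^sup>+x. norm (f x - s i x) \<partial>lborel) \<longlonglongrightarrow> (\<integral>\<^sup>+x. 0 \<partial>(lborel :: (real^'n) measure))"
    proof (rule nn_integral_dominated_convergence[where w="\<lambda>x. ennreal (3 * norm (f x))"])
      show "AE x in lborel. ennreal (norm (f x - s i x)) \<le> ennreal (3 * norm (f x))" for i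
      proof (intro always_eventually allI ennreal_leI)
        fix x show "norm (f x - s i x) \<le> 3 * norm (f x)"
          using lim.hyps(3)[of x i] norm_triangle_ineq4[of "f x" "s i x"] by simp
      qed
      show "(\<integral>\<^sup>+x. ennreal (3 * norm (f x)) \<partial>lborel) < \<infinity>"
        using lim.hyps(4) by (subst nn_integral_eq_integral) auto
      show "AE x in lborel. (\<lambda>i. ennreal (norm (f x - s i x))) \<longlonglongrightarrow> 0"
      proof (intro always_eventually allI)
        fix x
        have "(\<lambda>i. norm (f x - s i x)) \<longlonglongrightarrow> norm (f x - f x)"
          using lim.hyps(2)[of x] by (intro tendsto_intros) auto
        then have "(\<lambda>i. ennreal (norm (f x - s i x))) \<longlonglongrightarrow> ennreal (norm (f x - f x))"
          by (rule tendsto_ennrealI)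
        then show "(\<lambda>i. ennreal (norm (f x - s i x))) \<longlonglongrightarrow> 0" by simp
      qed
    qed measurable
    then have z: "(\<lambda>i. \<integral>\<^sup>+x. norm (f x - s i x) \<partial>lborel) \<longlonglongrightarrow> 0" by simp
    show ?case
    proof (rule ennreal_tendsto_0_approx)
      fix e :: real assume "e > 0"
      then have "eventually (\<lambda>i. (\<integral>\<^sup>+x. norm (f x - s i x) \<partial>lborel) < ennreal (e/2)) sequentially"
        using z by (auto intro: order_tendstoD)
      then obtain i where i: "(\<integral>\<^sup>+x. norm (f x - s i x) \<partial>lborel) < ennreal (e/2)"
        by (auto simp: eventually_sequentially)
      have d: "2 * (\<integral>\<^sup>+x. norm (f x - s i x) \<partial>lborel) \<le> ennreal e"
        using i \<open>e > 0\<close> mult_left_mono[of "\<integral>\<^sup>+x. norm (f x - s i x) \<partial>lborel" "ennreal (e/2)" 2]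
        by (simp add: ennreal_mult[symmetric, of 2 "e/2", simplified])
      show "\<exists>b. b \<longlonglongrightarrow> 0 \<and> (\<forall>k. (\<integral>\<^sup>+x. norm (conv (\<rho> k) f x - f x) \<partial>lborel) \<le> b k + ennreal e)"
        using lim.IH[of i] conv_L1_error[OF lim.hyps(4) lim.hyps(1)[of i] r] d
        by (meson add_left_mono order_trans)
    qed
  }
qed

text \<open>On a ball, only the values of f on a slightly larger ball matter, so f may be cut off there.\<close>

lemma mollifier_L1_local:
  fixes f :: "real ^ 'n::finite \<Rightarrow> 'b::{banach, second_countable_topology}"
  assumes m: "mollifier \<rho>" and f: "loc_int f"
  shows "(\<lambda>k. LINT x:cball 0 R|lborel. norm (conv (\<rho> k) f x - f x)) \<longlonglongrightarrow> 0"
proof -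
  obtain L where L: "L > 0" "\<And>k x. \<rho> k x \<noteq> 0 \<Longrightarrow> norm x \<le> L / real (Suc k)"
    using m unfolding mollifier_def by blast
  have r: "\<rho> k \<in> real_tests" for k using m unfolding mollifier_def by auto
  define h where "h x = indicat_real (cball 0 (R + L)) x *\<^sub>R f x" for x
  have h: "integrable lborel h"
    using f unfolding loc_int_def set_integrable_def h_def by auto
  have cv: "conv (\<rho> k) f x - f x = conv (\<rho> k) h x - h x" if x: "x \<in> cball 0 R" for k x
  proof -
    have "\<rho> k (x - y) *\<^sub>R f y = \<rho> k (x - y) *\<^sub>R h y" for y
    proof (cases "\<rho> k (x - y) = 0")
      case False
      have "norm (x - y) \<le> L / real (Suc k)" using L(2)[OF False] .
      also have "\<dots> \<le> L" using L(1) by (simp add: field_simps)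
      finally have "norm y \<le> R + L" using x norm_triangle_ineq4[of x "x - y"] by simp
      then show ?thesis by (simp add: h_def)
    qed simp
    then have "conv (\<rho> k) f x = conv (\<rho> k) h x" unfolding conv_def by (simp only:)
    moreover have "f x = h x" using x L(1) by (simp add: h_def)
    ultimately show ?thesis by simp
  qed
  note lf = continuous_borel_measurable[OF conv_continuous[OF f r]]
  note [measurable] = lf loc_int_measurable[OF f] borel_measurable_integrable[OF h]
     continuous_borel_measurable[OF conv_continuous[OF integrable_loc_int[OF h] r]]
  have "ennreal (LINT x:cball 0 R|lborel. norm (conv (\<rho> k) f x - f x))
      \<le> (\<integral>\<^sup>+x. norm (conv (\<rho> k) h x - h x) \<partial>lborel)" for k
  proof -
    have "ennreal (LINT x:cball 0 R|lborel. norm (conv (\<rho> k) f x - f x))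
        \<le> (\<integral>\<^sup>+x. indicat_real (cball 0 R) x * norm (conv (\<rho> k) f x - f x) \<partial>lborel)"
      unfolding set_lebesgue_integral_def
      by (cases "integrable lborel (\<lambda>x. indicat_real (cball 0 R) x *\<^sub>R norm (conv (\<rho> k) f x - f x))")
         (auto simp: nn_integral_eq_integral not_integrable_integral_eq)
    also have "\<dots> \<le> (\<integral>\<^sup>+x. norm (conv (\<rho> k) h x - h x) \<partial>lborel)"
      by (intro nn_integral_mono ennreal_leI) (auto simp: indicator_def cv)
    finally show ?thesis .
  qed
  then have "(\<lambda>k. ennreal (LINT x:cball 0 R|lborel. norm (conv (\<rho> k) f x - f x))) \<longlonglongrightarrow> 0"
    by (intro tendsto_sandwich[OF _ _ tendsto_const mollifier_L1[OF m h]]) auto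
  then have "(\<lambda>k. ennreal (LINT x:cball 0 R|lborel. norm (conv (\<rho> k) f x - f x))) \<longlonglongrightarrow> ennreal 0"
    by simp
  then show ?thesis
    by (subst (asm) tendsto_ennreal_iff) (auto intro!: always_eventually Bochner_Integration.integral_nonneg simp: set_lebesgue_integral_def)
qed

section \<open>Projection onto a ball of complex numbers\<close>

text \<open>The nearest-point projection onto the closed ball of radius R.\<close>

definition trunc :: "real \<Rightarrow> complex \<Rightarrow> complex"
  where "trunc R z = (if norm z \<le> R then z else (R / norm z) *\<^sub>R z)"

lemma norm_trunc_le: "R \<ge> 0 \<Longrightarrow> norm (trunc R z) \<le> R" "R \<ge> 0 \<Longrightarrow> norm (trunc R z) \<le> norm z"
  by (auto simp: trunc_def)

lemma trunc_eq: "norm z \<le> R \<Longrightarrow> trunc R z = z"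
  by (simp add: trunc_def)

lemma trunc_pos_multiple: "R > 0 \<Longrightarrow> \<exists>a\<ge>0. trunc R z = a *\<^sub>R z"
proof (cases "norm z \<le> R")
  case True
  then show ?thesis by (intro exI[of _ 1]) (simp add: trunc_def)
next
  case False
  then show "R > 0 \<Longrightarrow> ?thesis" by (intro exI[of _ "R / norm z"]) (simp add: trunc_def)
qed

text \<open>The variational characterisation of the nearest point of a convex set.\<close>

lemma trunc_variational:
  assumes "R > 0" "norm y \<le> R"
  shows "inner (z - trunc R z) (y - trunc R z) \<le> 0"
proof (cases "norm z \<le> R")
  case False
  then have z: "norm z > R" "norm z > 0" using assms(1) by auto
  have "inner (z - trunc R z) (y - trunc R z) = (1 - R / norm z) * (inner z y - R * norm z)"
    using z by (simp add: trunc_def inner_diff_left inner_diff_right dot_square_norm power2_eq_square field_simps)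
  moreover have "inner z y \<le> R * norm z"
    using norm_cauchy_schwarz[of z y] assms(2) mult_left_mono[of "norm y" R "norm z"] by (simp add: mult.commute)
  ultimately show ?thesis using z by (simp add: mult_nonneg_nonpos)
qed (simp add: trunc_def)

text \<open>Add the variational inequalities at z and at y.\<close>

lemma trunc_firmly_nonexpansive:
  assumes "R > 0"
  shows "(norm (trunc R z - trunc R y))\<^sup>2 \<le> inner (z - y) (trunc R z - trunc R y)"
proof -
  have "inner (z - trunc R z) (trunc R y - trunc R z) \<le> 0" "inner (y - trunc R y) (trunc R z - trunc R y) \<le> 0"
    using assms by (auto intro!: trunc_variational norm_trunc_le)
  then show ?thesis
    by (simp add: power2_norm_eq_inner inner_diff_left inner_diff_right inner_commute)
qed

lemma trunc_nonexpansive: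
  assumes "R > 0"
  shows "norm (trunc R z - trunc R y) \<le> norm (z - y)"
proof (cases "trunc R z = trunc R y")
  case False
  have "(norm (trunc R z - trunc R y))\<^sup>2 \<le> norm (z - y) * norm (trunc R z - trunc R y)"
    using trunc_firmly_nonexpansive[OF assms] norm_cauchy_schwarz order_trans by blast
  with False show ?thesis by (simp add: power2_eq_square)
qed simp

lemma continuous_trunc:
  assumes "R > 0" shows "continuous_on UNIV (trunc R)"
proof (rule lipschitz_on_continuous_on)
  show "1-lipschitz_on UNIV (trunc R)"
    using trunc_nonexpansive[OF assms] by (auto simp: lipschitz_on_def dist_norm)
qed

section \<open>Integrals of periodic functions over a cube\<close>

text \<open>Half-open, so that the cube with half side L is exactly one fundamental domain of the lattice of
periods 2 L and can be cut and reassembled without exceptional sets.\<close>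

definition cube :: "real \<Rightarrow> (real ^ 'n::finite) set"
  where "cube L = {x. \<forall>i. - L \<le> x $ i \<and> x $ i < L}"

lemma cube_subset_cbox: "cube L \<subseteq> cbox (- (L *\<^sub>R 1)) (L *\<^sub>R 1)"
  by (auto simp: cube_def mem_box_cart less_imp_le)

lemma bounded_cube: "bounded (cube L)"
  using cube_subset_cbox bounded_cbox bounded_subset by blast

lemma cube_measurable [measurable]: "cube L \<in> sets borel"
  unfolding cube_def by measurable

lemma continuous_loc_int:
  fixes f :: "real ^ 'n::finite \<Rightarrow> 'b::{banach, second_countable_topology}"
  assumes "continuous_on UNIV f" shows "loc_int f"
  unfolding loc_int_def set_integrable_def
  using continuous_borel_measurable[OF assms] borel_integrable_compact[of "cball 0 _" f] assms
  by (auto intro: continuous_on_subset)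

lemma cube_integrable: "loc_int f \<Longrightarrow> set_integrable lborel (cube L) f"
  by (rule loc_int_set_integrable[OF _ bounded_cube cube_measurable])

definition cube_int :: "real \<Rightarrow> (real ^ 'n::finite \<Rightarrow> real) \<Rightarrow> real"
  where "cube_int L f = (LINT x:cube L|lborel. f x)"

lemma cube_int_diff: "loc_int f \<Longrightarrow> loc_int g \<Longrightarrow> cube_int L (\<lambda>x. f x - g x) = cube_int L f - cube_int L g"
  unfolding cube_int_def by (intro set_integral_diff cube_integrable)

lemma cube_int_add: "loc_int f \<Longrightarrow> loc_int g \<Longrightarrow> cube_int L (\<lambda>x. f x + g x) = cube_int L f + cube_int L g"
  unfolding cube_int_def by (intro set_integral_add cube_integrable)

lemma cube_int_cmult: "cube_int L (\<lambda>x. a * f x) = a * cube_int L f"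
  unfolding cube_int_def by (rule set_integral_mult_right)

lemma cube_int_minus: "cube_int L (\<lambda>x. - f x) = - cube_int L f"
  using cube_int_cmult[of L "-1" f] by simp

lemma loc_int_add: "loc_int f \<Longrightarrow> loc_int g \<Longrightarrow> loc_int (\<lambda>x. f x + g x)"
  unfolding loc_int_def by auto

lemma loc_int_sum: "(\<And>i. i \<in> S \<Longrightarrow> loc_int (f i)) \<Longrightarrow> loc_int (\<lambda>x. \<Sum>i\<in>S. f i x)"
proof (induction S rule: infinite_finite_induct)
  case (insert i S)
  then show ?case by (simp add: loc_int_add)
qed (auto intro!: continuous_loc_int)

lemma cube_int_sum:
  "finite S \<Longrightarrow> (\<And>i. i \<in> S \<Longrightarrow> loc_int (f i)) \<Longrightarrow> cube_int L (\<lambda>x. \<Sum>i\<in>S. f i x) = (\<Sum>i\<in>S. cube_int L (f i))"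
proof (induction S rule: finite_induct)
  case (insert i S)
  then show ?case by (simp add: cube_int_add loc_int_sum)
qed (simp add: cube_int_def set_lebesgue_integral_def)

lemma cube_int_mono:
  assumes "loc_int f" "loc_int g" "\<And>x. x \<in> cube L \<Longrightarrow> f x \<le> g x"
  shows "cube_int L f \<le> cube_int L g"
  unfolding cube_int_def using assms by (intro set_integral_mono cube_integrable) auto

lemma cube_int_nonneg: "(\<And>x. 0 \<le> f x) \<Longrightarrow> 0 \<le> cube_int L f"
  unfolding cube_int_def set_lebesgue_integral_def
  by (intro Bochner_Integration.integral_nonneg) auto

lemma loc_int_cmult: "loc_int f \<Longrightarrow> loc_int (\<lambda>x. a * (f x :: real))"
  unfolding loc_int_def by auto

abbreviation shift :: "'n::finite \<Rightarrow> real \<Rightarrow> real ^ 'n \<Rightarrow> real ^ 'n"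
  where "shift i s x \<equiv> x + s *\<^sub>R axis i 1"

definition periodic :: "real \<Rightarrow> (real ^ 'n::finite \<Rightarrow> 'b) \<Rightarrow> bool"
  where "periodic P f \<longleftrightarrow> (\<forall>i x. f (shift i P x) = f x)"

text \<open>The translated cube sticks out of the original one by a slab; moving this slab back by one period
reassembles the original cube, and f does not change under this motion.\<close>

lemma cube_int_shift:
  fixes f :: "real ^ 'n::finite \<Rightarrow> real"
  assumes f: "loc_int f" and per: "periodic (2 * L) f" and s: "0 \<le> s" "s < 2 * L"
  shows "cube_int L (\<lambda>x. f (shift i s x)) = cube_int L f"
proof -
  note [measurable] = loc_int_measurable[OF f]
  let ?e = "axis i 1 :: real ^ 'n"
  let ?A = "{x \<in> cube L. x $ i \<ge> s - L}" and ?B = "{x \<in> cube L. x $ i < s - L}"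
  have meas [measurable]: "?A \<in> sets borel" "?B \<in> sets borel" by measurable
  have i: "set_integrable lborel ?A f" "set_integrable lborel ?B f"
    by (rule loc_int_set_integrable[OF f bounded_subset[OF bounded_cube] ]; auto)+
  \<comment> \<open>The left-hand side is the indicator of the translated cube; the set B is the slab that is moved by one period.\<close>
  have ind: "indicat_real (cube L) (y - s *\<^sub>R ?e) = indicat_real ?A y + indicat_real ?B (y - (2 * L) *\<^sub>R ?e)" for y
  proof -
    define oth where "oth \<longleftrightarrow> (\<forall>j. j \<noteq> i \<longrightarrow> - L \<le> y $ j \<and> y $ j < L)"
    have cube_iff: "y - t *\<^sub>R ?e \<in> cube L \<longleftrightarrow> oth \<and> - L \<le> y $ i - t \<and> y $ i - t < L" for t
      unfolding cube_def oth_def by (auto simp: axis_def)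
    have a: "y \<in> cube L \<longleftrightarrow> oth \<and> - L \<le> y $ i \<and> y $ i < L" using cube_iff[of 0] by simp
    have c: "(y - (2 * L) *\<^sub>R ?e) $ i = y $ i - 2 * L" by (simp add: axis_def)
    show ?thesis
      using s unfolding indicator_def mem_Collect_eq cube_iff a c by (auto split: if_splits)
  qed
  have "cube_int L (\<lambda>x. f (shift i s x)) = (LINT y|lborel. indicat_real (cube L) (y - s *\<^sub>R ?e) * f y)"
    unfolding cube_int_def set_lebesgue_integral_def
    using lborel_integral_shift[of "\<lambda>y. indicat_real (cube L) (y - s *\<^sub>R ?e) * f y" "s *\<^sub>R ?e"] by simp
  also have "\<dots> = (LINT y|lborel. indicat_real ?A y *\<^sub>R f y + indicat_real ?B (y - (2 * L) *\<^sub>R ?e) *\<^sub>R f y)"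
    unfolding ind by (simp add: algebra_simps)
  also have "\<dots> = (LINT y|lborel. indicat_real ?A y *\<^sub>R f y) + (LINT y|lborel. indicat_real ?B (y - (2 * L) *\<^sub>R ?e) *\<^sub>R f y)"
  proof (rule Bochner_Integration.integral_add)
    show "integrable lborel (\<lambda>y. indicat_real ?A y *\<^sub>R f y)"
      using i(1) by (simp add: set_integrable_def)
    have "integrable lborel (\<lambda>y. indicat_real ?B (y + - ((2 * L) *\<^sub>R ?e)) *\<^sub>R f (y + - ((2 * L) *\<^sub>R ?e)))"
      using lborel_integrable_shift[OF i(2)[unfolded set_integrable_def]] .
    moreover have "f (y - (2 * L) *\<^sub>R ?e) = f y" for y
    proof -
      have "f (shift i (2 * L) (y - (2 * L) *\<^sub>R ?e)) = f (y - (2 * L) *\<^sub>R ?e)"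
        using per unfolding periodic_def by blast
      then show ?thesis by simp
    qed
    ultimately show "integrable lborel (\<lambda>y. indicat_real ?B (y - (2 * L) *\<^sub>R ?e) *\<^sub>R f y)"
      by simp
  qed
  also have "(LINT y|lborel. indicat_real ?B (y - (2 * L) *\<^sub>R ?e) *\<^sub>R f y)
      = (LINT y|lborel. indicat_real ?B y *\<^sub>R f (shift i (2 * L) y))"
    using lborel_integral_shift[of "\<lambda>y. indicat_real ?B (y - (2 * L) *\<^sub>R ?e) *\<^sub>R f y" "(2 * L) *\<^sub>R ?e"] by simp
  also have "\<dots> = (LINT y|lborel. indicat_real ?B y *\<^sub>R f y)"
    using per unfolding periodic_def by simp
  also have "(LINT y|lborel. indicat_real ?A y *\<^sub>R f y) + (LINT y|lborel. indicat_real ?B y *\<^sub>R f y)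
      = (LINT y|lborel. indicat_real ?A y *\<^sub>R f y + indicat_real ?B y *\<^sub>R f y)"
    using i by (simp add: set_integrable_def)
  also have "\<dots> = cube_int L f"
    unfolding cube_int_def set_lebesgue_integral_def
    by (intro Bochner_Integration.integral_cong) (auto simp: indicator_def)
  finally show ?thesis .
qed

section \<open>The energy inequality\<close>

text \<open>The difference quotient version, with step h, of the operator i c d/dx_1 + Laplace + 1.\<close>

definition difference_operator :: "real \<Rightarrow> real \<Rightarrow> (real ^ 'n::{finite,one} \<Rightarrow> complex) \<Rightarrow> real ^ 'n::{finite,one} \<Rightarrow> complex"
  where "difference_operator c h w x =
    (\<Sum>i\<in>UNIV. (1 / h\<^sup>2) *\<^sub>R ((w (shift i h x) - w x) - (w x - w (shift i (-h) x))))
    + (c / (2 * h)) *\<^sub>R (\<i> * (w (shift 1 h x) - w (shift 1 (-h) x))) + w x"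

lemma continuous_on_shift:
  "continuous_on UNIV f \<Longrightarrow> continuous_on UNIV (\<lambda>x. f (shift i s x))"
  by (rule continuous_on_compose2[of UNIV f]) (auto intro!: continuous_intros)

lemma cube_int_cont_shift:
  fixes f :: "real ^ 'n::finite \<Rightarrow> real"
  assumes "continuous_on UNIV f" "periodic (2 * L) f" "0 < h" "h < 2 * L"
  shows "cube_int L (\<lambda>x. f (shift i h x)) = cube_int L f"
  using assms by (intro cube_int_shift continuous_loc_int) auto

lemma periodic_shift:
  "periodic P f \<Longrightarrow> f (shift j s (shift i P x)) = f (shift j s x)"
  unfolding periodic_def by (metis (no_types, lifting) add.assoc add.commute)

text \<open>Translate one of the two first differences by h, with \<open>cube_int_cont_shift\<close>.\<close>

lemma second_difference_by_parts:
  fixes w v :: "real ^ 'n::finite \<Rightarrow> complex"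
  assumes cw: "continuous_on UNIV w" and cv: "continuous_on UNIV v"
    and pw: "periodic (2 * L) w" and pv: "periodic (2 * L) v" and h: "0 < h" "h < 2 * L"
  shows "cube_int L (\<lambda>x. inner ((w (shift i h x) - w x) - (w x - w (shift i (-h) x))) (v x))
    = - cube_int L (\<lambda>x. inner (w (shift i h x) - w x) (v (shift i h x) - v x))"
proof -
  note cs = continuous_on_shift[OF cw] continuous_on_shift[OF cv] cw cv
  let ?g = "\<lambda>x. inner (w x - w (shift i (-h) x)) (v x)"
  have cg: "continuous_on UNIV ?g" by (intro continuous_intros cs)
  have "periodic (2 * L) ?g"
    by (simp only: periodic_def periodic_shift[OF pw] pw[unfolded periodic_def, rule_format]
        pv[unfolded periodic_def, rule_format] simp_thms)
  from cube_int_cont_shift[OF cg this h, of i]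
  have g: "cube_int L (\<lambda>x. inner (w (shift i h x) - w x) (v (shift i h x))) = cube_int L ?g"
    by (simp add: algebra_simps)
  have "cube_int L (\<lambda>x. inner ((w (shift i h x) - w x) - (w x - w (shift i (-h) x))) (v x))
      = cube_int L (\<lambda>x. inner (w (shift i h x) - w x) (v x) - ?g x)"
    by (simp only: inner_diff_left)
  also have "\<dots> = cube_int L (\<lambda>x. inner (w (shift i h x) - w x) (v x)) - cube_int L ?g"
    by (intro cube_int_diff continuous_loc_int continuous_intros cs)
  also have "\<dots> = cube_int L (\<lambda>x. inner (w (shift i h x) - w x) (v x) - inner (w (shift i h x) - w x) (v (shift i h x)))"
    unfolding g[symmetric] by (intro cube_int_diff[symmetric] continuous_loc_int continuous_intros cs)
  also have "\<dots> = cube_int L (\<lambda>x. - inner (w (shift i h x) - w x) (v (shift i h x) - v x))"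
    by (simp add: inner_diff_right)
  finally show ?thesis by (simp only: cube_int_minus)
qed

text \<open>Translate the two terms in opposite directions.  This moves the difference from w to v, so that the
first order term of the equation can be estimated by |w| and differences of v.\<close>

lemma first_difference_by_parts:
  fixes w v :: "real ^ 'n::finite \<Rightarrow> complex"
  assumes cw: "continuous_on UNIV w" and cv: "continuous_on UNIV v"
    and pw: "periodic (2 * L) w" and pv: "periodic (2 * L) v" and h: "0 < h" "h < 2 * L"
  shows "cube_int L (\<lambda>x. inner (\<i> * (w (shift i h x) - w (shift i (-h) x))) (v x))
    = cube_int L (\<lambda>x. inner (\<i> * w x) (v (shift i (-h) x) - v (shift i h x)))"
proof -
  note cs = continuous_on_shift[OF cw] continuous_on_shift[OF cv] cw cv
  let ?g = "\<lambda>x. inner (\<i> * w x) (v (shift i (-h) x))" and ?k = "\<lambda>x. inner (\<i> * w (shift i (-h) x)) (v x)"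
  have cg: "continuous_on UNIV ?g" "continuous_on UNIV ?k" by (intro continuous_intros cs)+
  have pg: "periodic (2 * L) ?g" "periodic (2 * L) ?k"
    by (simp_all only: periodic_def periodic_shift[OF pw] periodic_shift[OF pv]
        pw[unfolded periodic_def, rule_format] pv[unfolded periodic_def, rule_format] simp_thms)
  have g: "cube_int L (\<lambda>x. inner (\<i> * w (shift i h x)) (v x)) = cube_int L ?g"
    using cube_int_cont_shift[OF cg(1) pg(1) h, of i] by (simp add: algebra_simps)
  have k: "cube_int L (\<lambda>x. inner (\<i> * w x) (v (shift i h x))) = cube_int L ?k"
    using cube_int_cont_shift[OF cg(2) pg(2) h, of i] by (simp add: algebra_simps)
  have "cube_int L (\<lambda>x. inner (\<i> * (w (shift i h x) - w (shift i (-h) x))) (v x))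
     = cube_int L (\<lambda>x. inner (\<i> * w (shift i h x)) (v x) - ?k x)"
    by (simp only: inner_diff_left right_diff_distrib)
  also have "\<dots> = cube_int L (\<lambda>x. inner (\<i> * w (shift i h x)) (v x)) - cube_int L ?k"
    by (intro cube_int_diff continuous_loc_int continuous_intros cs)
  also have "\<dots> = cube_int L (\<lambda>x. ?g x - inner (\<i> * w x) (v (shift i h x)))"
    unfolding g k[symmetric] by (intro cube_int_diff[symmetric] continuous_loc_int continuous_intros cs)
  finally show ?thesis by (simp only: inner_diff_right)
qed

lemma young_difference:
  fixes a b :: complex
  assumes "c > 0" "h > 0"
  shows "c / (2 * h) * inner a b \<le> c\<^sup>2 / 4 * (norm a)\<^sup>2 + 1 / (4 * h\<^sup>2) * (norm b)\<^sup>2"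
proof -
  have "c / (2 * h) * inner a b \<le> c / (2 * h) * (norm a * norm b)"
    using assms norm_cauchy_schwarz by (intro mult_left_mono) auto
  also have "\<dots> = 1/4 * (2 * (c * norm a) * (norm b / h))" using assms by (simp add: field_simps)
  also have "\<dots> \<le> 1/4 * ((c * norm a)\<^sup>2 + (norm b / h)\<^sup>2)"
    using sum_squares_bound[of "c * norm a" "norm b / h"] by (intro mult_left_mono) auto
  also have "\<dots> = c\<^sup>2 / 4 * (norm a)\<^sup>2 + 1 / (4 * h\<^sup>2) * (norm b)\<^sup>2"
    by (simp add: power_mult_distrib power_divide field_simps)
  finally show ?thesis .
qed

text \<open>Test the difference operator with v = P w.  The second differences give, by firm nonexpansiveness, at most
minus the sum over i of D i / h^2, where D i is the integral of |v(x + h e_i) - v(x)|^2.  The first order term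
is moved to v and estimated by c^2 / 2 times the integral of |w|^2 plus D 1 / (2 h^2); half of the gain from
the second differences absorbs the latter.  The zeroth order term is harmless because w \<bullet> v \<le> |w|^2.\<close>

lemma discrete_energy_inequality:
  fixes w :: "real ^ 'n::{finite,one} \<Rightarrow> complex"
  assumes c: "c > 0" and R: "R > 0" and cw: "continuous_on UNIV w" and pw: "periodic (2 * L) w"
    and h: "0 < h" "h < 2 * L"
  defines "v \<equiv> \<lambda>x. trunc R (w x)"
  shows "cube_int L (\<lambda>x. (norm (v (shift j h x) - v x))\<^sup>2) / h\<^sup>2
    \<le> (c\<^sup>2 + 2) * cube_int L (\<lambda>x. (norm (w x))\<^sup>2) - 2 * cube_int L (\<lambda>x. inner (difference_operator c h w x) (v x))"
proof -
  have cv: "continuous_on UNIV v"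
    unfolding v_def by (rule continuous_on_compose2[OF continuous_trunc[OF R] cw]) auto
  have pv: "periodic (2 * L) v" using pw unfolding v_def periodic_def by simp
  note cs = continuous_on_shift[OF cw] continuous_on_shift[OF cv] cw cv
  define D where "D i = cube_int L (\<lambda>x. (norm (v (shift i h x) - v x))\<^sup>2)" for i
  define W where "W = cube_int L (\<lambda>x. (norm (w x))\<^sup>2)"
  have D0: "D i \<ge> 0" for i unfolding D_def by (rule cube_int_nonneg) simp
  let ?S = "\<lambda>i x. inner ((w (shift i h x) - w x) - (w x - w (shift i (-h) x))) (v x)"
  let ?F = "\<lambda>x. inner (\<i> * (w (shift 1 h x) - w (shift 1 (-h) x))) (v x)"
  have second: "cube_int L (?S i) \<le> - D i" for i
  proof -
    have "D i \<le> cube_int L (\<lambda>x. inner (w (shift i h x) - w x) (v (shift i h x) - v x))"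
      unfolding D_def by (intro cube_int_mono continuous_loc_int continuous_intros cs)
        (simp add: v_def trunc_firmly_nonexpansive[OF R])
    then show ?thesis using second_difference_by_parts[OF cw cv pw pv h, of i] by linarith
  qed
  have Dm: "cube_int L (\<lambda>x. (norm (v (shift i (-h) x) - v x))\<^sup>2) = D i" for i
  proof -
    let ?g = "\<lambda>x. (norm (v (shift i (-h) x) - v x))\<^sup>2"
    have "continuous_on UNIV ?g" by (intro continuous_intros cs)
    moreover have "periodic (2 * L) ?g"
      by (simp only: periodic_def periodic_shift[OF pv] pv[unfolded periodic_def, rule_format] simp_thms)
    ultimately have "cube_int L (\<lambda>x. ?g (shift i h x)) = cube_int L ?g"
      using cube_int_cont_shift h by blast
    then show ?thesis by (simp add: D_def norm_minus_commute)
  qed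
  have first: "c / (2 * h) * cube_int L ?F \<le> c\<^sup>2 / 2 * W + D 1 / (2 * h\<^sup>2)"
  proof -
    have "c / (2 * h) * cube_int L ?F
       = cube_int L (\<lambda>x. c / (2 * h) * inner (\<i> * w x) (v (shift 1 (-h) x) - v (shift 1 h x)))"
      by (simp only: first_difference_by_parts[OF cw cv pw pv h] cube_int_cmult)
    also have "\<dots> \<le> cube_int L (\<lambda>x. c\<^sup>2 / 2 * (norm (w x))\<^sup>2 + (1 / (4 * h\<^sup>2) * (norm (v (shift 1 (-h) x) - v x))\<^sup>2
          + 1 / (4 * h\<^sup>2) * (norm (v (shift 1 h x) - v x))\<^sup>2))"
    proof (intro cube_int_mono continuous_loc_int continuous_intros cs)
      fix x
      have "v (shift 1 (-h) x) - v (shift 1 h x) = (v (shift 1 (-h) x) - v x) + (v x - v (shift 1 h x))" by simp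
      then have "c / (2 * h) * inner (\<i> * w x) (v (shift 1 (-h) x) - v (shift 1 h x))
         = c / (2 * h) * inner (\<i> * w x) (v (shift 1 (-h) x) - v x) + c / (2 * h) * inner (\<i> * w x) (v x - v (shift 1 h x))"
        by (simp only: inner_add_right distrib_left)
      then show "c / (2 * h) * inner (\<i> * w x) (v (shift 1 (-h) x) - v (shift 1 h x))
         \<le> c\<^sup>2 / 2 * (norm (w x))\<^sup>2 + (1 / (4 * h\<^sup>2) * (norm (v (shift 1 (-h) x) - v x))\<^sup>2
          + 1 / (4 * h\<^sup>2) * (norm (v (shift 1 h x) - v x))\<^sup>2)"
        using young_difference[OF c h(1), of "\<i> * w x" "v (shift 1 (-h) x) - v x"]
          young_difference[OF c h(1), of "\<i> * w x" "v x - v (shift 1 h x)"]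
        by (simp add: norm_mult norm_minus_commute)
    qed
    also have "\<dots> = c\<^sup>2 / 2 * W + (1 / (4 * h\<^sup>2) * D 1 + 1 / (4 * h\<^sup>2) * D 1)"
    proof -
      have a: "cube_int L (\<lambda>x. f x + (g x + k x)) = cube_int L f + (cube_int L g + cube_int L k)"
        if "continuous_on UNIV f" "continuous_on UNIV g" "continuous_on UNIV k" for f g k :: "real ^ 'n::{finite,one} \<Rightarrow> real"
        using that by (simp add: cube_int_add continuous_loc_int loc_int_add)
      show ?thesis
        by (subst a) (auto intro!: continuous_intros cs simp only: cube_int_cmult W_def Dm D_def)
    qed
    finally show ?thesis by (simp add: field_simps)
  qed
  have third: "cube_int L (\<lambda>x. inner (w x) (v x)) \<le> W"
    unfolding W_def
  proof (intro cube_int_mono continuous_loc_int continuous_intros cs)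
    fix x
    have "inner (w x) (v x) \<le> norm (w x) * norm (v x)" by (rule norm_cauchy_schwarz)
    also have "\<dots> \<le> norm (w x) * norm (w x)"
      unfolding v_def using R by (intro mult_left_mono norm_trunc_le) auto
    finally show "inner (w x) (v x) \<le> (norm (w x))\<^sup>2" by (simp add: power2_eq_square)
  qed
  have "cube_int L (\<lambda>x. inner (difference_operator c h w x) (v x))
     = cube_int L (\<lambda>x. (\<Sum>i\<in>UNIV. 1 / h\<^sup>2 * ?S i x) + (c / (2 * h) * ?F x + inner (w x) (v x)))"
    unfolding difference_operator_def by (simp only: inner_add_left inner_sum_left inner_scaleR_left add.assoc)
  also have "\<dots> = cube_int L (\<lambda>x. \<Sum>i\<in>UNIV. 1 / h\<^sup>2 * ?S i x) + cube_int L (\<lambda>x. c / (2 * h) * ?F x + inner (w x) (v x))"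
    by (intro cube_int_add continuous_loc_int continuous_intros cs)
  also have "cube_int L (\<lambda>x. \<Sum>i\<in>UNIV. 1 / h\<^sup>2 * ?S i x) = (\<Sum>i\<in>UNIV. 1 / h\<^sup>2 * cube_int L (?S i))"
    by (subst cube_int_sum) (auto intro!: continuous_loc_int continuous_intros cs simp only: cube_int_cmult finite)
  also have "cube_int L (\<lambda>x. c / (2 * h) * ?F x + inner (w x) (v x)) = c / (2 * h) * cube_int L ?F + cube_int L (\<lambda>x. inner (w x) (v x))"
    by (subst cube_int_add) (auto intro!: continuous_loc_int continuous_intros cs simp only: cube_int_cmult)
  finally have split: "cube_int L (\<lambda>x. inner (difference_operator c h w x) (v x)) = (\<Sum>i\<in>UNIV. 1 / h\<^sup>2 * cube_int L (?S i))
      + (c / (2 * h) * cube_int L ?F + cube_int L (\<lambda>x. inner (w x) (v x)))" .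
  have "(\<Sum>i\<in>UNIV. 1 / h\<^sup>2 * cube_int L (?S i)) \<le> (\<Sum>i\<in>UNIV. 1 / h\<^sup>2 * - D i)"
    by (intro sum_mono mult_left_mono second) simp
  with split first third have main: "cube_int L (\<lambda>x. inner (difference_operator c h w x) (v x))
      \<le> (\<Sum>i\<in>UNIV. 1 / h\<^sup>2 * - D i) + (c\<^sup>2 / 2 * W + D 1 / (2 * h\<^sup>2) + W)"
    by linarith
  have s1: "(\<Sum>i\<in>UNIV. 1 / h\<^sup>2 * - D i) = - ((\<Sum>i\<in>UNIV. D i) / h\<^sup>2)"
    by (simp add: sum_negf sum_divide_distrib)
  \<comment> \<open>The factor 2 is there because j may be equal to 1.\<close>
  have "D j + D 1 \<le> 2 * (\<Sum>i\<in>UNIV. D i)"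
    using member_le_sum[of j UNIV D] member_le_sum[of 1 UNIV D] D0 by simp
  then have "(D j + D 1) / h\<^sup>2 \<le> (2 * (\<Sum>i\<in>UNIV. D i)) / h\<^sup>2" by (rule divide_right_mono) simp
  then have s2: "D j / h\<^sup>2 + D 1 / h\<^sup>2 \<le> 2 * ((\<Sum>i\<in>UNIV. D i) / h\<^sup>2)" by (simp add: add_divide_distrib)
  have s3: "D 1 / (2 * h\<^sup>2) = (D 1 / h\<^sup>2) / 2" by simp
  have s4: "(c\<^sup>2 + 2) * W = 2 * (c\<^sup>2 / 2 * W) + 2 * W"
    by (simp add: algebra_simps)
  \<comment> \<open>The form in which the estimates are combined: e is the tested operator, S the sum of all D i / h^2.\<close>
  have arith: "y \<le> (2 * a + 2 * b) - 2 * e" if "e \<le> - S + (a + d / 2 + b)" "y + d \<le> 2 * S"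
    for e S a d b y :: real
    using that by linarith
  have "D j / h\<^sup>2 \<le> (c\<^sup>2 + 2) * W - 2 * cube_int L (\<lambda>x. inner (difference_operator c h w x) (v x))"
    using arith[OF main[unfolded s1 s3] s2] unfolding s4 .
  then show ?thesis unfolding D_def W_def .
qed

text \<open>Cut the translation into m equal steps and use the Cauchy-Schwarz inequality; every step contributes
the same integral since the integrand is periodic.\<close>

lemma translation_subdivision:
  fixes v :: "real ^ 'n::finite \<Rightarrow> complex"
  assumes cv: "continuous_on UNIV v" and pv: "periodic (2 * L) v" and s: "0 < s" "s < 2 * L" and m: "m > 0"
  shows "cube_int L (\<lambda>x. (norm (v (shift i s x) - v x))\<^sup>2)
    \<le> (real m)\<^sup>2 * cube_int L (\<lambda>x. (norm (v (shift i (s / real m) x) - v x))\<^sup>2)"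
proof -
  define h where "h = s / real m"
  note cs = continuous_on_shift[OF cv] cv
  let ?d = "\<lambda>k x. v (shift i (real (Suc k) * h) x) - v (shift i (real k * h) x)"
  have pt: "(norm (v (shift i s x) - v x))\<^sup>2 \<le> (\<Sum>k<m. real m * (norm (?d k x))\<^sup>2)" for x
  proof -
    have "v (shift i s x) - v x = (\<Sum>k<m. ?d k x)"
      using m by (subst sum_lessThan_telescope) (simp add: h_def)
    then have "norm (v (shift i s x) - v x) \<le> (\<Sum>k<m. norm (?d k x))"
      by (simp only: norm_sum)
    then have "(norm (v (shift i s x) - v x))\<^sup>2 \<le> (\<Sum>k<m. norm (?d k x))\<^sup>2"
      by (intro power_mono) auto
    also have "\<dots> \<le> (\<Sum>k<m. (norm (?d k x))\<^sup>2) * real (card {..<m})"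
      by (rule sum_squared_le_sum_of_squares)
    finally show ?thesis by (simp add: sum_distrib_left mult.commute)
  qed
  have each: "cube_int L (\<lambda>x. (norm (?d k x))\<^sup>2) = cube_int L (\<lambda>x. (norm (v (shift i h x) - v x))\<^sup>2)" if k: "k < m" for k
  proof -
    let ?g = "\<lambda>x. (norm (v (shift i h x) - v x))\<^sup>2"
    have cg: "continuous_on UNIV ?g" by (intro continuous_intros cs)
    have pg: "periodic (2 * L) ?g"
      by (simp only: periodic_def periodic_shift[OF pv] pv[unfolded periodic_def, rule_format] simp_thms)
    have "real k * h \<le> s" using k s m by (simp add: h_def field_simps)
    then have "cube_int L (\<lambda>x. ?g (shift i (real k * h) x)) = cube_int L ?g"
      using s m by (intro cube_int_shift continuous_loc_int cg pg) (auto simp: h_def)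
    then show ?thesis by (simp add: algebra_simps)
  qed
  have "cube_int L (\<lambda>x. (norm (v (shift i s x) - v x))\<^sup>2) \<le> cube_int L (\<lambda>x. \<Sum>k<m. real m * (norm (?d k x))\<^sup>2)"
    by (intro cube_int_mono pt continuous_loc_int continuous_intros cs)
  also have "\<dots> = (\<Sum>k<m. real m * cube_int L (\<lambda>x. (norm (?d k x))\<^sup>2))"
    by (subst cube_int_sum) (auto intro!: continuous_loc_int continuous_intros cs simp only: cube_int_cmult finite_lessThan)
  also have "\<dots> = (\<Sum>k<m. real m * cube_int L (\<lambda>x. (norm (v (shift i h x) - v x))\<^sup>2))"
    by (intro sum.cong refl) (simp only: each lessThan_iff)
  finally show ?thesis by (simp add: h_def power2_eq_square mult.assoc)
qed

text \<open>Apply \<open>discrete_energy_inequality\<close> with step s / m and recover the translation by s from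
\<open>translation_subdivision\<close>: the factors m^2 and (s / m)^2 combine to s^2.  The hypothesis says that
w solves the equation with right-hand side H in the sense of difference quotients; its error is of order
1 / m and disappears in the limit.\<close>

lemma energy_inequality:
  fixes w H :: "real ^ 'n::{finite,one} \<Rightarrow> complex"
  assumes c: "c > 0" and R: "R > 0" and cw: "continuous_on UNIV w" and pw: "periodic (2 * L) w"
    and cH: "continuous_on UNIV H" and s: "0 < s" "s < 2 * L"
    and eq: "\<And>h x. 0 < h \<Longrightarrow> h \<le> 1 \<Longrightarrow> x \<in> cube L \<Longrightarrow> norm (difference_operator c h w x - H x) \<le> C * h"
  defines "v \<equiv> \<lambda>x. trunc R (w x)"
  shows "cube_int L (\<lambda>x. (norm (v (shift j s x) - v x))\<^sup>2)
    \<le> s\<^sup>2 * ((c\<^sup>2 + 2) * cube_int L (\<lambda>x. (norm (w x))\<^sup>2) - 2 * cube_int L (\<lambda>x. inner (H x) (v x)))"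
    (is "?lhs \<le> s\<^sup>2 * ?E")
proof -
  have cv: "continuous_on UNIV v"
    unfolding v_def by (rule continuous_on_compose2[OF continuous_trunc[OF R] cw]) auto
  have pv: "periodic (2 * L) v" using pw unfolding v_def periodic_def by simp
  note cs = continuous_on_shift[OF cw] continuous_on_shift[OF cv] cw cv cH
  define V where "V = cube_int L (\<lambda>x :: real ^ 'n::{finite,one}. 1)"
  have step: "?lhs \<le> s\<^sup>2 * ?E + (2 * s ^ 3 * C * R * V) / real m" if m: "real m \<ge> s" "m > 0" for m
  proof -
    define h where "h = s / real m"
    have "s < 2 * L * real m"
      using s m by (intro less_le_trans[OF s(2)]) (simp add: mult_le_cancel_left1 Suc_le_eq)
    then have h: "0 < h" "h \<le> 1" "h < 2 * L" using s m by (auto simp: h_def field_simps)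
    have cont_fd: "continuous_on UNIV (difference_operator c h w)"
      unfolding difference_operator_def by (intro continuous_intros cs)
    have "cube_int L (\<lambda>x. inner (H x) (v x)) - cube_int L (\<lambda>x. inner (difference_operator c h w x) (v x))
        = cube_int L (\<lambda>x. inner (H x) (v x) - inner (difference_operator c h w x) (v x))"
      by (intro cube_int_diff[symmetric] continuous_loc_int continuous_intros cs cont_fd)
    also have "\<dots> \<le> cube_int L (\<lambda>x :: real ^ 'n::{finite,one}. (C * h * R) * 1)"
    proof (intro cube_int_mono continuous_loc_int continuous_intros cs cont_fd)
      fix x :: "real ^ 'n::{finite,one}" assume x: "x \<in> cube L"
      have "inner (H x) (v x) - inner (difference_operator c h w x) (v x) = inner (H x - difference_operator c h w x) (v x)"
        by (simp add: inner_diff_left)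
      also have "\<dots> \<le> norm (H x - difference_operator c h w x) * norm (v x)" by (rule norm_cauchy_schwarz)
      also have "\<dots> \<le> (C * h) * R"
        using eq[OF h(1,2) x] R order_trans[OF norm_ge_zero eq[OF h(1,2) x]]
        unfolding v_def by (intro mult_mono norm_trunc_le) (auto simp: norm_minus_commute)
      finally show "inner (H x) (v x) - inner (difference_operator c h w x) (v x) \<le> C * h * R * 1" by simp
    qed
    also have "\<dots> = C * h * R * V" by (simp only: cube_int_cmult V_def)
    finally have err: "cube_int L (\<lambda>x. inner (H x) (v x)) - cube_int L (\<lambda>x. inner (difference_operator c h w x) (v x)) \<le> C * h * R * V" .
    have "cube_int L (\<lambda>x. (norm (v (shift j h x) - v x))\<^sup>2) / h\<^sup>2 \<le> ?E + 2 * (C * h * R * V)"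
      using discrete_energy_inequality[OF c R cw pw h(1,3), of j] err unfolding v_def by linarith
    then have "s\<^sup>2 * (cube_int L (\<lambda>x. (norm (v (shift j h x) - v x))\<^sup>2) / h\<^sup>2) \<le> s\<^sup>2 * (?E + 2 * (C * h * R * V))"
      by (intro mult_left_mono) auto
    moreover have "s\<^sup>2 * (cube_int L (\<lambda>x. (norm (v (shift j h x) - v x))\<^sup>2) / h\<^sup>2)
        = (real m)\<^sup>2 * cube_int L (\<lambda>x. (norm (v (shift j h x) - v x))\<^sup>2)"
      using s m by (simp add: h_def power_divide)
    moreover have "?lhs \<le> (real m)\<^sup>2 * cube_int L (\<lambda>x. (norm (v (shift j h x) - v x))\<^sup>2)"
      unfolding h_def by (rule translation_subdivision[OF cv pv s m(2)])
    moreover have "s\<^sup>2 * (?E + 2 * (C * h * R * V)) = s\<^sup>2 * ?E + (2 * s ^ 3 * C * R * V) / real m"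
      by (simp add: h_def power2_eq_square power3_eq_cube algebra_simps)
    ultimately show ?thesis by linarith
  qed
  have "eventually (\<lambda>m. real m \<ge> s \<and> m > 0) sequentially"
    using eventually_ge_at_top[of "nat \<lceil>s\<rceil>"] eventually_gt_at_top[of 0] by eventually_elim linarith
  then have ev: "eventually (\<lambda>m. ?lhs \<le> s\<^sup>2 * ?E + (2 * s ^ 3 * C * R * V) / real m) sequentially"
    by eventually_elim (use step in auto)
  have "(\<lambda>m. s\<^sup>2 * ?E + (2 * s ^ 3 * C * R * V) / real m) \<longlonglongrightarrow> s\<^sup>2 * ?E + 0"
    by (intro tendsto_add tendsto_const lim_const_over_n)
  from tendsto_lowerbound[OF this ev] show ?thesis by simp
qed

section \<open>Difference quotients of convolutions\<close>

text \<open>Taylor expansion to third order along the line through z in direction i.  The third derivatives are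
bounded, which gives bounds that are uniform in z.\<close>

lemma difference_quotient_taylor:
  fixes \<rho> :: "real ^ 'n::finite \<Rightarrow> real"
  assumes r: "\<rho> \<in> real_tests"
  shows "\<exists>M>0. \<forall>h z i.
     \<bar>(\<rho> (shift i h z) - \<rho> z) - (\<rho> z - \<rho> (shift i (-h) z)) - h\<^sup>2 * real_partial i (real_partial i \<rho>) z\<bar> \<le> M * \<bar>h\<bar> ^ 3 \<and>
     \<bar>\<rho> (shift i h z) - \<rho> (shift i (-h) z) - 2 * h * real_partial i \<rho> z\<bar> \<le> M * \<bar>h\<bar> ^ 3"
proof -
  have rt: "(real_partial i ^^ m) \<rho> \<in> real_tests" for i m
    by (induction m) (auto simp: r real_tests_real_partial)
  have "\<forall>i. \<exists>M>0. \<forall>x. \<bar>(real_partial i ^^ 3) \<rho> x\<bar> \<le> M"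
    using real_tests_bounded[OF rt] by blast
  then obtain K where K: "\<And>i. K i > 0" "\<And>i x. \<bar>(real_partial i ^^ 3) \<rho> x\<bar> \<le> K i" by metis
  \<comment> \<open>A bound for all directions at once.\<close>
  define M where "M = (\<Sum>i\<in>UNIV. K i)"
  have KM: "K i \<le> M" for i unfolding M_def by (rule member_le_sum) (auto simp: K less_imp_le)
  have taylor: "\<exists>t. \<rho> (shift i h z) = \<rho> z + h * real_partial i \<rho> z + h\<^sup>2 / 2 * real_partial i (real_partial i \<rho>) z
      + (real_partial i ^^ 3) \<rho> (shift i t z) / 6 * h ^ 3" for i h z
  proof -
    have "\<exists>t. \<bar>t\<bar> \<le> \<bar>h\<bar> \<and> \<rho> (shift i h z) = (\<Sum>m<3. ((real_partial i ^^ m) \<rho> (shift i 0 z) / fact m) * h ^ m)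
        + ((real_partial i ^^ 3) \<rho> (shift i t z) / fact 3) * h ^ 3"
      by (rule Maclaurin_all_le[where diff = "\<lambda>m t. (real_partial i ^^ m) \<rho> (shift i t z)"])
        (use real_tests_line_derivative[OF rt] in auto)
    then show ?thesis by (auto simp: eval_nat_numeral lessThan_Suc algebra_simps)
  qed
  show ?thesis
  proof (intro exI[of _ M] conjI allI)
    have "K undefined > 0" by (rule K)
    then show "M > 0" using KM[of undefined] by linarith
    fix h z i
    obtain t where t: "\<rho> (shift i h z) = \<rho> z + h * real_partial i \<rho> z + h\<^sup>2 / 2 * real_partial i (real_partial i \<rho>) z
      + (real_partial i ^^ 3) \<rho> (shift i t z) / 6 * h ^ 3" using taylor by blast
    obtain t' where "\<rho> (shift i (-h) z) = \<rho> z + (-h) * real_partial i \<rho> z + (-h)\<^sup>2 / 2 * real_partial i (real_partial i \<rho>) z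
      + (real_partial i ^^ 3) \<rho> (shift i t' z) / 6 * (-h) ^ 3" using taylor by blast
    then have t': "\<rho> (shift i (-h) z) = \<rho> z - h * real_partial i \<rho> z + h\<^sup>2 / 2 * real_partial i (real_partial i \<rho>) z
      - (real_partial i ^^ 3) \<rho> (shift i t' z) / 6 * h ^ 3" by simp
    define A where "A = (real_partial i ^^ 3) \<rho> (shift i t z)"
    define B where "B = (real_partial i ^^ 3) \<rho> (shift i t' z)"
    have AB: "\<bar>A\<bar> \<le> M" "\<bar>B\<bar> \<le> M" using K(2) KM order_trans unfolding A_def B_def by blast+
    have e1: "(\<rho> (shift i h z) - \<rho> z) - (\<rho> z - \<rho> (shift i (-h) z)) - h\<^sup>2 * real_partial i (real_partial i \<rho>) z = (A - B) / 6 * h ^ 3"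
      unfolding t t' A_def[symmetric] B_def[symmetric] by (simp add: algebra_simps)
    have e2: "\<rho> (shift i h z) - \<rho> (shift i (-h) z) - 2 * h * real_partial i \<rho> z = (A + B) / 6 * h ^ 3"
      unfolding t t' A_def[symmetric] B_def[symmetric] by (simp add: algebra_simps)
    have cube_bound: "\<bar>a * h ^ 3\<bar> \<le> M * \<bar>h\<bar> ^ 3" if "\<bar>a\<bar> \<le> M" for a
      using mult_right_mono[OF that, of "\<bar>h\<bar> ^ 3"] by (simp add: abs_mult power_abs)
    show "\<bar>(\<rho> (shift i h z) - \<rho> z) - (\<rho> z - \<rho> (shift i (-h) z)) - h\<^sup>2 * real_partial i (real_partial i \<rho>) z\<bar> \<le> M * \<bar>h\<bar> ^ 3"
      unfolding e1 using AB abs_triangle_ineq4[of A B] by (intro cube_bound) simp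
    show "\<bar>\<rho> (shift i h z) - \<rho> (shift i (-h) z) - 2 * h * real_partial i \<rho> z\<bar> \<le> M * \<bar>h\<bar> ^ 3"
      unfolding e2 using AB abs_triangle_ineq[of A B] by (intro cube_bound) simp
  qed
qed

lemma norm_conv_bound:
  assumes f: "loc_int f" and k: "continuous_on UNIV \<kappa>" "\<And>x. \<bar>\<kappa> x\<bar> \<le> M" "\<And>x. \<kappa> x \<noteq> 0 \<Longrightarrow> norm x \<le> L"
    and R: "norm x + L \<le> R"
  shows "norm (conv \<kappa> f x) \<le> M * (LINT y:cball 0 R|lborel. norm (f y))"
proof -
  have "norm (conv \<kappa> f x) \<le> (LINT y|lborel. norm (\<kappa> (x - y) *\<^sub>R f y))"
    unfolding conv_def by (rule integral_norm_bound)
  also have "\<dots> \<le> (LINT y|lborel. M * (indicator (cball 0 R) y * norm (f y)))"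
  proof (rule integral_mono)
    show "integrable lborel (\<lambda>y. norm (\<kappa> (x - y) *\<^sub>R f y))"
      by (intro integrable_norm conv_integrable[OF f k(1,3)])
    show "integrable lborel (\<lambda>y. M * (indicator (cball 0 R) y * norm (f y)))"
      using loc_int_norm[OF f] by (auto simp: loc_int_def set_integrable_def)
    show "norm (\<kappa> (x - y) *\<^sub>R f y) \<le> M * (indicator (cball 0 R) y * norm (f y))" for y
      by (rule conv_integrand_bound[OF k(2,3) R])
  qed
  also have "\<dots> = M * (LINT y:cball 0 R|lborel. norm (f y))"
    by (simp add: set_lebesgue_integral_def)
  finally show ?thesis .
qed

lemma conv_kernel_shift: "conv (\<lambda>z. \<rho> (z + a)) f x = conv \<rho> f (x + a)"
  by (simp add: conv_def algebra_simps)

text \<open>The support of a translated kernel grows by at most the length of the translation.\<close>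

lemma norm_axis_step: "norm (z + h *\<^sub>R axis i (1::real)) \<le> L \<Longrightarrow> \<bar>h\<bar> \<le> 1 \<Longrightarrow> norm z \<le> L + 1"
  using norm_triangle_ineq4[of "z + h *\<^sub>R axis i (1::real)" "h *\<^sub>R axis i 1"] by simp

text \<open>Difference quotients of a convolution are convolutions with difference quotients of the kernel.
These approach the derivatives of the kernel uniformly, with an error of order h, so no differentiability
of the convolution has to be discussed.\<close>

lemma difference_operator_conv_consistent:
  fixes f :: "real ^ 'n::{finite,one} \<Rightarrow> complex"
  assumes f: "loc_int f" and r: "\<rho> \<in> real_tests" and c: "c > 0"
  shows "\<exists>C. \<forall>h x. 0 < h \<longrightarrow> h \<le> 1 \<longrightarrow> x \<in> cube L \<longrightarrow>
    norm (difference_operator c h (conv \<rho> f) x - ((\<Sum>i\<in>UNIV. conv (real_partial i (real_partial i \<rho>)) f x)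
        + c *\<^sub>R (\<i> * conv (real_partial 1 \<rho>) f x) + conv \<rho> f x)) \<le> C * h"
proof -
  obtain M where M: "M > 0"
    "\<And>h z i. \<bar>(\<rho> (shift i h z) - \<rho> z) - (\<rho> z - \<rho> (shift i (-h) z)) - h\<^sup>2 * real_partial i (real_partial i \<rho>) z\<bar> \<le> M * \<bar>h\<bar> ^ 3"
    "\<And>h z i. \<bar>\<rho> (shift i h z) - \<rho> (shift i (-h) z) - 2 * h * real_partial i \<rho> z\<bar> \<le> M * \<bar>h\<bar> ^ 3"
    using difference_quotient_taylor[OF r] by blast
  have r1: "real_partial i \<rho> \<in> real_tests" and r2: "real_partial i (real_partial i \<rho>) \<in> real_tests" for i
    using r real_tests_real_partial by auto
  have supp: "\<exists>S>0. \<forall>i x. (\<rho> x \<noteq> 0 \<or> real_partial i \<rho> x \<noteq> 0 \<or> real_partial i (real_partial i \<rho>) x \<noteq> 0) \<longrightarrow> norm x \<le> S"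
  proof -
    obtain S0 where S0: "S0 > 0" "\<And>x. \<rho> x \<noteq> 0 \<Longrightarrow> norm x \<le> S0" using real_tests_support[OF r] by blast
    have "\<forall>i. \<exists>S>0. \<forall>x. real_partial i \<rho> x \<noteq> 0 \<longrightarrow> norm x \<le> S" using real_tests_support[OF r1] by blast
    then obtain S1 where S1: "\<And>i. S1 i > 0" "\<And>i x. real_partial i \<rho> x \<noteq> 0 \<Longrightarrow> norm x \<le> S1 i" by metis
    have "\<forall>i. \<exists>S>0. \<forall>x. real_partial i (real_partial i \<rho>) x \<noteq> 0 \<longrightarrow> norm x \<le> S" using real_tests_support[OF r2] by blast
    then obtain S2 where S2: "\<And>i. S2 i > 0" "\<And>i x. real_partial i (real_partial i \<rho>) x \<noteq> 0 \<Longrightarrow> norm x \<le> S2 i" by metis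
    have "S1 i \<le> sum S1 UNIV" "S2 i \<le> sum S2 UNIV" for i
      by (rule member_le_sum; simp add: less_imp_le S1 S2)+
    moreover have "sum S1 UNIV \<ge> 0" "sum S2 UNIV \<ge> 0" by (rule sum_nonneg; simp add: less_imp_le S1 S2)+
    ultimately show ?thesis
      using S0 S1(2) S2(2)
      by (intro exI[of _ "S0 + sum S1 UNIV + sum S2 UNIV"]) (smt (verit, best))
  qed
  then obtain S where S: "S > 0" "\<And>x. \<rho> x \<noteq> 0 \<Longrightarrow> norm x \<le> S" "\<And>i x. real_partial i \<rho> x \<noteq> 0 \<Longrightarrow> norm x \<le> S"
    "\<And>i x. real_partial i (real_partial i \<rho>) x \<noteq> 0 \<Longrightarrow> norm x \<le> S" by blast
  obtain B where B: "\<And>x :: real ^ 'n::{finite,one}. x \<in> cube L \<Longrightarrow> norm x \<le> B"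
    using bounded_cube unfolding bounded_iff by blast
  define N where "N = (LINT y:cball 0 (B + (S + 1))|lborel. norm (f y))"
  have N: "N \<ge> 0" unfolding N_def set_lebesgue_integral_def by (rule Bochner_Integration.integral_nonneg) auto
  note cont = real_tests_continuous[OF r] real_tests_continuous[OF r1] real_tests_continuous[OF r2]
  note cs = cont continuous_on_shift[OF cont(1)]
  have int: "integrable lborel (\<lambda>y. \<rho> (a - y) *\<^sub>R f y)"
    "integrable lborel (\<lambda>y. real_partial i \<rho> (a - y) *\<^sub>R f y)"
    "integrable lborel (\<lambda>y. real_partial i (real_partial i \<rho>) (a - y) *\<^sub>R f y)" for a i
    by (intro real_tests_conv_integrable f r r1 r2)+
  have est: "norm ((conv \<rho> f (shift i h x) - conv \<rho> f x) - (conv \<rho> f x - conv \<rho> f (shift i (-h) x))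
       - h\<^sup>2 *\<^sub>R conv (real_partial i (real_partial i \<rho>)) f x) \<le> M * h ^ 3 * N"
    "norm (conv \<rho> f (shift i h x) - conv \<rho> f (shift i (-h) x) - (2 * h) *\<^sub>R conv (real_partial i \<rho>) f x) \<le> M * h ^ 3 * N"
    if h: "0 < h" "h \<le> 1" and x: "x \<in> cube L" for h x i
  proof -
    let ?k = "\<lambda>z. (\<rho> (shift i h z) - \<rho> z) - (\<rho> z - \<rho> (shift i (-h) z)) - h\<^sup>2 * real_partial i (real_partial i \<rho>) z"
    let ?l = "\<lambda>z. \<rho> (shift i h z) - \<rho> (shift i (-h) z) - 2 * h * real_partial i \<rho> z"
    have step: "norm z \<le> S + 1" if "norm (shift i h z) \<le> S \<or> norm (shift i (-h) z) \<le> S" for z :: "real ^ 'n::{finite,one}"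
      using that norm_axis_step[of z h i S] norm_axis_step[of z "-h" i S] h by auto
    have k0: "norm z \<le> S + 1" if "?k z \<noteq> 0" for z
    proof (rule ccontr)
      assume n: "\<not> norm z \<le> S + 1"
      then have "\<rho> z = 0" "real_partial i (real_partial i \<rho>) z = 0" using S(2,4) by fastforce+
      moreover have "\<rho> (shift i h z) = 0" "\<rho> (shift i (-h) z) = 0" using S(2) step n by blast+
      ultimately show False using that by simp
    qed
    have l0: "norm z \<le> S + 1" if "?l z \<noteq> 0" for z
    proof (rule ccontr)
      assume n: "\<not> norm z \<le> S + 1"
      then have "real_partial i \<rho> z = 0" using S(3) by fastforce
      moreover have "\<rho> (shift i h z) = 0" "\<rho> (shift i (-h) z) = 0" using S(2) step n by blast+
      ultimately show False using that by simp
    qed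
    have ck: "continuous_on UNIV ?k" and cl: "continuous_on UNIV ?l"
      by (intro continuous_intros cs)+
    have bk: "\<bar>?k z\<bar> \<le> M * h ^ 3" and bl: "\<bar>?l z\<bar> \<le> M * h ^ 3" for z
      using M(2)[where i=i and h=h and z=z] M(3)[where i=i and h=h and z=z] unfolding abs_of_pos[OF h(1)] .
    have "conv ?k f x = (conv (\<lambda>z. \<rho> (shift i h z)) f x - conv \<rho> f x) - (conv \<rho> f x - conv (\<lambda>z. \<rho> (shift i (-h) z)) f x)
       - h\<^sup>2 *\<^sub>R conv (real_partial i (real_partial i \<rho>)) f x"
      unfolding conv_def by (simp only: diff_add_eq scaleR_diff_left scaleR_scaleR[symmetric] Bochner_Integration.integral_diff
          Bochner_Integration.integrable_diff integrable_scaleR_right integral_scaleR_right int simp_thms)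
    moreover have "norm (conv ?k f x) \<le> M * h ^ 3 * N"
      unfolding N_def
      by (rule norm_conv_bound[OF f ck bk k0]) (use B[OF x] in auto)
    ultimately show "norm ((conv \<rho> f (shift i h x) - conv \<rho> f x) - (conv \<rho> f x - conv \<rho> f (shift i (-h) x))
       - h\<^sup>2 *\<^sub>R conv (real_partial i (real_partial i \<rho>)) f x) \<le> M * h ^ 3 * N"
      by (simp only: conv_kernel_shift)
    have "conv ?l f x = conv (\<lambda>z. \<rho> (shift i h z)) f x - conv (\<lambda>z. \<rho> (shift i (-h) z)) f x - (2 * h) *\<^sub>R conv (real_partial i \<rho>) f x"
      unfolding conv_def by (simp only: diff_add_eq scaleR_diff_left scaleR_scaleR[symmetric] Bochner_Integration.integral_diff
          Bochner_Integration.integrable_diff integrable_scaleR_right integral_scaleR_right int simp_thms)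
    moreover have "norm (conv ?l f x) \<le> M * h ^ 3 * N"
      unfolding N_def
      by (rule norm_conv_bound[OF f cl bl l0]) (use B[OF x] in auto)
    ultimately show "norm (conv \<rho> f (shift i h x) - conv \<rho> f (shift i (-h) x) - (2 * h) *\<^sub>R conv (real_partial i \<rho>) f x) \<le> M * h ^ 3 * N"
      by (simp only: conv_kernel_shift)
  qed
  define u where "u = conv \<rho> f"
  show ?thesis
  proof (intro exI allI impI)
    fix h :: real and x :: "real ^ 'n::{finite,one}"
    assume h: "0 < h" "h \<le> 1" and x: "x \<in> cube L"
    let ?a = "\<lambda>i. (1 / h\<^sup>2) *\<^sub>R ((u (shift i h x) - u x) - (u x - u (shift i (-h) x))) - conv (real_partial i (real_partial i \<rho>)) f x"
    let ?b = "(c / (2 * h)) *\<^sub>R (\<i> * (u (shift 1 h x) - u (shift 1 (-h) x))) - c *\<^sub>R (\<i> * conv (real_partial 1 \<rho>) f x)"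
    have a: "norm (?a i) \<le> (M * N) * h" for i
    proof -
      define d where "d = (u (shift i h x) - u x) - (u x - u (shift i (-h) x)) - h\<^sup>2 *\<^sub>R conv (real_partial i (real_partial i \<rho>)) f x"
      have d: "norm d \<le> M * h ^ 3 * N" using est(1)[OF h x, of i] unfolding d_def u_def .
      have "?a i = (1 / h\<^sup>2) *\<^sub>R d"
        using h by (simp add: d_def scaleR_diff_right)
      then have "norm (?a i) = (1 / h\<^sup>2) * norm d" by simp
      also have "\<dots> \<le> (1 / h\<^sup>2) * (M * h ^ 3 * N)"
        by (intro mult_left_mono d) simp
      also have "\<dots> = (M * N) * h" using h by (simp add: power2_eq_square power3_eq_cube)
      finally show ?thesis .
    qed
    have b: "norm ?b \<le> (c * M * N) * h"
    proof -
      define d where "d = u (shift 1 h x) - u (shift 1 (-h) x) - (2 * h) *\<^sub>R conv (real_partial 1 \<rho>) f x"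
      have d: "norm d \<le> M * h ^ 3 * N" using est(2)[OF h x, of 1] unfolding d_def u_def .
      have "?b = (c / (2 * h)) *\<^sub>R (\<i> * d)"
        using h by (simp add: d_def scaleR_conv_of_real field_simps)
      then have "norm ?b = (c / (2 * h)) * norm d"
        using c h by (simp add: norm_mult)
      also have "\<dots> \<le> (c / (2 * h)) * (M * h ^ 3 * N)"
        using c h by (intro mult_left_mono d) simp
      also have "\<dots> = (c * M * N / 2) * (h * h)" using h by (simp add: power3_eq_cube)
      also have "\<dots> \<le> (c * M * N) * h"
        using h c M N by (intro mult_mono) (auto simp: mult_le_cancel_right1)
      finally show ?thesis .
    qed
    have "difference_operator c h u x - ((\<Sum>i\<in>UNIV. conv (real_partial i (real_partial i \<rho>)) f x)
        + c *\<^sub>R (\<i> * conv (real_partial 1 \<rho>) f x) + u x) = (\<Sum>i\<in>UNIV. ?a i) + ?b"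
      unfolding difference_operator_def sum_subtractf by (simp only: algebra_simps)
    also have "norm \<dots> \<le> (\<Sum>i\<in>(UNIV :: 'n set). (M * N) * h) + (c * M * N) * h"
      by (intro order_trans[OF norm_triangle_ineq] add_mono sum_norm_le a b)
    also have "\<dots> = (real CARD('n) * (M * N) + c * M * N) * h" by (simp add: algebra_simps)
    finally show "norm (difference_operator c h (conv \<rho> f) x - ((\<Sum>i\<in>UNIV. conv (real_partial i (real_partial i \<rho>)) f x)
        + c *\<^sub>R (\<i> * conv (real_partial 1 \<rho>) f x) + conv \<rho> f x)) \<le> (real CARD('n) * (M * N) + c * M * N) * h"
      unfolding u_def .
  qed
qed

section \<open>Removing the mollification\<close>

lemma mollifier_AE_subseq:
  fixes f :: "real ^ 'n::finite \<Rightarrow> 'b::{banach, second_countable_topology}"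
  assumes m: "mollifier \<rho>" and f: "loc_int f" and r: "strict_mono (r :: nat \<Rightarrow> nat)"
  shows "\<exists>r'. strict_mono r' \<and>
    (AE x in lborel. x \<in> cball 0 B \<longrightarrow> (\<lambda>k. conv (\<rho> (r (r' k))) f x) \<longlonglongrightarrow> f x)"
proof -
  have rt: "\<rho> k \<in> real_tests" for k using m unfolding mollifier_def by auto
  let ?u = "\<lambda>k x. indicat_real (cball 0 B) x *\<^sub>R (conv (\<rho> (r k)) f x - f x)"
  have "\<exists>r'. strict_mono (r' :: nat \<Rightarrow> nat) \<and> (AE x in lborel. (\<lambda>k. ?u (r' k) x) \<longlonglongrightarrow> 0)"
  proof (rule tendsto_L1_AE_subseq)
    show "integrable lborel (?u k)" for k
      using loc_int_diff[OF continuous_loc_int[OF conv_continuous[OF f rt]] f]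
      by (auto simp: loc_int_def set_integrable_def)
    have "(\<lambda>k. LINT x:cball 0 B|lborel. norm (conv (\<rho> (r k)) f x - f x)) \<longlonglongrightarrow> 0"
      using LIMSEQ_subseq_LIMSEQ[OF mollifier_L1_local[OF m f] r] by (simp add: o_def)
    then show "(\<lambda>k. LINT x|lborel. norm (?u k x)) \<longlonglongrightarrow> 0"
      by (simp add: set_lebesgue_integral_def)
  qed
  then obtain r' where r': "strict_mono r'" "AE x in lborel. (\<lambda>k. ?u (r' k) x) \<longlonglongrightarrow> 0" by blast
  have "AE x in lborel. x \<in> cball 0 B \<longrightarrow> (\<lambda>k. conv (\<rho> (r (r' k))) f x) \<longlonglongrightarrow> f x"
    using r'(2)
  proof eventually_elim
    case (elim x)
    then show ?case by (auto simp: LIM_zero_iff)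
  qed
  with r'(1) show ?thesis by blast
qed

lemma cube_mollifier_L1:
  fixes f :: "real ^ 'n::finite \<Rightarrow> 'b::{banach, second_countable_topology}"
  assumes m: "mollifier \<rho>" and f: "loc_int f"
  shows "(\<lambda>k. cube_int L (\<lambda>x. norm (conv (\<rho> k) f x - f x))) \<longlonglongrightarrow> 0"
proof -
  have rt: "\<rho> k \<in> real_tests" for k using m unfolding mollifier_def by auto
  obtain B where B: "\<And>x :: real ^ 'n. x \<in> cube L \<Longrightarrow> norm x \<le> B"
    using bounded_cube unfolding bounded_iff by blast
  have l: "loc_int (\<lambda>x. norm (conv (\<rho> k) f x - f x))" for k
    using loc_int_norm[OF loc_int_diff[OF continuous_loc_int[OF conv_continuous[OF f rt]] f]] .
  have "cube_int L (\<lambda>x. norm (conv (\<rho> k) f x - f x)) \<le> (LINT x:cball 0 B|lborel. norm (conv (\<rho> k) f x - f x))" for k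
    unfolding cube_int_def set_lebesgue_integral_def
    using cube_integrable[OF l, of L k] l[of k] B
    by (intro integral_mono) (auto simp: set_integrable_def loc_int_def indicator_def)
  then show ?thesis
    by (intro tendsto_sandwich[OF _ _ tendsto_const mollifier_L1_local[OF m f, of B]])
      (auto intro!: always_eventually cube_int_nonneg)
qed

text \<open>Jensen's inequality for the square: the variance of f with respect to the density
\<rho>(x - y) is nonnegative.\<close>

lemma norm_conv_square_le:
  fixes f :: "real ^ 'n::finite \<Rightarrow> complex"
  assumes f: "loc_int f" and f2: "loc_int (\<lambda>x. (norm (f x))\<^sup>2)"
    and r: "\<rho> \<in> real_tests" "\<And>x. \<rho> x \<ge> 0" "(LINT x|lborel. \<rho> x) = 1"
  shows "(norm (conv \<rho> f x))\<^sup>2 \<le> conv \<rho> (\<lambda>y. (norm (f y))\<^sup>2) x"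
proof -
  define u where "u = conv \<rho> f x"
  have i1: "integrable lborel (\<lambda>y. \<rho> (x - y) *\<^sub>R f y)" by (rule real_tests_conv_integrable[OF f r(1)])
  have i2: "integrable lborel (\<lambda>y. \<rho> (x - y) *\<^sub>R (norm (f y))\<^sup>2)" by (rule real_tests_conv_integrable[OF f2 r(1)])
  have i3: "integrable lborel (\<lambda>y. \<rho> (x - y))"
    by (rule lborel_integrable_reflect[OF real_tests_integrable[OF r(1)]])
  have one: "(LINT y|lborel. \<rho> (x - y)) = 1"
    using lborel_integral_reflect[OF continuous_borel_measurable[OF real_tests_continuous[OF r(1)]]] r(3) by simp
  have i4: "integrable lborel (\<lambda>y. inner u (\<rho> (x - y) *\<^sub>R f y))" by (intro integrable_inner_right i1)
  \<comment> \<open>The variance, where u is the mean.\<close>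
  have "0 \<le> (LINT y|lborel. \<rho> (x - y) * (norm (f y - u))\<^sup>2)"
    by (rule Bochner_Integration.integral_nonneg) (simp add: r)
  also have "(\<lambda>y. \<rho> (x - y) * (norm (f y - u))\<^sup>2)
     = (\<lambda>y. \<rho> (x - y) *\<^sub>R (norm (f y))\<^sup>2 - 2 * inner u (\<rho> (x - y) *\<^sub>R f y) + (norm u)\<^sup>2 * \<rho> (x - y))"
    by (rule ext) (simp add: power2_norm_eq_inner inner_diff_left inner_diff_right inner_commute algebra_simps)
  also have "(LINT y|lborel. \<rho> (x - y) *\<^sub>R (norm (f y))\<^sup>2 - 2 * inner u (\<rho> (x - y) *\<^sub>R f y) + (norm u)\<^sup>2 * \<rho> (x - y))
     = conv \<rho> (\<lambda>y. (norm (f y))\<^sup>2) x - 2 * (LINT y|lborel. inner u (\<rho> (x - y) *\<^sub>R f y)) + (norm u)\<^sup>2"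
    unfolding conv_def using i2 i3 i4 one by simp
  also have "(LINT y|lborel. inner u (\<rho> (x - y) *\<^sub>R f y)) = inner u u"
    using integral_inner_right[OF i1, of u] by (simp add: u_def conv_def)
  finally show ?thesis by (simp add: u_def power2_norm_eq_inner)
qed

lemma loc_int_dominated:
  fixes f :: "real ^ 'n::finite \<Rightarrow> 'b::{banach, second_countable_topology}"
  assumes "f \<in> borel_measurable borel" "loc_int g" "\<And>x. norm (f x) \<le> g x"
  shows "loc_int f"
  unfolding loc_int_def set_integrable_def
proof (intro conjI allI assms(1))
  fix R
  note [measurable] = assms(1)
  show "integrable lborel (\<lambda>x. indicat_real (cball 0 R) x *\<^sub>R f x)"
  proof (rule Bochner_Integration.integrable_bound)
    show "integrable lborel (\<lambda>x. indicat_real (cball 0 R) x *\<^sub>R g x)"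
      using assms(2) by (simp add: loc_int_def set_integrable_def)
    show "AE x in lborel. norm (indicat_real (cball 0 R) x *\<^sub>R f x) \<le> norm (indicat_real (cball 0 R) x *\<^sub>R g x)"
      using assms(3) by (auto simp: indicator_def intro: order_trans[OF _ abs_ge_self])
  qed (use assms(1) in \<open>auto intro!: borel_measurable_scaleR borel_measurable_indicator\<close>)
qed

lemma loc_int_norm_diff_square:
  fixes f g :: "real ^ 'n::finite \<Rightarrow> complex"
  assumes [measurable]: "f \<in> borel_measurable borel" "g \<in> borel_measurable borel"
    and sq: "loc_int (\<lambda>x. (norm (f x))\<^sup>2)" "loc_int (\<lambda>x. (norm (g x))\<^sup>2)"
  shows "loc_int (\<lambda>x. (norm (f x - g x))\<^sup>2)"
proof (rule loc_int_dominated)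
  show "loc_int (\<lambda>x. 2 * (norm (f x))\<^sup>2 + 2 * (norm (g x))\<^sup>2)"
    by (intro loc_int_add loc_int_cmult sq)
  fix x
  have "(norm (f x - g x))\<^sup>2 \<le> (norm (f x) + norm (g x))\<^sup>2"
    by (intro power_mono norm_triangle_ineq4) auto
  also have "\<dots> \<le> 2 * (norm (f x))\<^sup>2 + 2 * (norm (g x))\<^sup>2"
    using sum_squares_bound[of "norm (f x)" "norm (g x)"] by (simp add: power2_sum)
  finally show "norm ((norm (f x - g x))\<^sup>2) \<le> 2 * (norm (f x))\<^sup>2 + 2 * (norm (g x))\<^sup>2"
    by simp
qed measurable

lemma cube_int_tendsto:
  fixes f :: "nat \<Rightarrow> real ^ 'n::finite \<Rightarrow> real"
  assumes m: "\<And>k. f k \<in> borel_measurable borel" "g \<in> borel_measurable borel"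
    and b: "loc_int b" "\<And>k x. \<bar>f k x\<bar> \<le> b x"
    and lim: "AE x in lborel. x \<in> cube L \<longrightarrow> (\<lambda>k. f k x) \<longlonglongrightarrow> g x"
  shows "(\<lambda>k. cube_int L (f k)) \<longlonglongrightarrow> cube_int L g"
  unfolding cube_int_def set_lebesgue_integral_def
proof (rule integral_dominated_convergence)
  note [measurable] = m
  show "integrable lborel (\<lambda>x. indicat_real (cube L) x *\<^sub>R b x)"
    using cube_integrable[OF b(1)] by (simp add: set_integrable_def)
  show "AE x in lborel. norm (indicat_real (cube L) x *\<^sub>R f k x) \<le> indicat_real (cube L) x *\<^sub>R b x" for k
    using b(2) by (auto simp: indicator_def)
  show "AE x in lborel. (\<lambda>k. indicat_real (cube L) x *\<^sub>R f k x) \<longlonglongrightarrow> indicat_real (cube L) x *\<^sub>R g x"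
    using lim by eventually_elim (auto simp: indicator_def)
qed (use m in measurable)

lemma cube_int_mono_AE:
  assumes "loc_int f" "loc_int g" "AE x in lborel. f x \<le> g x"
  shows "cube_int L f \<le> cube_int L g"
  unfolding cube_int_def set_lebesgue_integral_def
proof (rule integral_mono_AE)
  show "AE x in lborel. indicat_real (cube L) x *\<^sub>R f x \<le> indicat_real (cube L) x *\<^sub>R g x"
    using assms(3) by eventually_elim (auto simp: indicator_def)
qed (use cube_integrable[OF assms(1), of L] cube_integrable[OF assms(2), of L] in \<open>simp_all add: set_integrable_def\<close>)

lemma abs_cube_int_le: "\<bar>cube_int L f\<bar> \<le> cube_int L (\<lambda>x. \<bar>f x\<bar>)"
  unfolding cube_int_def set_lebesgue_integral_def
  using integral_norm_bound[of lborel "\<lambda>x. indicat_real (cube L) x *\<^sub>R f x"] by (simp add: abs_mult)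

lemma conv_periodic:
  fixes w :: "real ^ 'n::finite \<Rightarrow> 'b::{banach, second_countable_topology}"
  assumes w: "w \<in> borel_measurable borel" and r: "\<rho> \<in> real_tests"
    and per: "AE x in lborel. w (x + a) = w x"
  shows "conv \<rho> w (x + a) = conv \<rho> w x"
proof -
  note [measurable] = w
  have "conv \<rho> w (x + a) = conv \<rho> (\<lambda>y. w (y + a)) x" by (rule conv_shift[OF w r, symmetric])
  also have "\<dots> = conv \<rho> w x" by (rule conv_cong_AE[OF per _ w r]) measurable
  finally show ?thesis .
qed

text \<open>Apply \<open>energy_inequality\<close> to the mollification of w.  By Jensen the square of the mollified
w is bounded by the mollification of |w|^2, whose integral converges.  The mollified H converges in L1
and is paired with the bounded functions P w, which converge almost everywhere along a subsequence; in the limit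
this pairing is nonnegative and can be dropped.\<close>

lemma truncated_translation_estimate:
  fixes w H :: "real ^ 'n::{finite,one} \<Rightarrow> complex"
  assumes c: "c > 0" and R: "R > 0"
    and w: "loc_int w" "loc_int (\<lambda>x. (norm (w x))\<^sup>2)" and H: "loc_int H"
    and per: "\<And>i. AE x in lborel. w (shift i (2 * L) x) = w x"
    and mono: "\<And>x. 0 \<le> inner (H x) (w x)"
    and eq: "\<And>\<rho> x. \<rho> \<in> real_tests \<Longrightarrow> (\<Sum>i\<in>UNIV. conv (real_partial i (real_partial i \<rho>)) w x)
        + c *\<^sub>R (\<i> * conv (real_partial 1 \<rho>) w x) + conv \<rho> w x = conv \<rho> H x"
    and s: "0 < s" "s < 2 * L"
  shows "cube_int L (\<lambda>x. (norm (trunc R (w (shift j s x)) - trunc R (w x)))\<^sup>2)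
    \<le> s\<^sup>2 * ((c\<^sup>2 + 2) * cube_int L (\<lambda>x. (norm (w x))\<^sup>2))"
proof -
  obtain \<rho> :: "nat \<Rightarrow> real ^ 'n::{finite,one} \<Rightarrow> real" where m: "mollifier \<rho>"
    using mollifier_exists by blast
  have rt: "\<rho> k \<in> real_tests" and r0: "\<rho> k x \<ge> 0" and r1: "(LINT x|lborel. \<rho> k x) = 1" for k x
    using m unfolding mollifier_def by auto
  obtain B0 where B0: "\<And>x :: real ^ 'n::{finite,one}. x \<in> cube L \<Longrightarrow> norm x \<le> B0"
    using bounded_cube unfolding bounded_iff by blast
  \<comment> \<open>The ball contains the cube and its translate by s.\<close>
  obtain r where r: "strict_mono (r :: nat \<Rightarrow> nat)"
    and ae: "AE x in lborel. x \<in> cball 0 (B0 + s) \<longrightarrow> (\<lambda>k. conv (\<rho> (r k)) w x) \<longlonglongrightarrow> w x"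
    using mollifier_AE_subseq[OF m w(1) strict_mono_id] by auto
  define u where "u k = conv (\<rho> (r k)) w" for k
  define h where "h k = conv (\<rho> (r k)) H" for k
  define q where "q k = conv (\<rho> (r k)) (\<lambda>y. (norm (w y))\<^sup>2)" for k
  have cu: "continuous_on UNIV (u k)" and ch: "continuous_on UNIV (h k)" and cq: "continuous_on UNIV (q k)" for k
    unfolding u_def h_def q_def by (intro conv_continuous w H rt)+
  have ct: "continuous_on UNIV (\<lambda>x. trunc R (u k x))" for k
    by (rule continuous_on_compose2[OF continuous_trunc[OF R] cu]) auto
  have pu: "periodic (2 * L) (u k)" for k
    unfolding periodic_def u_def using conv_periodic[OF loc_int_measurable[OF w(1)] rt per] by blast
  note [measurable] = loc_int_measurable[OF w(1)] loc_int_measurable[OF H]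
    continuous_borel_measurable[OF cu] continuous_borel_measurable[OF ch] continuous_borel_measurable[OF ct]
    continuous_borel_measurable[OF continuous_on_shift[OF ct]]
  have mt [measurable]: "trunc R \<in> borel_measurable borel"
    by (rule borel_measurable_continuous_onI[OF continuous_trunc[OF R]])
  have lim: "AE x in lborel. x \<in> cube L \<longrightarrow> (\<lambda>k. trunc R (u k x)) \<longlonglongrightarrow> trunc R (w x)"
    "AE x in lborel. x \<in> cube L \<longrightarrow> (\<lambda>k. trunc R (u k (shift j s x))) \<longlonglongrightarrow> trunc R (w (shift j s x))"
  proof -
    have tl: "(\<lambda>k. trunc R (a k)) \<longlonglongrightarrow> trunc R b" if "a \<longlonglongrightarrow> b" for a b
      using continuous_on_tendsto_compose[OF continuous_trunc[OF R] that] by simp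
    show "AE x in lborel. x \<in> cube L \<longrightarrow> (\<lambda>k. trunc R (u k x)) \<longlonglongrightarrow> trunc R (w x)"
      using ae by eventually_elim (use B0 s in \<open>force intro!: tl simp: u_def\<close>)
    show "AE x in lborel. x \<in> cube L \<longrightarrow> (\<lambda>k. trunc R (u k (shift j s x))) \<longlonglongrightarrow> trunc R (w (shift j s x))"
      using AE_lborel_shift[OF ae, of "s *\<^sub>R axis j 1"]
    proof eventually_elim
      case (elim x)
      show ?case
      proof
        assume "x \<in> cube L"
        then have "norm (shift j s x) \<le> B0 + s"
          using B0[of x] s norm_triangle_ineq[of x "s *\<^sub>R axis j 1"] by simp
        then show "(\<lambda>k. trunc R (u k (shift j s x))) \<longlonglongrightarrow> trunc R (w (shift j s x))"
          using elim by (intro tl) (simp add: u_def)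
      qed
    qed
  qed
  have bR: "norm (trunc R z) \<le> R" for z using R by (intro norm_trunc_le) auto
  have lhs: "(\<lambda>k. cube_int L (\<lambda>x. (norm (trunc R (u k (shift j s x)) - trunc R (u k x)))\<^sup>2))
     \<longlonglongrightarrow> cube_int L (\<lambda>x. (norm (trunc R (w (shift j s x)) - trunc R (w x)))\<^sup>2)"
  proof (rule cube_int_tendsto)
    show "loc_int (\<lambda>x :: real ^ 'n::{finite,one}. (2 * R)\<^sup>2)" by (intro continuous_loc_int continuous_intros)
    show "\<bar>(norm (trunc R (u k (shift j s x)) - trunc R (u k x)))\<^sup>2\<bar> \<le> (2 * R)\<^sup>2" for k x
    proof -
      have "norm (trunc R (u k (shift j s x)) - trunc R (u k x)) \<le> 2 * R"
        using norm_triangle_ineq4[of "trunc R (u k (shift j s x))" "trunc R (u k x)"]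
          bR[of "u k (shift j s x)"] bR[of "u k x"] by linarith
      from power_mono[OF this norm_ge_zero, of 2] show ?thesis by simp
    qed
    show "AE x in lborel. x \<in> cube L \<longrightarrow> (\<lambda>k. (norm (trunc R (u k (shift j s x)) - trunc R (u k x)))\<^sup>2)
       \<longlonglongrightarrow> (norm (trunc R (w (shift j s x)) - trunc R (w x)))\<^sup>2"
      using lim by eventually_elim (auto intro!: tendsto_intros)
  qed measurable
  have limq: "(\<lambda>k. cube_int L (q k)) \<longlonglongrightarrow> cube_int L (\<lambda>x. (norm (w x))\<^sup>2)"
  proof -
    have A: "(\<lambda>k. cube_int L (\<lambda>x. norm (q k x - (norm (w x))\<^sup>2))) \<longlonglongrightarrow> 0"
      using LIMSEQ_subseq_LIMSEQ[OF cube_mollifier_L1[OF m w(2), of L] r] by (simp add: o_def q_def)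
    have B: "norm (cube_int L (q k) - cube_int L (\<lambda>x. (norm (w x))\<^sup>2)) \<le> cube_int L (\<lambda>x. norm (q k x - (norm (w x))\<^sup>2))" for k
      using abs_cube_int_le[of L "\<lambda>x. q k x - (norm (w x))\<^sup>2"]
      by (simp add: cube_int_diff[OF continuous_loc_int[OF cq] w(2)])
    have "(\<lambda>k. cube_int L (q k) - cube_int L (\<lambda>x. (norm (w x))\<^sup>2)) \<longlonglongrightarrow> 0"
      by (rule Lim_null_comparison[OF always_eventually[OF allI[OF B]] A])
    then show ?thesis by (simp only: LIM_zero_iff)
  qed
  have limh: "(\<lambda>k. cube_int L (\<lambda>x. inner (h k x) (trunc R (u k x)))) \<longlonglongrightarrow> cube_int L (\<lambda>x. inner (H x) (trunc R (w x)))"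
  proof -
    have lR: "loc_int (\<lambda>x. R * norm (H x))" by (intro loc_int_cmult loc_int_norm H)
    have dom: "norm (inner (H x) (trunc R z)) \<le> R * norm (H x)" for x z
      using Cauchy_Schwarz_ineq2[of "H x" "trunc R z"] mult_left_mono[OF bR[of z], of "norm (H x)"]
      by (simp add: mult.commute)
    have l1: "loc_int (\<lambda>x. inner (H x) (trunc R (u k x)))" for k
      by (rule loc_int_dominated[OF _ lR dom]) measurable
    have t1: "(\<lambda>k. cube_int L (\<lambda>x. inner (H x) (trunc R (u k x)))) \<longlonglongrightarrow> cube_int L (\<lambda>x. inner (H x) (trunc R (w x)))"
    proof (rule cube_int_tendsto[OF _ _ lR])
      show "AE x in lborel. x \<in> cube L \<longrightarrow> (\<lambda>k. inner (H x) (trunc R (u k x))) \<longlonglongrightarrow> inner (H x) (trunc R (w x))"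
        using lim(1) by eventually_elim (auto intro!: tendsto_intros)
      show "\<bar>inner (H x) (trunc R (u k x))\<bar> \<le> R * norm (H x)" for k x using dom by simp
    qed measurable
    have "(\<lambda>k. R * cube_int L (\<lambda>x. norm (h k x - H x))) \<longlonglongrightarrow> R * 0"
      using LIMSEQ_subseq_LIMSEQ[OF cube_mollifier_L1[OF m H, of L] r]
      by (intro tendsto_mult tendsto_const) (simp add: o_def h_def)
    then have A: "(\<lambda>k. R * cube_int L (\<lambda>x. norm (h k x - H x))) \<longlonglongrightarrow> 0" by simp
    have B: "norm (cube_int L (\<lambda>x. inner (h k x) (trunc R (u k x))) - cube_int L (\<lambda>x. inner (H x) (trunc R (u k x))))
        \<le> R * cube_int L (\<lambda>x. norm (h k x - H x))" for k
    proof -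
      have li: "loc_int (\<lambda>x. inner (h k x) (trunc R (u k x)))"
        by (intro continuous_loc_int continuous_intros ch ct)
      have ld: "loc_int (\<lambda>x. norm (h k x - H x))"
        by (intro loc_int_norm loc_int_diff continuous_loc_int ch H)
      have "cube_int L (\<lambda>x. inner (h k x) (trunc R (u k x))) - cube_int L (\<lambda>x. inner (H x) (trunc R (u k x)))
          = cube_int L (\<lambda>x. inner (h k x - H x) (trunc R (u k x)))"
        by (simp add: cube_int_diff[OF li l1, symmetric] inner_diff_left)
      also have "norm \<dots> \<le> cube_int L (\<lambda>x. \<bar>inner (h k x - H x) (trunc R (u k x))\<bar>)"
        using abs_cube_int_le by simp
      also have "\<dots> \<le> cube_int L (\<lambda>x. R * norm (h k x - H x))"
      proof (rule cube_int_mono[OF _ loc_int_cmult[OF ld]])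
        show pt: "\<bar>inner (h k x - H x) (trunc R (u k x))\<bar> \<le> R * norm (h k x - H x)" for x
          using Cauchy_Schwarz_ineq2[of "h k x - H x" "trunc R (u k x)"] mult_left_mono[OF bR[of "u k x"], of "norm (h k x - H x)"]
          by (simp add: mult.commute)
        show "loc_int (\<lambda>x. \<bar>inner (h k x - H x) (trunc R (u k x))\<bar>)"
          by (rule loc_int_dominated[OF _ loc_int_cmult[OF ld]]) (use pt in \<open>measurable, simp\<close>)
      qed
      finally show ?thesis by (simp add: cube_int_cmult)
    qed
    have "(\<lambda>k. cube_int L (\<lambda>x. inner (h k x) (trunc R (u k x))) - cube_int L (\<lambda>x. inner (H x) (trunc R (u k x)))) \<longlonglongrightarrow> 0"
      by (rule Lim_null_comparison[OF always_eventually[OF allI[OF B]] A])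
    from tendsto_add[OF this t1] show ?thesis by simp
  qed
  have each: "cube_int L (\<lambda>x. (norm (trunc R (u k (shift j s x)) - trunc R (u k x)))\<^sup>2)
     \<le> s\<^sup>2 * ((c\<^sup>2 + 2) * cube_int L (q k) - 2 * cube_int L (\<lambda>x. inner (h k x) (trunc R (u k x))))" for k
  proof -
    obtain C where C: "\<And>t x. 0 < t \<Longrightarrow> t \<le> 1 \<Longrightarrow> x \<in> cube L \<Longrightarrow> norm (difference_operator c t (u k) x - h k x) \<le> C * t"
      using difference_operator_conv_consistent[OF w(1) rt c, of L "r k"] eq[OF rt] unfolding u_def h_def by metis
    have "cube_int L (\<lambda>x. (norm (trunc R (u k (shift j s x)) - trunc R (u k x)))\<^sup>2)
     \<le> s\<^sup>2 * ((c\<^sup>2 + 2) * cube_int L (\<lambda>x. (norm (u k x))\<^sup>2) - 2 * cube_int L (\<lambda>x. inner (h k x) (trunc R (u k x))))"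
      by (rule energy_inequality[OF c R cu pu ch s C])
    moreover have "cube_int L (\<lambda>x. (norm (u k x))\<^sup>2) \<le> cube_int L (q k)"
      unfolding u_def q_def
      by (intro cube_int_mono norm_conv_square_le w rt r0 r1 continuous_loc_int continuous_intros conv_continuous)
    then have "(c\<^sup>2 + 2) * cube_int L (\<lambda>x. (norm (u k x))\<^sup>2) \<le> (c\<^sup>2 + 2) * cube_int L (q k)"
      by (intro mult_left_mono) auto
    then have "s\<^sup>2 * ((c\<^sup>2 + 2) * cube_int L (\<lambda>x. (norm (u k x))\<^sup>2) - 2 * cube_int L (\<lambda>x. inner (h k x) (trunc R (u k x))))
      \<le> s\<^sup>2 * ((c\<^sup>2 + 2) * cube_int L (q k) - 2 * cube_int L (\<lambda>x. inner (h k x) (trunc R (u k x))))"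
      by (intro mult_left_mono) auto
    ultimately show ?thesis by linarith
  qed
  have "(\<lambda>k. s\<^sup>2 * ((c\<^sup>2 + 2) * cube_int L (q k) - 2 * cube_int L (\<lambda>x. inner (h k x) (trunc R (u k x)))))
     \<longlonglongrightarrow> s\<^sup>2 * ((c\<^sup>2 + 2) * cube_int L (\<lambda>x. (norm (w x))\<^sup>2) - 2 * cube_int L (\<lambda>x. inner (H x) (trunc R (w x))))"
    by (intro tendsto_intros limq limh)
  then have "cube_int L (\<lambda>x. (norm (trunc R (w (shift j s x)) - trunc R (w x)))\<^sup>2)
    \<le> s\<^sup>2 * ((c\<^sup>2 + 2) * cube_int L (\<lambda>x. (norm (w x))\<^sup>2) - 2 * cube_int L (\<lambda>x. inner (H x) (trunc R (w x))))"
    using LIMSEQ_le[OF lhs] each by blast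
  also have "\<dots> \<le> s\<^sup>2 * ((c\<^sup>2 + 2) * cube_int L (\<lambda>x. (norm (w x))\<^sup>2))"
  proof -
    have "0 \<le> cube_int L (\<lambda>x. inner (H x) (trunc R (w x)))"
    proof (rule cube_int_nonneg)
      fix x
      obtain a where "a \<ge> 0" "trunc R (w x) = a *\<^sub>R w x" using trunc_pos_multiple[OF R] by blast
      then show "0 \<le> inner (H x) (trunc R (w x))" using mono[of x] by simp
    qed
    then show ?thesis by (intro mult_left_mono) auto
  qed
  finally show ?thesis .
qed

text \<open>Let the radius of truncation tend to infinity.  As the truncation is nonexpansive, the untruncated
integrand is a majorant.\<close>

lemma translation_estimate:
  fixes w H :: "real ^ 'n::{finite,one} \<Rightarrow> complex"
  assumes c: "c > 0"
    and w: "loc_int w" "loc_int (\<lambda>x. (norm (w x))\<^sup>2)" and H: "loc_int H"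
    and per: "\<And>i. AE x in lborel. w (shift i (2 * L) x) = w x"
    and mono: "\<And>x. 0 \<le> inner (H x) (w x)"
    and eq: "\<And>\<rho> x. \<rho> \<in> real_tests \<Longrightarrow> (\<Sum>i\<in>UNIV. conv (real_partial i (real_partial i \<rho>)) w x)
        + c *\<^sub>R (\<i> * conv (real_partial 1 \<rho>) w x) + conv \<rho> w x = conv \<rho> H x"
    and s: "0 < s" "s < 2 * L"
  shows "cube_int L (\<lambda>x. (norm (w (shift j s x) - w x))\<^sup>2)
    \<le> s\<^sup>2 * ((c\<^sup>2 + 2) * cube_int L (\<lambda>x. (norm (w x))\<^sup>2))"
proof -
  note [measurable] = loc_int_measurable[OF w(1)] loc_int_measurable[OF loc_int_shift[OF w(1)]]
  let ?R = "\<lambda>k. real (Suc k)"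
  have mt [measurable]: "trunc (?R k) \<in> borel_measurable borel" for k
    by (rule borel_measurable_continuous_onI[OF continuous_trunc]) simp
  have ev: "(\<lambda>k. trunc (?R k) z) \<longlonglongrightarrow> z" for z
  proof (rule tendsto_eventually)
    show "eventually (\<lambda>k. trunc (?R k) z = z) sequentially"
      using eventually_ge_at_top[of "nat \<lceil>norm z\<rceil>"] by eventually_elim (rule trunc_eq, linarith)
  qed
  have "(\<lambda>k. cube_int L (\<lambda>x. (norm (trunc (?R k) (w (shift j s x)) - trunc (?R k) (w x)))\<^sup>2))
     \<longlonglongrightarrow> cube_int L (\<lambda>x. (norm (w (shift j s x) - w x))\<^sup>2)"
  proof (rule cube_int_tendsto)
    show "loc_int (\<lambda>x. (norm (w (shift j s x) - w x))\<^sup>2)"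
      by (intro loc_int_norm_diff_square loc_int_shift[OF w(2), of "s *\<^sub>R axis j 1"] w(2)) measurable
    show "\<bar>(norm (trunc (?R k) (w (shift j s x)) - trunc (?R k) (w x)))\<^sup>2\<bar> \<le> (norm (w (shift j s x) - w x))\<^sup>2" for k x
      using trunc_nonexpansive[of "?R k"] by (auto intro: power_mono)
    show "AE x in lborel. x \<in> cube L \<longrightarrow> (\<lambda>k. (norm (trunc (?R k) (w (shift j s x)) - trunc (?R k) (w x)))\<^sup>2)
       \<longlonglongrightarrow> (norm (w (shift j s x) - w x))\<^sup>2"
      by (intro always_eventually allI impI tendsto_intros ev)
  qed measurable
  moreover have "cube_int L (\<lambda>x. (norm (trunc (?R k) (w (shift j s x)) - trunc (?R k) (w x)))\<^sup>2)
     \<le> s\<^sup>2 * ((c\<^sup>2 + 2) * cube_int L (\<lambda>x. (norm (w x))\<^sup>2))" for k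
    by (rule truncated_translation_estimate[OF c _ w H per mono eq s]) auto
  ultimately show ?thesis using LIMSEQ_le_const2 by blast
qed

section \<open>Solutions of small period\<close>

text \<open>The gradient of a convex function is monotone.  By a \<bullet> b \<le> (|a|^2 + |b|^2) / 2 the left-hand
side is at least (|a|^2 - |b|^2)^2 / 2.\<close>

lemma monotone_cubic:
  "0 \<le> inner ((norm a)\<^sup>2 *\<^sub>R a - (norm b)\<^sup>2 *\<^sub>R b) (a - b)" for a b :: complex
proof -
  define A where "A = (norm a)\<^sup>2"
  define B where "B = (norm b)\<^sup>2"
  have ab: "2 * inner a b \<le> A + B"
    using norm_cauchy_schwarz[of a b] sum_squares_bound[of "norm a" "norm b"] by (simp add: A_def B_def)
  have aa: "inner a a = A" and bb: "inner b b = B"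
    by (simp_all add: A_def B_def power2_norm_eq_inner)
  have "inner (A *\<^sub>R a - B *\<^sub>R b) (a - b) = A\<^sup>2 + B\<^sup>2 - (A + B) * inner a b"
    by (simp add: inner_diff_left inner_diff_right inner_commute aa bb algebra_simps power2_eq_square)
  moreover have "(A + B) * inner a b \<le> (A + B) * ((A + B) / 2)"
    using ab by (intro mult_left_mono) (auto simp: A_def B_def)
  moreover have "A\<^sup>2 + B\<^sup>2 - (A + B) * ((A + B) / 2) = (A - B)\<^sup>2 / 2"
    by (simp add: power2_eq_square field_simps)
  ultimately have "(A - B)\<^sup>2 / 2 \<le> inner (A *\<^sub>R a - B *\<^sub>R b) (a - b)" by linarith
  then show ?thesis using zero_le_power2[of "A - B"] unfolding A_def B_def by linarith
qed

text \<open>Kernels of the form \<open>real_partial i \<rho>\<close> stand for derivatives of the mollification, so this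
is the equation for \<psi> mollified by \<rho>.  It is what the weak formulation says for the test functions
y \<mapsto> \<rho>(x - y).\<close>

definition mollified_solution :: "real \<Rightarrow> (real ^ 'n::{finite,one} \<Rightarrow> complex) \<Rightarrow> bool"
  where "mollified_solution c \<psi> \<longleftrightarrow>
    loc_int \<psi> \<and> loc_int (\<lambda>x. (norm (\<psi> x))\<^sup>2) \<and> loc_int (\<lambda>x. (norm (\<psi> x))\<^sup>2 *\<^sub>R \<psi> x) \<and>
    (\<forall>\<rho>\<in>real_tests. \<forall>x. (\<Sum>i\<in>UNIV. conv (real_partial i (real_partial i \<rho>)) \<psi> x)
        + c *\<^sub>R (\<i> * conv (real_partial 1 \<rho>) \<psi> x) + conv \<rho> \<psi> x = conv \<rho> (\<lambda>x. (norm (\<psi> x))\<^sup>2 *\<^sub>R \<psi> x) x)"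

lemma AE_periodic_iterate:
  fixes f :: "real ^ 'n::finite \<Rightarrow> 'b"
  assumes "AE x in lborel. f (x + a) = f x"
  shows "AE x in lborel. f (x + real k *\<^sub>R a) = f x"
proof (induction k)
  case (Suc k)
  have "AE x in lborel. f (x + real k *\<^sub>R a + a) = f (x + real k *\<^sub>R a)"
    using AE_lborel_shift[OF assms, of "real k *\<^sub>R a"] .
  moreover have e: "x + real (Suc k) *\<^sub>R a = x + real k *\<^sub>R a + a" for x
    by (simp add: scaleR_add_left add.assoc add.commute)
  ultimately show ?case
    unfolding e using Suc by (auto elim: eventually_elim2)
qed simp

text \<open>The averaging argument.  The cube has side 2 N T, a multiple of T, and N is arbitrary in order to
exhaust the whole space; the smallness condition involves T only because all translations that occur are shorter
than T.\<close>

lemma fractional_period_on_cube: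
  fixes \<psi> :: "real ^ 'n::{finite,one} \<Rightarrow> complex"
  assumes c: "c > 0" and sol: "mollified_solution c \<psi>"
    and per: "\<And>i. AE x in lborel. \<psi> (shift i T x) = \<psi> x"
    and T: "T > 0" "T\<^sup>2 * (c\<^sup>2 + 2) < 1" and m: "m > 0" and N: "N > 0"
  shows "AE x in lborel. x \<in> cube (real N * T) \<longrightarrow> \<psi> (shift j (T / real m) x) = \<psi> x"
proof -
  define L where "L = real N * T"
  define s where "s = T / real m"
  define w where "w x = \<psi> (shift j s x) - \<psi> x" for x
  define F where "F x = (norm (\<psi> x))\<^sup>2 *\<^sub>R \<psi> x" for x
  define H where "H x = F (shift j s x) - F x" for x
  have s: "s > 0" using T m by (simp add: s_def)
  have loc: "loc_int \<psi>" "loc_int (\<lambda>x. (norm (\<psi> x))\<^sup>2)" "loc_int F"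
    and eq: "\<And>\<rho> x. \<rho> \<in> real_tests \<Longrightarrow> (\<Sum>i\<in>UNIV. conv (real_partial i (real_partial i \<rho>)) \<psi> x)
        + c *\<^sub>R (\<i> * conv (real_partial 1 \<rho>) \<psi> x) + conv \<rho> \<psi> x = conv \<rho> F x"
    using sol unfolding mollified_solution_def F_def[abs_def] by auto
  have sh: "loc_int (\<lambda>x. \<psi> (shift j s x))" "loc_int (\<lambda>x. F (shift j s x))"
    by (intro loc_int_shift loc)+
  have lw: "loc_int w" and lH: "loc_int H" unfolding w_def[abs_def] H_def[abs_def]
    by (intro loc_int_diff sh loc)+
  note [measurable] = loc_int_measurable[OF lw]
  have lw2: "loc_int (\<lambda>x. (norm (w x))\<^sup>2)"
    unfolding w_def
    by (intro loc_int_norm_diff_square loc_int_measurable sh loc loc_int_shift[OF loc(2), of "s *\<^sub>R axis j 1"])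
  \<comment> \<open>The equation is linear in the pair of w and H, so it passes to differences of translates.\<close>
  have weq: "(\<Sum>i\<in>UNIV. conv (real_partial i (real_partial i \<rho>)) w x)
        + c *\<^sub>R (\<i> * conv (real_partial 1 \<rho>) w x) + conv \<rho> w x = conv \<rho> H x" if r: "\<rho> \<in> real_tests" for \<rho> x
  proof -
    have cw: "conv \<kappa> w x = conv \<kappa> \<psi> (shift j s x) - conv \<kappa> \<psi> x" if "\<kappa> \<in> real_tests" for \<kappa>
      unfolding w_def[abs_def] by (simp add: conv_diff[OF sh(1) loc(1) that] conv_shift[OF loc_int_measurable[OF loc(1)] that])
    have cH: "conv \<rho> H x = conv \<rho> F (shift j s x) - conv \<rho> F x"
      unfolding H_def[abs_def] by (simp add: conv_diff[OF sh(2) loc(3) r] conv_shift[OF loc_int_measurable[OF loc(3)] r])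
    have rt: "real_partial i \<rho> \<in> real_tests" "real_partial i (real_partial i \<rho>) \<in> real_tests" for i
      using r real_tests_real_partial by auto
    show ?thesis
      unfolding cH eq[OF r, symmetric] cw[OF r] cw[OF rt(1)] cw[OF rt(2)] sum_subtractf
      by (simp add: algebra_simps)
  qed
  have wmono: "0 \<le> inner (H x) (w x)" for x
    unfolding H_def w_def F_def by (rule monotone_cubic)
  have per2: "AE x in lborel. \<psi> (shift i (2 * L) x) = \<psi> x" for i
    using AE_periodic_iterate[OF per[of i], where k = "2 * N"] by (simp add: L_def mult.assoc)
  have perw: "AE x in lborel. w (shift i (2 * L) x) = w x" for i
    using per2[of i] AE_lborel_shift[OF per2[of i], of "s *\<^sub>R axis j 1"]
  proof eventually_elim
    case (elim x)
    have "shift j s (shift i (2 * L) x) = shift i (2 * L) (shift j s x)"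
      by (simp only: add.assoc add.commute[of "s *\<^sub>R axis j 1"])
    with elim show ?case unfolding w_def by (simp only:)
  qed
  define W where "W = cube_int L (\<lambda>x. (norm (w x))\<^sup>2)"
  have W0: "W \<ge> 0" unfolding W_def by (rule cube_int_nonneg) simp
  have TL: "T < 2 * L" using T N by (simp add: L_def)
  have lsh: "loc_int (\<lambda>x. (norm (w x - w (shift j t x)))\<^sup>2)" for t
    by (intro loc_int_norm_diff_square loc_int_measurable loc_int_shift[OF lw, of "t *\<^sub>R axis j 1"]
        loc_int_shift[OF lw2, of "t *\<^sub>R axis j 1"] lw lw2)
  have each: "cube_int L (\<lambda>x. (norm (w x - w (shift j (real k * s) x)))\<^sup>2) \<le> T\<^sup>2 * (c\<^sup>2 + 2) * W" if k: "k < m" for k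
  proof (cases "k = 0")
    case True
    then show ?thesis using W0 by (simp add: cube_int_def set_lebesgue_integral_def)
  next
    case False
    have ks: "0 < real k * s" "real k * s \<le> T" using False s k T m by (auto simp: s_def field_simps)
    have "cube_int L (\<lambda>x. (norm (w (shift j (real k * s) x) - w x))\<^sup>2) \<le> (real k * s)\<^sup>2 * ((c\<^sup>2 + 2) * W)"
      unfolding W_def using ks TL by (intro translation_estimate[OF c lw lw2 lH perw wmono weq]) auto
    also have "\<dots> \<le> T\<^sup>2 * ((c\<^sup>2 + 2) * W)"
      using ks W0 by (intro mult_right_mono power_mono) auto
    finally show ?thesis by (simp add: norm_minus_commute mult.assoc)
  qed
  \<comment> \<open>Here the telescoping sum over one period enters.\<close>
  have "AE x in lborel. (real m)\<^sup>2 * (norm (w x))\<^sup>2 \<le> (\<Sum>k<m. real m * (norm (w x - w (shift j (real k * s) x)))\<^sup>2)"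
    using per[of j]
  proof eventually_elim
    case (elim x)
    have ms: "real m * s = T" using m by (simp add: s_def)
    have "(\<Sum>k<m. w (shift j (real k * s) x)) = (\<Sum>k<m. \<psi> (shift j (real (Suc k) * s) x) - \<psi> (shift j (real k * s) x))"
      by (intro sum.cong refl) (simp add: w_def algebra_simps)
    also have "\<dots> = \<psi> (shift j (real m * s) x) - \<psi> x"
      by (subst sum_lessThan_telescope) simp
    also have "\<dots> = 0" unfolding ms using elim by simp
    finally have z: "(\<Sum>k<m. w (shift j (real k * s) x)) = 0" .
    have "real m *\<^sub>R w x = (\<Sum>k<m. w x - w (shift j (real k * s) x))"
      by (simp add: sum_subtractf z scaleR_conv_of_real[where 'a=complex])
    then have "real m * norm (w x) = norm (\<Sum>k<m. w x - w (shift j (real k * s) x))"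
      by (metis norm_scaleR abs_of_nat)
    then have "real m * norm (w x) \<le> (\<Sum>k<m. norm (w x - w (shift j (real k * s) x)))"
      by (simp only: norm_sum)
    then have "(real m * norm (w x))\<^sup>2 \<le> (\<Sum>k<m. norm (w x - w (shift j (real k * s) x)))\<^sup>2"
      by (intro power_mono) auto
    also have "\<dots> \<le> (\<Sum>k<m. (norm (w x - w (shift j (real k * s) x)))\<^sup>2) * real (card {..<m})"
      by (rule sum_squared_le_sum_of_squares)
    finally show ?case by (simp add: sum_distrib_left mult.commute power_mult_distrib)
  qed
  then have "cube_int L (\<lambda>x. (real m)\<^sup>2 * (norm (w x))\<^sup>2)
     \<le> cube_int L (\<lambda>x. \<Sum>k<m. real m * (norm (w x - w (shift j (real k * s) x)))\<^sup>2)"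
    by (intro cube_int_mono_AE loc_int_cmult loc_int_sum lw2 lsh)
  also have "\<dots> = (\<Sum>k<m. real m * cube_int L (\<lambda>x. (norm (w x - w (shift j (real k * s) x)))\<^sup>2))"
    by (subst cube_int_sum) (auto intro!: loc_int_cmult lsh simp only: cube_int_cmult finite_lessThan)
  also have "\<dots> \<le> (\<Sum>k<m. real m * (T\<^sup>2 * (c\<^sup>2 + 2) * W))"
    by (intro sum_mono mult_left_mono each) auto
  also have "\<dots> = (real m)\<^sup>2 * (T\<^sup>2 * (c\<^sup>2 + 2) * W)" by (simp add: power2_eq_square)
  finally have "(real m)\<^sup>2 * W \<le> (real m)\<^sup>2 * (T\<^sup>2 * (c\<^sup>2 + 2) * W)"
    by (simp only: cube_int_cmult W_def)
  then have "W \<le> T\<^sup>2 * (c\<^sup>2 + 2) * W" using m by simp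
  then have "(1 - T\<^sup>2 * (c\<^sup>2 + 2)) * W \<le> 0" by (simp add: algebra_simps)
  then have "W = 0" using T(2) W0 by (simp add: mult_le_0_iff)
  then have "AE x in lborel. indicat_real (cube L) x *\<^sub>R (norm (w x))\<^sup>2 = 0"
    using integral_nonneg_eq_0_iff_AE[of lborel "\<lambda>x. indicat_real (cube L) x *\<^sub>R (norm (w x))\<^sup>2"]
      cube_integrable[OF lw2, of L]
    by (auto simp: W_def cube_int_def set_lebesgue_integral_def set_integrable_def)
  then show ?thesis
    by eventually_elim (auto simp: w_def s_def L_def indicator_def)
qed

lemma fractional_period:
  fixes \<psi> :: "real ^ 'n::{finite,one} \<Rightarrow> complex"
  assumes c: "c > 0" and sol: "mollified_solution c \<psi>"
    and per: "\<And>i. AE x in lborel. \<psi> (shift i T x) = \<psi> x"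
    and T: "T > 0" "T\<^sup>2 * (c\<^sup>2 + 2) < 1" and m: "m > 0"
  shows "AE x in lborel. \<psi> (shift j (T / real m) x) = \<psi> x"
proof -
  have "AE x in lborel. \<forall>N. x \<in> cube (real (Suc N) * T) \<longrightarrow> \<psi> (shift j (T / real m) x) = \<psi> x"
    unfolding AE_all_countable
    using fractional_period_on_cube[OF c sol per T m] by blast
  then show ?thesis
  proof eventually_elim
    case (elim x)
    obtain N where N: "real N > norm x / T" using reals_Archimedean2 by blast
    then have n: "norm x < real (Suc N) * T" using T(1) by (simp add: field_simps)
    have "x \<in> cube (real (Suc N) * T)"
      unfolding cube_def
    proof (safe)
      fix i
      have "\<bar>x $ i\<bar> < real (Suc N) * T" using component_le_norm_cart[of x i] n by linarith
      then show "- (real (Suc N) * T) \<le> x $ i" "x $ i < real (Suc N) * T" by linarith+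
    qed
    then show ?case using elim by blast
  qed
qed

text \<open>Multiples of the numbers T / m approximate every real number, so by continuity u is invariant under all
translations in coordinate directions, and these generate all translations.\<close>

lemma constant_of_small_periods:
  fixes u :: "real ^ 'n::finite \<Rightarrow> 'b::t2_space"
  assumes cont: "continuous_on UNIV u" and T: "T > 0"
    and per: "\<And>m j x. m > 0 \<Longrightarrow> u (shift j (T / real m) x) = u x"
  shows "u x = u 0"
proof -
  have nat: "u (shift j (real n * (T / real m)) x) = u x" if "m > 0" for n m j x
  proof (induction n)
    case (Suc n)
    have "shift j (real (Suc n) * (T / real m)) x = shift j (T / real m) (shift j (real n * (T / real m)) x)"
    proof -
      have "real (Suc n) * (T / real m) = real n * (T / real m) + T / real m"
        by (simp only: of_nat_Suc distrib_right mult_1 add.commute)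
      then show ?thesis by (simp only: scaleR_add_left add.assoc)
    qed
    then show ?case
      using per[OF that, where j=j and x="shift j (real n * (T / real m)) x"] Suc by (simp only:)
  qed simp
  have pos: "u (shift j t x) = u x" if t: "t \<ge> 0" for t j x
  proof -
    \<comment> \<open>The largest multiple of T / (m + 1) that does not exceed t.\<close>
    let ?t = "\<lambda>m. real (nat \<lfloor>t * real (Suc m) / T\<rfloor>) * (T / real (Suc m))"
    have lim: "?t \<longlonglongrightarrow> t"
    proof (rule tendsto_sandwich[of "\<lambda>m. t - T / real (Suc m)" _ _ "\<lambda>_. t"])
      show "(\<lambda>m. t - T / real (Suc m)) \<longlonglongrightarrow> t"
        using tendsto_diff[OF tendsto_const LIMSEQ_Suc[OF lim_const_over_n[of T]], of t] by simp
      have b: "t - T / real (Suc m) \<le> ?t m \<and> ?t m \<le> t" for m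
      proof -
        define p where "p = T / real (Suc m)"
        have p: "p > 0" using T by (simp add: p_def)
        have e: "t * real (Suc m) / T = t / p" using T by (simp add: p_def)
        have f: "real (nat \<lfloor>t / p\<rfloor>) = of_int \<lfloor>t / p\<rfloor>" using t p by simp
        have "of_int \<lfloor>t / p\<rfloor> * p \<le> t / p * p" using p by (intro mult_right_mono) auto
        moreover have "(t / p - 1) * p \<le> of_int \<lfloor>t / p\<rfloor> * p"
          using p by (intro mult_right_mono) linarith+
        ultimately show ?thesis
          using p unfolding e f p_def[symmetric] by (simp add: algebra_simps)
      qed
      show "\<forall>\<^sub>F m in sequentially. t - T / real (Suc m) \<le> ?t m" "\<forall>\<^sub>F m in sequentially. ?t m \<le> t"
        using b by auto
    qed auto
    have "(\<lambda>m. u (shift j (?t m) x)) \<longlonglongrightarrow> u (shift j t x)"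
      by (rule continuous_on_tendsto_compose[OF cont tendsto_add[OF tendsto_const tendsto_scaleR[OF lim tendsto_const]]]) auto
    moreover have "u (shift j (?t m) x) = u x" for m by (rule nat) simp
    ultimately have "(\<lambda>m. u x) \<longlonglongrightarrow> u (shift j t x)" by (simp only:)
    then show ?thesis by (rule LIMSEQ_unique[OF _ tendsto_const])
  qed
  have all: "u (shift j t x) = u x" for t j x
  proof (cases "t \<ge> 0")
    case False
    then show ?thesis using pos[where t="-t" and j=j and x="shift j t x"] by simp
  qed (rule pos)
  have "u (\<Sum>i\<in>S. x $ i *\<^sub>R axis i 1) = u 0" if "finite S" for S
    using that
  proof (induction S rule: finite_induct)
    case (insert i S)
    then show ?case using all[where j=i and t="x $ i" and x="\<Sum>i\<in>S. x $ i *\<^sub>R axis i 1"] by (simp add: add.commute)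
  qed simp
  from this[of UNIV] show ?thesis
    using basis_expansion[of x] by (simp add: scalar_mult_eq_scaleR)
qed

text \<open>The mollifications of \<psi> are continuous and inherit the periods T / m, hence they are constants.
Along a subsequence these constants converge to \<psi> almost everywhere on the unit ball, so they have a limit a; a further
subsequence on each larger ball shows that \<psi> = a there.\<close>

lemma mollified_solution_constant:
  fixes \<psi> :: "real ^ 'n::{finite,one} \<Rightarrow> complex"
  assumes c: "c > 0" and sol: "mollified_solution c \<psi>"
    and per: "\<And>i. AE x in lborel. \<psi> (shift i T x) = \<psi> x"
    and T: "T > 0" "T\<^sup>2 * (c\<^sup>2 + 2) < 1"
  shows "\<exists>b. AE x in lborel. \<psi> x = b"
proof -
  obtain \<rho> :: "nat \<Rightarrow> real ^ 'n::{finite,one} \<Rightarrow> real" where m: "mollifier \<rho>"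
    using mollifier_exists by blast
  have rt: "\<rho> k \<in> real_tests" for k using m unfolding mollifier_def by auto
  have loc: "loc_int \<psi>" using sol unfolding mollified_solution_def by blast
  define b where "b k = conv (\<rho> k) \<psi> 0" for k
  have const: "conv (\<rho> k) \<psi> x = b k" for k x
    unfolding b_def
  proof (rule constant_of_small_periods[OF conv_continuous[OF loc rt] T(1)])
    fix n :: nat and j x assume "n > 0"
    from fractional_period[OF c sol per T this]
    show "conv (\<rho> k) \<psi> (shift j (T / real n) x) = conv (\<rho> k) \<psi> x"
      by (rule conv_periodic[OF loc_int_measurable[OF loc] rt])
  qed
  obtain r where r: "strict_mono r"
    "AE x in lborel. x \<in> cball 0 1 \<longrightarrow> (\<lambda>k. b (r k)) \<longlonglongrightarrow> \<psi> x"
    using mollifier_AE_subseq[OF m loc strict_mono_id, of 1] unfolding const by auto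
  from r(2) have "AE x in lborel. x \<in> ball 0 1 \<longrightarrow> (\<lambda>k. b (r k)) \<longlonglongrightarrow> \<psi> x"
    by (rule eventually_mono) auto
  from AE_ball_nonempty[OF zero_less_one this] obtain a where a: "(\<lambda>k. b (r k)) \<longlonglongrightarrow> a"
    by blast
  have "AE x in lborel. x \<in> cball 0 (real N) \<longrightarrow> \<psi> x = a" for N
  proof -
    obtain r' where r': "strict_mono r'"
      "AE x in lborel. x \<in> cball 0 (real N) \<longrightarrow> (\<lambda>k. b (r (r' k))) \<longlonglongrightarrow> \<psi> x"
      using mollifier_AE_subseq[OF m loc r(1), of "real N"] unfolding const by auto
    have "(\<lambda>k. b (r (r' k))) \<longlonglongrightarrow> a" using LIMSEQ_subseq_LIMSEQ[OF a r'(1)] by (simp add: o_def)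
    note lim = this
    show ?thesis using r'(2)
    proof eventually_elim
      case (elim x)
      then show ?case using LIMSEQ_unique[OF _ lim] by blast
    qed
  qed
  then have "AE x in lborel. \<forall>N. x \<in> cball 0 (real N) \<longrightarrow> \<psi> x = a"
    unfolding AE_all_countable by blast
  then have "AE x in lborel. \<psi> x = a"
    by eventually_elim (meson mem_cball_0 real_arch_simple)
  then show ?thesis by blast
qed

section \<open>Mollification of weak solutions\<close>

text \<open>Replacing a solution by a Borel representative makes Fubini's theorem and translations of the argument directly
applicable.\<close>

lemma lebesgue_complex_borel_representative:
  fixes f :: "'a::euclidean_space \<Rightarrow> complex"
  assumes [measurable]: "f \<in> borel_measurable lebesgue"
  shows "\<exists>g. g \<in> borel_measurable borel \<and> (AE x in lborel. f x = g x)"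
proof -
  have "(\<lambda>x. Re (f x)) \<in> borel_measurable lebesgue" "(\<lambda>x. Im (f x)) \<in> borel_measurable lebesgue"
    by measurable
  from this[THEN completion_ex_borel_measurable_real]
  obtain g1 g2 where g: "g1 \<in> borel_measurable lborel" "AE x in lborel. Re (f x) = g1 x"
      "g2 \<in> borel_measurable lborel" "AE x in lborel. Im (f x) = g2 x"
    by blast
  have "(\<lambda>x. complex_of_real (g1 x) + \<i> * complex_of_real (g2 x)) \<in> borel_measurable borel"
    using g(1,3) by measurable
  moreover have "AE x in lborel. f x = complex_of_real (g1 x) + \<i> * complex_of_real (g2 x)"
    using g(2,4) by eventually_elim (simp add: complex_eq_iff)
  ultimately show ?thesis by blast
qed

lemma test_functions_lebesgue_measurable:
  assumes "\<phi> \<in> test_functions" shows "\<phi> \<in> borel_measurable lebesgue"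
  using continuous_borel_measurable[OF test_functions_continuous[OF assms]]
  by (intro measurable_completion) simp

lemma test_functions_bounded:
  assumes "\<phi> \<in> test_functions"
  shows "\<exists>M L. 0 < M \<and> 0 < L \<and> (\<forall>x. norm (\<phi> x) \<le> M * indicator (cball 0 L) x)"
proof -
  obtain L where L: "L > 0" "\<And>x. \<phi> x \<noteq> 0 \<Longrightarrow> norm x \<le> L"
    using test_functions_compact_support[OF assms] by blast
  have "continuous_on UNIV (\<lambda>x. norm (\<phi> x))"
    using test_functions_continuous[OF assms] by (intro continuous_intros)
  then obtain M where M: "M > 0" "\<And>x. \<bar>norm (\<phi> x)\<bar> \<le> M"
    using continuous_compact_support_bounded[of "\<lambda>x. norm (\<phi> x)" L] L(2) by auto
  have "norm (\<phi> x) \<le> M * indicator (cball 0 L) x" for x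
    using M(2)[of x] L(2)[of x] by (cases "\<phi> x = 0") (auto simp: indicator_def M(1) less_imp_le)
  with M(1) L(1) show ?thesis by blast
qed

lemma le_one_plus_square: "(a::real) \<le> 1 + a\<^sup>2"
proof -
  have "0 \<le> (a - 1/2)\<^sup>2" by simp
  also have "\<dots> = a\<^sup>2 - a + 1/4" by (simp add: power2_eq_square algebra_simps)
  finally show ?thesis by linarith
qed

lemma L2_loc_test_integrable:
  fixes g :: "real ^ 'n::finite \<Rightarrow> complex"
  assumes g: "g \<in> L2_loc" and \<phi>: "\<phi> \<in> test_functions"
  shows "integrable lebesgue (\<lambda>x. g x * \<phi> x)"
proof -
  obtain M L where M: "0 < M" "\<And>x. norm (\<phi> x) \<le> M * indicator (cball 0 L) x"
    using test_functions_bounded[OF \<phi>] by blast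
  have gm [measurable]: "g \<in> borel_measurable lebesgue" using g by (simp add: L2_loc_def)
  note [measurable] = test_functions_lebesgue_measurable[OF \<phi>]
  have i1: "integrable lebesgue (\<lambda>x. indicat_real (cball 0 L) x * (norm (g x))\<^sup>2)"
    using g compact_cball[of 0 L] unfolding L2_loc_def set_integrable_def by auto
  have i2: "integrable lebesgue (indicat_real (cball (0 :: real ^ 'n) L))"
    using emeasure_lborel_cball_finite[of "0 :: real ^ 'n" L]
    by (subst integrable_completion) (auto intro!: borel_measurable_indicator integrable_real_indicator)
  show ?thesis
  proof (rule Bochner_Integration.integrable_bound)
    show "integrable lebesgue (\<lambda>x. M * (indicat_real (cball 0 L) x + indicat_real (cball 0 L) x * (norm (g x))\<^sup>2))"
      using i1 i2 by simp
    have "norm (g x * \<phi> x) \<le> M * (indicat_real (cball 0 L) x + indicat_real (cball 0 L) x * (norm (g x))\<^sup>2)" for x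
    proof -
      have "norm (g x) \<le> 1 + (norm (g x))\<^sup>2"
        by (rule le_one_plus_square)
      then have "norm (g x) * norm (\<phi> x) \<le> (1 + (norm (g x))\<^sup>2) * (M * indicator (cball 0 L) x)"
        by (intro mult_mono M(2)) auto
      then show ?thesis by (simp add: norm_mult algebra_simps)
    qed
    then show "AE x in lebesgue. norm (g x * \<phi> x)
        \<le> norm (M * (indicat_real (cball 0 L) x + indicat_real (cball 0 L) x * (norm (g x))\<^sup>2))"
      using M(1) by (intro always_eventually allI) (simp add: abs_mult)
  qed measurable
qed

lemma lebesgue_integrable_cong_borel:
  fixes f g :: "'a::euclidean_space \<Rightarrow> 'b::{banach, second_countable_topology}"
  assumes "f \<in> borel_measurable lebesgue" "g \<in> borel_measurable borel" "AE x in lborel. f x = g x"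
  shows "integrable lebesgue f \<longleftrightarrow> integrable lborel g" "(LINT x|lebesgue. f x) = (LINT x|lborel. g x)"
proof -
  have g1: "g \<in> borel_measurable lborel" using assms(2) by simp
  then have g2: "g \<in> borel_measurable lebesgue" by (rule measurable_completion)
  have ae: "AE x in lebesgue. f x = g x" using assms(3) by (rule AE_completion)
  show "integrable lebesgue f \<longleftrightarrow> integrable lborel g"
    using integrable_cong_AE[OF assms(1) g2 ae] integrable_completion[OF g1] by simp
  show "(LINT x|lebesgue. f x) = (LINT x|lborel. g x)"
    using integral_cong_AE[OF assms(1) g2 ae] integral_completion[OF g1] by simp
qed

text \<open>The terms that contain a weak derivative are integrable because a locally square integrable function is
integrated against a bounded function with compact support.  Existence of the integral in the weak formulation therefore gives
integrability of the cubic term, and the weak derivatives can be moved to the test function.\<close>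

lemma weak_equation_tested:
  fixes \<psi> :: "real ^ 'n::{finite,one} \<Rightarrow> complex"
  assumes sol: "weak_periodic_solution c T \<psi>" and \<phi>: "\<phi> \<in> test_functions"
  shows "integrable lebesgue (\<lambda>x. of_real ((cmod (\<psi> x))\<^sup>2) * \<psi> x * \<phi> x)"
    and "(LINT x|lebesgue. of_real ((cmod (\<psi> x))\<^sup>2) * \<psi> x * \<phi> x)
      = - (\<i> * of_real c * (LINT x|lebesgue. \<psi> x * partial_deriv 1 \<phi> x))
        + (\<Sum>i\<in>UNIV. LINT x|lebesgue. \<psi> x * partial_deriv i (partial_deriv i \<phi>) x)
        + (LINT x|lebesgue. \<psi> x * \<phi> x)"
proof -
  obtain g where g: "\<And>i. g i \<in> L2_loc" "\<And>i. has_weak_partial i \<psi> (g i)"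
    and eq: "has_bochner_integral lebesgue
           (\<lambda>x. \<i> * of_real c * g 1 x * \<phi> x - (\<Sum>i\<in>UNIV. g i x * partial_deriv i \<phi> x)
                + of_real (1 - (cmod (\<psi> x))\<^sup>2) * \<psi> x * \<phi> x) 0"
    using sol \<phi> unfolding weak_periodic_solution_def by blast
  have \<psi>: "\<psi> \<in> L2_loc" using sol by (simp add: weak_periodic_solution_def H1_per_def H1_loc_def)
  note d\<phi> = test_functions_partial_deriv[OF \<phi>]
  let ?S = "\<lambda>x. \<i> * of_real c * g 1 x * \<phi> x - (\<Sum>i\<in>UNIV. g i x * partial_deriv i \<phi> x)
                + of_real (1 - (cmod (\<psi> x))\<^sup>2) * \<psi> x * \<phi> x"
  have S: "integrable lebesgue ?S" "(LINT x|lebesgue. ?S x) = 0"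
    using eq by (auto simp: has_bochner_integral_iff)
  have i1: "integrable lebesgue (\<lambda>x. g i x * \<phi> x)" "integrable lebesgue (\<lambda>x. g i x * partial_deriv i \<phi> x)"
    "integrable lebesgue (\<lambda>x. \<psi> x * \<phi> x)" for i
    by (intro L2_loc_test_integrable g \<psi> \<phi> d\<phi>)+
  have i2: "integrable lebesgue (\<lambda>x. (\<i> * of_real c) * (g 1 x * \<phi> x))"
    "integrable lebesgue (\<lambda>x. \<Sum>i\<in>UNIV. g i x * partial_deriv i \<phi> x)"
    by (intro integrable_mult_right i1 Bochner_Integration.integrable_sum)+
  \<comment> \<open>The cubic term is the rest of the weak formulation when all other terms are moved to the other side.\<close>
  have split: "(\<lambda>x. of_real ((cmod (\<psi> x))\<^sup>2) * \<psi> x * \<phi> x)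
      = (\<lambda>x. ((\<i> * of_real c) * (g 1 x * \<phi> x) - (\<Sum>i\<in>UNIV. g i x * partial_deriv i \<phi> x) + \<psi> x * \<phi> x) - ?S x)"
    by (rule ext) (simp add: algebra_simps)
  show "integrable lebesgue (\<lambda>x. of_real ((cmod (\<psi> x))\<^sup>2) * \<psi> x * \<phi> x)"
    unfolding split
    by (intro Bochner_Integration.integrable_diff Bochner_Integration.integrable_add i1(3) i2 S(1))
  have w1: "(LINT x|lebesgue. g i x * \<phi> x) = - (LINT x|lebesgue. \<psi> x * partial_deriv i \<phi> x)"
    and w2: "(LINT x|lebesgue. g i x * partial_deriv i \<phi> x) = - (LINT x|lebesgue. \<psi> x * partial_deriv i (partial_deriv i \<phi>) x)" for i
  proof -
    have "(LINT x|lebesgue. \<psi> x * partial_deriv i \<eta> x) = - (LINT x|lebesgue. g i x * \<eta> x)"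
      if "\<eta> \<in> test_functions" for \<eta>
      using g(2)[of i] that unfolding has_weak_partial_def by blast
    from this[OF \<phi>] this[OF d\<phi>[of i]]
    show "(LINT x|lebesgue. g i x * \<phi> x) = - (LINT x|lebesgue. \<psi> x * partial_deriv i \<phi> x)"
      "(LINT x|lebesgue. g i x * partial_deriv i \<phi> x) = - (LINT x|lebesgue. \<psi> x * partial_deriv i (partial_deriv i \<phi>) x)"
      by simp_all
  qed
  have "(LINT x|lebesgue. of_real ((cmod (\<psi> x))\<^sup>2) * \<psi> x * \<phi> x)
     = (\<i> * of_real c) * (LINT x|lebesgue. g 1 x * \<phi> x)
       - (\<Sum>i\<in>UNIV. LINT x|lebesgue. g i x * partial_deriv i \<phi> x) + (LINT x|lebesgue. \<psi> x * \<phi> x)"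
    unfolding split
    by (simp only: Bochner_Integration.integral_diff Bochner_Integration.integral_add Bochner_Integration.integrable_diff
        Bochner_Integration.integrable_add i1 i2 S integral_mult_right_zero Bochner_Integration.integral_sum diff_0_right simp_thms)
  then show "(LINT x|lebesgue. of_real ((cmod (\<psi> x))\<^sup>2) * \<psi> x * \<phi> x)
      = - (\<i> * of_real c * (LINT x|lebesgue. \<psi> x * partial_deriv 1 \<phi> x))
        + (\<Sum>i\<in>UNIV. LINT x|lebesgue. \<psi> x * partial_deriv i (partial_deriv i \<phi>) x)
        + (LINT x|lebesgue. \<psi> x * \<phi> x)"
    unfolding w1 w2 sum_negf by simp
qed

text \<open>Integrability against such a function implies integrability on the ball.\<close>

lemma test_function_positive_on_ball:
  "\<exists>\<phi>\<in>test_functions. \<exists>\<mu>>0. \<forall>x :: real ^ 'n::finite. norm x \<le> R \<longrightarrow> \<mu> \<le> norm (\<phi> x)"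
proof -
  obtain \<beta> :: "real ^ 'n \<Rightarrow> real" where b: "\<beta> \<in> real_tests" "\<And>x. (\<forall>j. \<bar>x $ j\<bar> < 1) \<Longrightarrow> \<beta> x > 0"
    using real_tests_bump_exists by blast
  define r where "r = 1 / (\<bar>R\<bar> + 1)"
  have r: "r > 0" by (simp add: r_def)
  define \<phi> where "\<phi> x = complex_of_real (1 * \<beta> (0 + r *\<^sub>R x))" for x
  have \<phi>: "\<phi> \<in> test_functions"
    using real_tests_affine(1)[OF b(1), of r 1 0] r unfolding real_tests_def \<phi>_def[abs_def] by simp
  have pos: "norm (\<phi> x) > 0" if "norm x \<le> R" for x
  proof -
    have "\<bar>(r *\<^sub>R x) $ j\<bar> < 1" for j
    proof -
      have "\<bar>(r *\<^sub>R x) $ j\<bar> \<le> r * norm x"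
        using component_le_norm_cart[of "r *\<^sub>R x" j] r by simp
      also have "\<dots> < 1" using that by (simp add: r_def field_simps)
      finally show ?thesis .
    qed
    then have "\<beta> (r *\<^sub>R x) > 0" by (intro b(2)) blast
    then show ?thesis by (simp add: \<phi>_def)
  qed
  have "\<exists>\<mu>>0. \<forall>x\<in>cball 0 R. \<mu> \<le> norm (\<phi> x)"
  proof (cases "cball (0 :: real ^ 'n) R = {}")
    case False
    have "continuous_on (cball 0 R) (\<lambda>x. norm (\<phi> x))"
      by (intro continuous_on_norm continuous_on_subset[OF test_functions_continuous[OF \<phi>]]) auto
    from continuous_attains_inf[OF compact_cball False this]
    obtain x0 where "x0 \<in> cball 0 R" "\<forall>x\<in>cball 0 R. norm (\<phi> x0) \<le> norm (\<phi> x)" by blast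
    then show ?thesis using pos[of x0] by (intro exI[of _ "norm (\<phi> x0)"]) auto
  qed (auto intro: exI[of _ 1])
  then obtain \<mu> where "\<mu> > 0" "\<forall>x\<in>cball 0 R. \<mu> \<le> norm (\<phi> x)" by blast
  then show ?thesis using \<phi> by (intro bexI[of _ \<phi>] exI[of _ \<mu>]) auto
qed

text \<open>Test the weak equation with y \<mapsto> \<rho>(x - y); the signs of the reflected derivatives cancel in the
second order term and compensate the integration by parts in the first order term.\<close>

lemma weak_solution_mollified:
  fixes \<psi> :: "real ^ 'n::{finite,one} \<Rightarrow> complex"
  assumes sol: "weak_periodic_solution c T \<psi>"
  shows "\<exists>u. mollified_solution c u \<and> (AE x in lborel. \<psi> x = u x) \<and>
    (\<forall>i. AE x in lborel. u (shift i T x) = u x)"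
proof -
  have L2: "\<psi> \<in> L2_loc" and per: "\<And>i. AE x in lebesgue. \<psi> (shift i T x) = \<psi> x"
    using sol by (auto simp: weak_periodic_solution_def H1_per_def H1_loc_def)
  have \<psi>m [measurable]: "\<psi> \<in> borel_measurable lebesgue" using L2 by (simp add: L2_loc_def)
  obtain u where um [measurable]: "u \<in> borel_measurable borel" and ae: "AE x in lborel. \<psi> x = u x"
    using lebesgue_complex_borel_representative[OF \<psi>m] by blast
  have per_u: "AE x in lborel. u (shift i T x) = u x" for i
  proof -
    have "AE x in lborel. \<psi> (shift i T x) = \<psi> x" using per[of i] by (simp add: AE_completion_iff)
    with ae AE_lborel_shift[OF ae, of "T *\<^sub>R axis i 1"] show ?thesis by eventually_elim simp
  qed
  have loc2: "loc_int (\<lambda>x. (norm (u x))\<^sup>2)"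
    unfolding loc_int_def set_integrable_def
  proof (intro conjI allI)
    fix R
    have [measurable]: "indicat_real (cball (0 :: real ^ 'n::{finite,one}) R) \<in> borel_measurable lebesgue"
      by (rule measurable_completion) (simp add: borel_measurable_indicator)
    have "integrable lebesgue (\<lambda>x. indicat_real (cball 0 R) x *\<^sub>R (norm (\<psi> x))\<^sup>2)"
      using L2 compact_cball[of 0 R] unfolding L2_loc_def set_integrable_def by auto
    then show "integrable lborel (\<lambda>x. indicat_real (cball 0 R) x *\<^sub>R (norm (u x))\<^sup>2)"
      by (subst (asm) lebesgue_integrable_cong_borel(1)[where g="\<lambda>x. indicat_real (cball 0 R) x *\<^sub>R (norm (u x))\<^sup>2"])
        (measurable, use ae in \<open>auto elim: eventually_mono\<close>)
  qed measurable
  have loc1: "loc_int u"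
  proof (rule loc_int_dominated)
    show "loc_int (\<lambda>x. 1 + (norm (u x))\<^sup>2)"
      by (intro loc_int_add loc2 continuous_loc_int continuous_intros)
    show "norm (u x) \<le> 1 + (norm (u x))\<^sup>2" for x
      by (rule le_one_plus_square)
  qed measurable
  let ?F = "\<lambda>x. (norm (u x))\<^sup>2 *\<^sub>R u x"
  have transfer: "(LINT x|lebesgue. \<psi> x * of_real (\<kappa> (x0 - x))) = conv \<kappa> u x0"
    if k: "\<kappa> \<in> real_tests" for \<kappa> x0
  proof -
    note [measurable] = continuous_borel_measurable[OF real_tests_continuous[OF k]]
    have [measurable]: "(\<lambda>x. complex_of_real (\<kappa> (x0 - x))) \<in> borel_measurable lebesgue"
      by (rule measurable_completion) measurable
    show ?thesis
      unfolding conv_def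
      by (rule lebesgue_integrable_cong_borel(2)) (measurable, use ae in \<open>auto elim!: eventually_mono simp: scaleR_conv_of_real mult.commute\<close>)
  qed
  have transferF: "(LINT x|lebesgue. of_real ((cmod (\<psi> x))\<^sup>2) * \<psi> x * of_real (\<kappa> (x0 - x))) = conv \<kappa> ?F x0"
    if k: "\<kappa> \<in> real_tests" for \<kappa> x0
  proof -
    note [measurable] = continuous_borel_measurable[OF real_tests_continuous[OF k]]
    have [measurable]: "(\<lambda>x. complex_of_real (\<kappa> (x0 - x))) \<in> borel_measurable lebesgue"
      by (rule measurable_completion) measurable
    show ?thesis
      unfolding conv_def
      by (rule lebesgue_integrable_cong_borel(2)) (measurable, use ae in \<open>auto elim!: eventually_mono simp: scaleR_conv_of_real mult_ac\<close>)
  qed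
  have locF: "loc_int ?F"
    unfolding loc_int_def set_integrable_def
  proof (intro conjI allI)
    fix R
    obtain \<phi> :: "real ^ 'n::{finite,one} \<Rightarrow> complex" and \<mu> where \<phi>: "\<phi> \<in> test_functions" "\<mu> > 0"
      "\<And>x. norm x \<le> R \<Longrightarrow> \<mu> \<le> norm (\<phi> x)"
      using test_function_positive_on_ball by blast
    note [measurable] = test_functions_lebesgue_measurable[OF \<phi>(1)]
      continuous_borel_measurable[OF test_functions_continuous[OF \<phi>(1)]]
    have "integrable lborel (\<lambda>x. of_real ((cmod (u x))\<^sup>2) * u x * \<phi> x)"
      using weak_equation_tested(1)[OF sol \<phi>(1)]
      by (subst (asm) lebesgue_integrable_cong_borel(1)[where g="\<lambda>x. of_real ((cmod (u x))\<^sup>2) * u x * \<phi> x"])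
        (measurable, use ae in \<open>auto elim: eventually_mono\<close>)
    then have int: "integrable lborel (\<lambda>x. (1 / \<mu>) * norm (of_real ((cmod (u x))\<^sup>2) * u x * \<phi> x))" by simp
    show "integrable lborel (\<lambda>x. indicat_real (cball 0 R) x *\<^sub>R ?F x)"
    proof (rule Bochner_Integration.integrable_bound[OF int])
      have "norm (indicat_real (cball 0 R) x *\<^sub>R ?F x) \<le> (1 / \<mu>) * norm (of_real ((cmod (u x))\<^sup>2) * u x * \<phi> x)" for x
      proof (cases "norm x \<le> R")
        case True
        have "\<mu> * norm (?F x) \<le> norm (\<phi> x) * norm (?F x)"
          using \<phi>(3)[OF True] by (intro mult_right_mono) auto
        then show ?thesis using True \<phi>(2) by (simp add: norm_mult field_simps del: of_real_power)
      qed (use \<phi>(2) in simp)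
      then show "AE x in lborel. norm (indicat_real (cball 0 R) x *\<^sub>R ?F x)
          \<le> norm ((1 / \<mu>) * norm (of_real ((cmod (u x))\<^sup>2) * u x * \<phi> x))"
        unfolding real_norm_def by (intro always_eventually allI order_trans[OF _ abs_ge_self])
    qed (intro borel_measurable_scaleR borel_measurable_indicator; simp)
  qed measurable
  have "(\<Sum>i\<in>UNIV. conv (real_partial i (real_partial i \<rho>)) u x)
        + c *\<^sub>R (\<i> * conv (real_partial 1 \<rho>) u x) + conv \<rho> u x = conv \<rho> ?F x" if r: "\<rho> \<in> real_tests" for \<rho> x
  proof -
    let ?\<phi> = "\<lambda>y. complex_of_real (\<rho> (x - y))"
    have rt: "(\<lambda>y. b * \<kappa> (x - y)) \<in> real_tests" if "\<kappa> \<in> real_tests" for \<kappa> b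
      using real_tests_affine(1)[OF that, where r="-1" and b=b and x=x] by simp
    have rd: "real_partial i (\<lambda>y. b * \<kappa> (x - y)) = (\<lambda>y. - b * real_partial i \<kappa> (x - y))" if "\<kappa> \<in> real_tests" for \<kappa> b i
      using real_tests_affine(2)[OF that, where r="-1" and b=b and x=x and i=i] by simp
    have \<phi>: "?\<phi> \<in> test_functions" using rt[OF r, where b=1] by (simp add: real_tests_def)
    have p1: "partial_deriv i ?\<phi> = (\<lambda>y. complex_of_real (-1 * real_partial i \<rho> (x - y)))" for i
      using partial_deriv_of_real[OF rt[OF r, where b=1], of i] rd[OF r, where i=i and b=1] by (auto simp: fun_eq_iff)
    have p2: "partial_deriv i (partial_deriv i ?\<phi>) = (\<lambda>y. complex_of_real (real_partial i (real_partial i \<rho>) (x - y)))" for i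
      unfolding p1
      using partial_deriv_of_real[OF rt[OF real_tests_real_partial[OF r], where b="-1"], of i] rd[OF real_tests_real_partial[OF r], where b="-1" and i=i]
      by (auto simp: fun_eq_iff)
    have m1: "(LINT y|lebesgue. \<psi> y * partial_deriv 1 ?\<phi> y) = - conv (real_partial 1 \<rho>) u x"
      unfolding p1 transfer[OF real_tests_real_partial[OF r], symmetric] by simp
    have m2: "(LINT y|lebesgue. \<psi> y * partial_deriv i (partial_deriv i ?\<phi>) y) = conv (real_partial i (real_partial i \<rho>)) u x" for i
      unfolding p2 by (rule transfer[OF real_tests_real_partial[OF real_tests_real_partial[OF r]]])
    show ?thesis
      using weak_equation_tested(2)[OF sol \<phi>]
      unfolding m1 m2 transfer[OF r] transferF[OF r]
      by (simp add: scaleR_conv_of_real mult_ac add_ac)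
  qed
  then have "mollified_solution c u"
    unfolding mollified_solution_def using loc1 loc2 locF by blast
  then show ?thesis using ae per_u by (intro exI[of _ u] conjI allI)
qed

section \<open>Small periods force constancy\<close>

lemma weak_periodic_solution_constant:
  fixes \<psi> :: "real ^ 'n::{finite,one} \<Rightarrow> complex"
  assumes c: "c > 0" and T: "0 < T" "T < 1 / sqrt (c\<^sup>2 + 2)" and sol: "weak_periodic_solution c T \<psi>"
  shows "ae_constant \<psi>"
proof -
  from weak_solution_mollified[OF sol] obtain u where u: "mollified_solution c u" "AE x in lborel. \<psi> x = u x"
    and per: "\<forall>i. AE x in lborel. u (shift i T x) = u x"
    by (elim exE conjE)
  have k: "c\<^sup>2 + 2 > 0" using zero_le_power2[of c] by linarith
  have "T\<^sup>2 < (1 / sqrt (c\<^sup>2 + 2))\<^sup>2"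
    using power_strict_mono[OF T(2) less_imp_le[OF T(1)], of 2] by simp
  also have "\<dots> = 1 / (c\<^sup>2 + 2)" using k by (simp add: power_divide)
  finally have "T\<^sup>2 * (c\<^sup>2 + 2) < 1" using k by (simp only: pos_less_divide_eq)
  from mollified_solution_constant[OF c u(1) per[rule_format] T(1) this]
  obtain b where "AE x in lborel. u x = b" by blast
  with u(2) have "AE x in lborel. \<psi> x = b" by eventually_elim simp
  then have "AE x in lebesgue. \<psi> x = b" by (rule AE_completion)
  then show ?thesis unfolding ae_constant_def by (rule exI)
qed

theorem theorem1p3:
  fixes c :: real
  assumes "c > 0"
  shows "(\<exists>Tstar>0. \<forall>T. 0 < T \<and> T < Tstar \<longrightarrow>
            (\<forall>\<psi> :: real ^ 2 \<Rightarrow> complex. weak_periodic_solution c T \<psi> \<longrightarrow> ae_constant \<psi>)) \<and>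
         (\<exists>Tstar>0. \<forall>T. 0 < T \<and> T < Tstar \<longrightarrow>
            (\<forall>\<psi> :: real ^ 3 \<Rightarrow> complex. weak_periodic_solution c T \<psi> \<longrightarrow> ae_constant \<psi>))"
proof -
  have "c\<^sup>2 + 2 > 0" using zero_le_power2[of c] by linarith
  then have pos: "1 / sqrt (c\<^sup>2 + 2) > 0" by simp
  have two: "ae_constant \<psi>" if "0 < T \<and> T < 1 / sqrt (c\<^sup>2 + 2)" "weak_periodic_solution c T \<psi>"
    for T and \<psi> :: "real ^ 2 \<Rightarrow> complex"
    using weak_periodic_solution_constant[OF assms conjunct1[OF that(1)] conjunct2[OF that(1)] that(2)] .
  have three: "ae_constant \<psi>" if "0 < T \<and> T < 1 / sqrt (c\<^sup>2 + 2)" "weak_periodic_solution c T \<psi>"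
    for T and \<psi> :: "real ^ 3 \<Rightarrow> complex"
    using weak_periodic_solution_constant[OF assms conjunct1[OF that(1)] conjunct2[OF that(1)] that(2)] .
  show ?thesis
  proof (rule conjI)
    show "\<exists>Tstar>0. \<forall>T. 0 < T \<and> T < Tstar \<longrightarrow>
            (\<forall>\<psi> :: real ^ 2 \<Rightarrow> complex. weak_periodic_solution c T \<psi> \<longrightarrow> ae_constant \<psi>)"
      by (rule exI, rule conjI, rule pos) (iprover intro: two)
    show "\<exists>Tstar>0. \<forall>T. 0 < T \<and> T < Tstar \<longrightarrow>
            (\<forall>\<psi> :: real ^ 3 \<Rightarrow> complex. weak_periodic_solution c T \<psi> \<longrightarrow> ae_constant \<psi>)"
      by (rule exI, rule conjI, rule pos) (iprover intro: three)
  qed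
qed

end
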